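(* Let $\Omega$, $\mathcal T_h$, $\mathbf V_h$, $a_h(\cdot,\cdot)$ and $\|\cdot\|_h$ be as in the context. There exist constants $\eta_1^*,\eta_2^*>0$ and $c>0$, depending only on the shape regularity of the meshes (and not on the mesh sizes or the polynomial degrees), such that whenever $\eta_1>\eta_1^*$ and $\eta_2>\eta_2^*$, $$a_h(\mathbf v,\mathbf v)\ \ge\ c\,\|\mathbf v\|_h^2\qquad\text{for all }\mathbf v\in\mathbf V_h .$$
   Context: $\Omega\subset\mathbb R^d$ ($d=2,3$) is a bounded simply-connected Lipschitz polygon/polyhedron; in $d=2$ the operator $\mathrm{curl}$ and the tangential trace $\times\mathbf n$ have their standard two-dimensional meanings. $\mathcal T_h$ is a shape-regular affine partition of $\Omega$ into triangles ($d=2$) or tetrahedra ($d=3$), possibly with hanging nodes; each $K\in\mathcal T_h$ has diameter $h_K$ and a polynomial degree $p_K\ge 2$. The DG space is $\mathbf V_h=\{\mathbf v\in\mathbf L^2(\Omega):\mathbf v|_K\in (P_{p_K}(K))^d\ \forall K\}$, $P_k$ being polynomials of total degree $\le k$. $\mathcal E_h$ is the set of faces (edges if $d=2$), interior ones $\mathcal E_h^0$ and boundary ones $\mathcal E_h^\partial$. For an interior face $f$ shared by $K^\pm$ with outward unit normals $\mathbf n^\pm$, set $h_f=\max(h_{K^+},h_{K^-})$, $p_f=\min(p_{K^+},p_{K^-})$, $\llbracket\mathbf v\rrbracket=\mathbf v^+\times\mathbf n^++\mathbf v^-\times\mathbf n^-$, $\llbracket\mathrm{curl}\,\mathbf v\rrbracket=\mathrm{curl}\,\mathbf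 v^+\times\mathbf n^++\mathrm{curl}\,\mathbf v^-\times\mathbf n^-$, $\{\mathrm{curl}^k\mathbf v\}=(\mathrm{curl}^k\mathbf v^++\mathrm{curl}^k\mathbf v^-)/2$ ($k=2,3$), where $\mathbf v^\pm$ are traces from $K^\pm$. On a boundary face $f\subset\partial K$ (normal $\mathbf n$): $h_f=h_K$, $p_f=p_K$, $\llbracket\mathbf v\rrbracket=\mathbf v\times\mathbf n$, $\llbracket\mathrm{curl}\,\mathbf v\rrbracket=\mathrm{curl}\,\mathbf v\times\mathbf n$, $\{\mathrm{curl}^k\mathbf v\}=\mathrm{curl}^k\mathbf v$. With elementwise (broken) curls $\mathrm{curl}_h$ and penalty parameters $\eta_1,\eta_2>0$, $$a_h(\mathbf w,\mathbf v)=\sum_K\int_K(\mathrm{curl}^2\mathbf w\cdot\mathrm{curl}^2\mathbf v+\mathbf w\cdot\mathbf v)+\sum_{f\in\mathcal E_h}\int_f\Big(\{\mathrm{curl}^3\mathbf w\}\cdot\llbracket\mathbf v\rrbracket+\{\mathrm{curl}^2\mathbf w\}\cdot\llbracket\mathrm{curl}\,\mathbf v\rrbracket+\{\mathrm{curl}^3\mathbf v\}\cdot\llbracket\mathbf w\rrbracket+\{\mathrm{curl}^2\mathbf v\}\cdot\llbracket\mathrm{curl}\,\mathbf w\rrbracket+\tfrac{\eta_1p_f^2}{h_f}\llbracket\mathrm{curl}\,\mathbf v\rrbracket\cdot\llbracket\mathrm{curl}\,\mathbf w\rrbracket+\tfrac{\eta_2p_f^6}{h_f^3}\llbracket\mathbf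 v\rrbracket\cdot\llbracket\mathbf w\rrbracket\Big)ds.$$ The DG norm is $\|\mathbf v\|_h^2=\sum_K(\|\mathrm{curl}^2\mathbf v\|_{0,K}^2+\|\mathbf v\|_{0,K}^2)+\sum_{f\in\mathcal E_h}\big(h_f^{-3}p_f^6\|\llbracket\mathbf v\rrbracket\|_{0,f}^2+h_f^3p_f^{-6}\|\{\mathrm{curl}^3\mathbf v\}\|_{0,f}^2+h_fp_f^{-2}\|\{\mathrm{curl}^2\mathbf v\}\|_{0,f}^2+h_f^{-1}p_f^2\|\llbracket\mathrm{curl}\,\mathbf v\rrbracket\|_{0,f}^2\big)$.
   Formalization: Shape regularity here also requires that diameters and polynomial degrees of elements sharing a face be comparable up to the shape-regularity constant; without this the claim fails, e.g. for a bubble-type field on a small or high-degree element next to a large or low-degree one. *)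

theory Defs
  imports "HOL-Analysis.Analysis"
begin

definition poly_le :: "nat \<Rightarrow> ((real,'n::finite) vec \<Rightarrow> real) \<Rightarrow> bool" where
  "poly_le k f \<longleftrightarrow> (\<exists>c :: ('n \<Rightarrow> nat) \<Rightarrow> real.
     \<forall>x. f x = (\<Sum>\<alpha>\<in>{\<alpha>. sum \<alpha> UNIV \<le> k}. c \<alpha> * (\<Prod>i\<in>UNIV. (x $ i) ^ (\<alpha> i))))"

text \<open>The i-th coordinate direction (i = 1..d); zero for i > d.  In d = 2 the
  third direction is 0, so every field is independent of a fictitious x3.\<close>
definition coord_dir :: "nat \<Rightarrow> (real,'n::{finite,linorder}) vec" where
  "coord_dir i = (if 1 \<le> i \<and> i \<le> CARD('n)
       then axis (sorted_list_of_set (UNIV::'n set) ! (i - 1)) 1 else 0)"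

text \<open>Embedding of R^d into R^3 (identity for d = 3, (y1,y2) to (y1,y2,0) for d = 2).
  Scalars of the 2D calculus are represented as (0,0,w); with this the 2D operators
  curl v = d1 v2 - d2 v1, curl w = (d2 w, -d1 w), v x n = v1 n2 - v2 n1 and
  w x n = (-w n2, w n1) are the restrictions of the 3D ones.\<close>
definition emb :: "(real,'n::{finite,linorder}) vec \<Rightarrow> real^3" where
  "emb y = vector [y \<bullet> coord_dir 1, y \<bullet> coord_dir 2, y \<bullet> coord_dir 3]"

definition pderiv_dir :: "(real,'n::finite) vec \<Rightarrow> ((real,'n) vec \<Rightarrow> real) \<Rightarrow> (real,'n) vec \<Rightarrow> real" where
  "pderiv_dir e f x = frechet_derivative f (at x) e"

definition pd :: "((real,'n::{finite,linorder}) vec \<Rightarrow> real^3) \<Rightarrow> nat \<Rightarrow> 3 \<Rightarrow> (real,'n) vec \<Rightarrow> real" where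
  "pd U i j x = pderiv_dir (coord_dir i) (\<lambda>y. U y $ j) x"

definition curl :: "((real,'n::{finite,linorder}) vec \<Rightarrow> real^3) \<Rightarrow> (real,'n) vec \<Rightarrow> real^3" where
  "curl U x = vector [pd U 2 3 x - pd U 3 2 x, pd U 3 1 x - pd U 1 3 x, pd U 1 2 x - pd U 2 1 x]"

definition simplex_verts :: "((real,'n::finite) vec) set \<Rightarrow> bool" where
  "simplex_verts S \<longleftrightarrow> finite S \<and> card S = CARD('n) + 1 \<and> \<not> affine_dependent S"

definition facet :: "((real,'n::finite) vec) set \<Rightarrow> (real,'n) vec \<Rightarrow> ((real,'n) vec) set" where
  "facet S s = convex hull (S - {s})"

definition outnormal :: "((real,'n::finite) vec) set \<Rightarrow> (real,'n) vec \<Rightarrow> (real,'n) vec" where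
  "outnormal S s = (THE \<nu>. norm \<nu> = 1 \<and> (\<forall>a\<in>S - {s}. \<forall>b\<in>S - {s}. \<nu> \<bullet> (a - b) = 0)
                         \<and> (\<forall>a\<in>S - {s}. \<nu> \<bullet> (s - a) < 0))"

definition hyp_off :: "((real,'n::finite) vec) set \<Rightarrow> (real,'n) vec \<Rightarrow> real" where
  "hyp_off S s = outnormal S s \<bullet> (SOME a. a \<in> S - {s})"

text \<open>Surface integral over a set A contained in the hyperplane {y. y . nu = c}
  (nu a unit vector): integral of g(projection) over the unit-height cylinder over A,
  which by Fubini equals the (d-1)-dimensional surface integral over A.\<close>
definition surf_int :: "(real,'n::finite) vec \<Rightarrow> real \<Rightarrow> ((real,'n) vec) set \<Rightarrow> ((real,'n) vec \<Rightarrow> real) \<Rightarrow> real" where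
  "surf_int \<nu> c A g = integral {a + t *\<^sub>R \<nu> | a t. a \<in> A \<and> t \<in> {0..1}}
                         (\<lambda>x. g (x - (x \<bullet> \<nu> - c) *\<^sub>R \<nu>))"

definition inradius :: "((real,'n::finite) vec) set \<Rightarrow> real" where
  "inradius K = Sup {r. \<exists>x. ball x r \<subseteq> K}"

definition lipschitz_domain :: "((real,'n::finite) vec) set \<Rightarrow> bool" where
  "lipschitz_domain \<Omega> \<longleftrightarrow> (\<forall>x\<in>frontier \<Omega>. \<exists>\<nu> r L g. norm \<nu> = 1 \<and> 0 < r \<and>
      L-lipschitz_on {z. z \<bullet> \<nu> = 0} g \<and>
      \<Omega> \<inter> ball x r = {y \<in> ball x r. y \<bullet> \<nu> < g (y - (y \<bullet> \<nu>) *\<^sub>R \<nu>)})"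

definition admissible_domain :: "((real,'n::finite) vec) set \<Rightarrow> bool" where
  "admissible_domain \<Omega> \<longleftrightarrow> open \<Omega> \<and> bounded \<Omega> \<and> connected \<Omega> \<and> simply_connected \<Omega>
      \<and> lipschitz_domain \<Omega>"

text \<open>T is a (possibly nonconforming, i.e. hanging-node) simplicial partition of Omega;
  each element is given by its vertex set S, the element being convex hull S.\<close>
definition mesh_of :: "((real,'n::finite) vec) set \<Rightarrow> ((real,'n) vec) set set \<Rightarrow> bool" where
  "mesh_of \<Omega> T \<longleftrightarrow> finite T \<and> T \<noteq> {} \<and> (\<forall>S\<in>T. simplex_verts S) \<and>
      (\<forall>S1\<in>T. \<forall>S2\<in>T. S1 \<noteq> S2 \<longrightarrow>
          interior (convex hull S1) \<inter> interior (convex hull S2) = {}) \<and>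
      (\<Union>S\<in>T. convex hull S) = closure \<Omega>"

definition face_neighbors :: "((real,'n::finite) vec) set \<Rightarrow> ((real,'n) vec) set \<Rightarrow> bool" where
  "face_neighbors S1 S2 \<longleftrightarrow> S1 \<noteq> S2 \<and> (\<exists>s1\<in>S1. \<exists>s2\<in>S2.
      surf_int (outnormal S1 s1) (hyp_off S1 s1) (facet S1 s1 \<inter> facet S2 s2) (\<lambda>_. 1) > 0)"

text \<open>Shape regularity with constant sigma: h_K / rho_K bounded, and (as needed with
  hanging nodes and variable degrees) local comparability of sizes and degrees of
  face-neighbouring elements.\<close>
definition shape_regular :: "real \<Rightarrow> ((real,'n::finite) vec) set set \<Rightarrow> (((real,'n) vec) set \<Rightarrow> nat) \<Rightarrow> bool" where
  "shape_regular \<sigma> T p \<longleftrightarrow>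
     (\<forall>S\<in>T. diameter (convex hull S) \<le> \<sigma> * inradius (convex hull S)) \<and>
     (\<forall>S1\<in>T. \<forall>S2\<in>T. face_neighbors S1 S2 \<longrightarrow>
        diameter (convex hull S1) \<le> \<sigma> * diameter (convex hull S2) \<and>
        real (p S1) \<le> \<sigma> * real (p S2))"

type_synonym 'n dgfun = "((real,'n) vec) set \<Rightarrow> (real,'n) vec \<Rightarrow> (real,'n) vec"

text \<open>An element of V_h is a family of polynomial vector fields G S (one per element,
  componentwise of total degree at most p S); v restricted to K = convex hull S is G S.\<close>
definition Vh :: "((real,'n::finite) vec) set set \<Rightarrow> (((real,'n) vec) set \<Rightarrow> nat) \<Rightarrow> 'n dgfun set" where
  "Vh T p = {G. \<forall>S\<in>T. \<forall>j. poly_le (p S) (\<lambda>x. G S x $ j)}"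

definition cu :: "nat \<Rightarrow> ('n::{finite,linorder}) dgfun \<Rightarrow> ((real,'n) vec) set \<Rightarrow> (real,'n) vec \<Rightarrow> real^3" where
  "cu k G S = (curl ^^ k) (\<lambda>x. emb (G S x))"

definition face_form :: "real \<Rightarrow> real \<Rightarrow> real \<Rightarrow> real \<Rightarrow>
    ((real,'n) vec \<Rightarrow> real^3) \<Rightarrow> ((real,'n) vec \<Rightarrow> real^3) \<Rightarrow> ((real,'n) vec \<Rightarrow> real^3) \<Rightarrow> ((real,'n) vec \<Rightarrow> real^3) \<Rightarrow>
    ((real,'n) vec \<Rightarrow> real^3) \<Rightarrow> ((real,'n) vec \<Rightarrow> real^3) \<Rightarrow> ((real,'n) vec \<Rightarrow> real^3) \<Rightarrow> ((real,'n) vec \<Rightarrow> real^3) \<Rightarrow>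
    (real,'n) vec \<Rightarrow> real" where
  "face_form \<eta>1 \<eta>2 hf pf jW jCW aW2 aW3 jV jCV aV2 aV3 x =
     aW3 x \<bullet> jV x + aW2 x \<bullet> jCV x + aV3 x \<bullet> jW x + aV2 x \<bullet> jCW x
     + \<eta>1 * pf ^ 2 / hf * (jCV x \<bullet> jCW x) + \<eta>2 * pf ^ 6 / hf ^ 3 * (jV x \<bullet> jW x)"

definition face_normsq :: "real \<Rightarrow> real \<Rightarrow>
    ((real,'n) vec \<Rightarrow> real^3) \<Rightarrow> ((real,'n) vec \<Rightarrow> real^3) \<Rightarrow> ((real,'n) vec \<Rightarrow> real^3) \<Rightarrow> ((real,'n) vec \<Rightarrow> real^3) \<Rightarrow>
    (real,'n) vec \<Rightarrow> real" where
  "face_normsq hf pf jV jCV aV2 aV3 x =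
     pf ^ 6 / hf ^ 3 * (norm (jV x))\<^sup>2 + hf ^ 3 / pf ^ 6 * (norm (aV3 x))\<^sup>2
     + hf / pf ^ 2 * (norm (aV2 x))\<^sup>2 + pf ^ 2 / hf * (norm (jCV x))\<^sup>2"

definition ijump :: "nat \<Rightarrow> ('n::{finite,linorder}) dgfun \<Rightarrow> ((real,'n) vec) set \<Rightarrow> (real,'n) vec \<Rightarrow>
    ((real,'n) vec) set \<Rightarrow> (real,'n) vec \<Rightarrow> (real,'n) vec \<Rightarrow> real^3" where
  "ijump k G S1 s1 S2 s2 x = cross3 (cu k G S1 x) (emb (outnormal S1 s1))
                            + cross3 (cu k G S2 x) (emb (outnormal S2 s2))"

definition iavg :: "nat \<Rightarrow> ('n::{finite,linorder}) dgfun \<Rightarrow> ((real,'n) vec) set \<Rightarrow> ((real,'n) vec) set \<Rightarrow>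
    (real,'n) vec \<Rightarrow> real^3" where
  "iavg k G S1 S2 x = (1/2) *\<^sub>R (cu k G S1 x + cu k G S2 x)"

definition bjump :: "nat \<Rightarrow> ('n::{finite,linorder}) dgfun \<Rightarrow> ((real,'n) vec) set \<Rightarrow> (real,'n) vec \<Rightarrow>
    (real,'n) vec \<Rightarrow> real^3" where
  "bjump k G S s x = cross3 (cu k G S x) (emb (outnormal S s))"

definition hface :: "((real,'n::finite) vec) set \<Rightarrow> ((real,'n) vec) set \<Rightarrow> real" where
  "hface S1 S2 = max (diameter (convex hull S1)) (diameter (convex hull S2))"

definition pface :: "(((real,'n::finite) vec) set \<Rightarrow> nat) \<Rightarrow> ((real,'n) vec) set \<Rightarrow> ((real,'n) vec) set \<Rightarrow> real" where
  "pface p S1 S2 = real (min (p S1) (p S2))"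

text \<open>Sums over interior faces are written as 1/2 times the sum over ordered pairs of
  element facets (each interior face f = facet S1 s1 inter facet S2 s2 is met twice;
  all summands are symmetric); boundary faces are facet S s inter the boundary of Omega.
  Pairs whose intersection has zero surface measure contribute 0.\<close>
definition ah :: "((real,'n::{finite,linorder}) vec) set \<Rightarrow> ((real,'n) vec) set set \<Rightarrow> (((real,'n) vec) set \<Rightarrow> nat) \<Rightarrow>
    real \<Rightarrow> real \<Rightarrow> 'n dgfun \<Rightarrow> 'n dgfun \<Rightarrow> real" where
  "ah \<Omega> T p \<eta>1 \<eta>2 W V =
     (\<Sum>S\<in>T. integral (convex hull S) (\<lambda>x. cu 2 W S x \<bullet> cu 2 V S x + W S x \<bullet> V S x))
   + (\<Sum>S1\<in>T. \<Sum>s1\<in>S1. \<Sum>S2\<in>T - {S1}. \<Sum>s2\<in>S2. (1/2) *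
        surf_int (outnormal S1 s1) (hyp_off S1 s1) (facet S1 s1 \<inter> facet S2 s2)
          (face_form \<eta>1 \<eta>2 (hface S1 S2) (pface p S1 S2)
             (ijump 0 W S1 s1 S2 s2) (ijump 1 W S1 s1 S2 s2) (iavg 2 W S1 S2) (iavg 3 W S1 S2)
             (ijump 0 V S1 s1 S2 s2) (ijump 1 V S1 s1 S2 s2) (iavg 2 V S1 S2) (iavg 3 V S1 S2)))
   + (\<Sum>S\<in>T. \<Sum>s\<in>S.
        surf_int (outnormal S s) (hyp_off S s) (facet S s \<inter> frontier \<Omega>)
          (face_form \<eta>1 \<eta>2 (diameter (convex hull S)) (real (p S))
             (bjump 0 W S s) (bjump 1 W S s) (cu 2 W S) (cu 3 W S)
             (bjump 0 V S s) (bjump 1 V S s) (cu 2 V S) (cu 3 V S)))"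

definition dg_normsq :: "((real,'n::{finite,linorder}) vec) set \<Rightarrow> ((real,'n) vec) set set \<Rightarrow> (((real,'n) vec) set \<Rightarrow> nat) \<Rightarrow>
    'n dgfun \<Rightarrow> real" where
  "dg_normsq \<Omega> T p V =
     (\<Sum>S\<in>T. integral (convex hull S) (\<lambda>x. (norm (cu 2 V S x))\<^sup>2 + (norm (V S x))\<^sup>2))
   + (\<Sum>S1\<in>T. \<Sum>s1\<in>S1. \<Sum>S2\<in>T - {S1}. \<Sum>s2\<in>S2. (1/2) *
        surf_int (outnormal S1 s1) (hyp_off S1 s1) (facet S1 s1 \<inter> facet S2 s2)
          (face_normsq (hface S1 S2) (pface p S1 S2)
             (ijump 0 V S1 s1 S2 s2) (ijump 1 V S1 s1 S2 s2) (iavg 2 V S1 S2) (iavg 3 V S1 S2)))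
   + (\<Sum>S\<in>T. \<Sum>s\<in>S.
        surf_int (outnormal S s) (hyp_off S s) (facet S s \<inter> frontier \<Omega>)
          (face_normsq (diameter (convex hull S)) (real (p S))
             (bjump 0 V S s) (bjump 1 V S s) (cu 2 V S) (cu 3 V S)))"

end

theory Submission
  imports Defs "HOL-Computational_Algebra.Polynomial"
begin

text \<open>The consistency terms are absorbed by Young's inequality once the averages
  $h^3 p^{-6} |\{curl^3 v\}|^2 + h p^{-2} |\{curl^2 v\}|^2$ on the faces are bounded by
  $|curl^2 v|^2$ on the adjacent elements. This needs two inverse inequalities with the
  optimal powers of the degree: the trace inequality (factor $p^2 / h$) and the $L^2$ Markov
  inequality (factor $p^4 / h^2$).

  In one dimension both follow from Cauchy--Schwarz in a basis of Legendre polynomials, for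
  which orthogonality to lower degrees alone gives the Legendre equation and then the exact
  size of the boundary values and of the derivative. On a simplex they are applied on line
  segments: parallel to the edges at a vertex $a$, on the part of the simplex where the
  barycentric coordinate of $a$ is at least $1 / (d + 1)$ (Markov), and along the rays from a
  facet to the opposite vertex (trace). Disjointness of the interiors and shape regularity bound
  the number of neighbours of an element by comparing volumes.\<close>

subsection \<open>Inverse inequalities for univariate polynomials\<close>

text \<open>The face weights dictate the powers. Only curl^2 v is measured in the volume, and curl^3
  v is one further curl of it, so its face average costs one Markov and one trace inequality,
  p^4/h^2 times p^2/h: exactly the inverse of the weight h^3 p^{-6}. Likewise p^2/h is the inverse
  of h p^{-2}. Losing a power of p in either inequality would make the coercivity constant depend on
  the degrees. Chords of a simplex can be arbitrarily short, while the Markov constant on a segment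
  is the inverse square of its length. Where the barycentric coordinate of \<open>a\<close> is at
  least 1/(d+1), this much weight can be moved from \<open>a\<close> to any other vertex, so
  segments in the edge directions are never short; hence the splitting by vertices. With hanging
  nodes a face is only a piece of a facet, so traces are estimated on arbitrary compact subsets of a
  facet. If Q bounds the averages by the energy, Young's inequality with parameter c consumes 2cQ of
  the energy while the norm claims c of it; c = 1/(2Q+1) balances the two.\<close>

definition unit_int :: "real poly \<Rightarrow> real" where
  "unit_int q = integral {0..1} (poly q)"

lemma poly_integrable: "poly q integrable_on {a..b::real}"
  by (intro integrable_continuous_interval continuous_intros)

lemma unit_int_add: "unit_int (q + r) = unit_int q + unit_int r"
  unfolding unit_int_def poly_add[abs_def] by (intro integral_add poly_integrable)

lemma unit_int_smult: "unit_int (smult c q) = c * unit_int q"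
  unfolding unit_int_def poly_smult[abs_def] by simp

lemma real_poly_ext: "(\<And>x. poly q x = poly r x) \<Longrightarrow> q = (r :: real poly)"
  by (simp add: poly_eq_poly_eq_iff[symmetric] fun_eq_iff)

lemma unit_int_minus: "unit_int (- q) = - unit_int q"
  using unit_int_smult[of "-1" q] by simp

lemma unit_int_diff: "unit_int (q - r) = unit_int q - unit_int r"
  using unit_int_add[of q "- r"] by (simp add: unit_int_minus)

lemma unit_int_pderiv: "unit_int (pderiv q) = poly q 1 - poly q 0"
proof -
  have "(poly (pderiv q) has_integral poly q 1 - poly q 0) {0..1}"
    by (intro fundamental_theorem_of_calculus)
       (auto simp flip: has_real_derivative_iff_has_vector_derivative
             intro!: has_field_derivative_at_within poly_DERIV)
  then show ?thesis unfolding unit_int_def by (rule integral_unique)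
qed

lemma unit_int_square_nonneg: "0 \<le> unit_int (q * q)"
  unfolding unit_int_def by (intro integral_nonneg poly_integrable) simp

lemma unit_int_square_eq_0: "unit_int (q * q) = 0 \<Longrightarrow> q = 0"
proof -
  assume "unit_int (q * q) = 0"
  then have "\<forall>x\<in>{0..1}. poly (q * q) x = 0"
    unfolding unit_int_def
    by (subst (asm) integral_eq_0_iff) (auto intro!: continuous_intros)
  then have "{0..1} \<subseteq> {x. poly q x = 0}" by auto
  then have "infinite {x. poly q x = 0}"
    using infinite_Icc[of "0::real" 1] infinite_super zero_less_one by blast
  then show "q = 0" using poly_roots_finite by blast
qed

section \<open>Legendre polynomials on [0,1]\<close>

definition deg_lt :: "nat \<Rightarrow> real poly \<Rightarrow> bool" where
  "deg_lt n q \<longleftrightarrow> (\<forall>i\<ge>n. coeff q i = 0)"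

lemma deg_lt_Suc_degree: "degree q \<le> n \<Longrightarrow> deg_lt (Suc n) q"
  by (auto simp: deg_lt_def intro: coeff_eq_0)

lemma deg_lt_step:
  assumes "deg_lt (Suc n) q" "deg_lt (Suc n) L" "coeff L n = 1"
  shows "deg_lt n (q - smult (coeff q n) L)"
  unfolding deg_lt_def
proof safe
  fix i assume "n \<le> i"
  then show "coeff (q - smult (coeff q n) L) i = 0"
    using assms by (cases "i = n") (auto simp: deg_lt_def)
qed

text \<open>Gram-Schmidt: the residual of x^n after projection is a monic polynomial
  \<open>L\<close> orthogonal to all lower degrees, and the next projection adds the component of
  \<open>q\<close> along it. The induction ranges over all \<open>q\<close> because its hypothesis
  is applied both to x^n and to \<open>q\<close>.\<close>

lemma orthogonal_projection_exists:
  "\<exists>r. deg_lt n r \<and> (\<forall>s. deg_lt n s \<longrightarrow> unit_int ((q - r) * s) = 0)"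
proof (induction n arbitrary: q)
  case 0
  \<comment> \<open>\<open>deg_lt 0\<close> singles out the zero polynomial, which
    \<open>degree\<close> cannot tell from the constants.\<close>
  have "deg_lt 0 s \<Longrightarrow> s = 0" for s by (auto simp: deg_lt_def poly_eq_iff)
  moreover have "unit_int 0 = 0" using unit_int_smult[of 0 0] by simp
  ultimately show ?case by (intro exI[of _ 0]) (fastforce simp: deg_lt_def)
next
  case (Suc n)
  obtain r' where r': "deg_lt n r'" "\<And>s. deg_lt n s \<Longrightarrow> unit_int ((monom 1 n - r') * s) = 0"
    using Suc by blast
  obtain r where r: "deg_lt n r" "\<And>s. deg_lt n s \<Longrightarrow> unit_int ((q - r) * s) = 0"
    using Suc by blast
  define L where "L = monom 1 n - r'"
  have L: "coeff L n = 1" "deg_lt (Suc n) L"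
    using r'(1) by (auto simp: L_def deg_lt_def)
  have L0: "unit_int (L * L) \<noteq> 0"
    using unit_int_square_eq_0[of L] L(1) by auto
  define c where "c = unit_int ((q - r) * L) / unit_int (L * L)"
  have "unit_int ((q - (r + smult c L)) * s) = 0" if s: "deg_lt (Suc n) s" for s
  proof -
    define s' where "s' = s - smult (coeff s n) L"
    have s': "deg_lt n s'" unfolding s'_def by (rule deg_lt_step) (use s L in auto)
    have s_eq: "s' + smult (coeff s n) L = s" by (simp add: s'_def)
    have "(q - (r + smult c L)) * (s' + smult (coeff s n) L) = (q - r) * s' + smult (coeff s n) ((q - r) * L)
        - smult c (L * s') - smult (c * coeff s n) (L * L)"
      by (rule real_poly_ext) (simp add: algebra_simps)
    then have "unit_int ((q - (r + smult c L)) * s) =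
      coeff s n * unit_int ((q - r) * L) - c * coeff s n * unit_int (L * L)"
      using r(2)[OF s'] r'(2)[OF s'] unfolding s_eq L_def[symmetric]
      by (simp only: unit_int_add unit_int_diff unit_int_smult)
    then show ?thesis using L0 by (simp add: c_def)
  qed
  moreover have "deg_lt (Suc n) (r + smult c L)"
    using r(1) L(2) by (auto simp: deg_lt_def)
  ultimately show ?case by blast
qed

text \<open>The monic multiple of the Legendre polynomial transported to [0,1], given by
  orthogonality alone instead of a formula or a recurrence.\<close>

definition is_legendre :: "nat \<Rightarrow> real poly \<Rightarrow> bool" where
  "is_legendre n L \<longleftrightarrow> coeff L n = 1 \<and> deg_lt (Suc n) L \<and> (\<forall>s. deg_lt n s \<longrightarrow> unit_int (L * s) = 0)"

lemma legendre_exists: "\<exists>L. is_legendre n L"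
proof -
  obtain r where r: "deg_lt n r" "\<And>s. deg_lt n s \<Longrightarrow> unit_int ((monom 1 n - r) * s) = 0"
    using orthogonal_projection_exists by blast
  then have "is_legendre n (monom 1 n - r)"
    by (auto simp: is_legendre_def deg_lt_def)
  then show ?thesis by blast
qed

lemma legendre_square_pos: "is_legendre n L \<Longrightarrow> 0 < unit_int (L * L)"
  using unit_int_square_eq_0[of L] unit_int_square_nonneg[of L]
  by (fastforce simp: is_legendre_def)

text \<open>The Sturm-Liouville operator of the Legendre polynomials on [0,1]. The coefficient x -
  x^2 vanishes at both ends, so integration by parts leaves no boundary terms.\<close>

definition legendre_op :: "real poly \<Rightarrow> real poly" where
  "legendre_op q = pderiv ([:0, 1, -1:] * pderiv q)"

text \<open>Coefficient n of the image involves only coefficients n and n + 1, so the operator does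
  not raise the degree, and it multiplies a leading coefficient by the eigenvalue -n(n + 1).\<close>

lemma coeff_legendre_op:
  "coeff (legendre_op q) n = (real n + 1) * ((real n + 1) * coeff q (Suc n) - real n * coeff q n)"
  by (cases n) (simp_all add: legendre_op_def coeff_pderiv coeff_pCons algebra_simps)

lemma legendre_op_symmetric: "unit_int (legendre_op q * r) = unit_int (q * legendre_op r)"
proof -
  have *: "unit_int (legendre_op q * r) = - unit_int ([:0, 1, -1:] * pderiv q * pderiv r)" for q r
    using unit_int_pderiv[of "([:0, 1, -1:] * pderiv q) * r"]
    by (subst (asm) pderiv_mult) (simp add: legendre_op_def unit_int_add algebra_simps)
  have "unit_int (legendre_op q * r) = - unit_int ([:0, 1, -1:] * pderiv q * pderiv r)" by (rule *)
  also have "[:0, 1, -1:] * pderiv q * pderiv r = [:0, 1, -1:] * pderiv r * pderiv q"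
    by (simp only: mult_ac)
  also have "- unit_int \<dots> = unit_int (legendre_op r * q)" by (rule *[symmetric])
  finally show ?thesis by (simp only: mult.commute)
qed

text \<open>The leading coefficients of the two sides agree, so their difference \<open>E\<close>
  has lower degree. By symmetry of the operator, the integral of E^2 reduces to \<open>L\<close>
  against \<open>E\<close> and against the image of \<open>E\<close>, both of degree below n; hence
  it vanishes.\<close>

lemma legendre_ode:
  assumes L: "is_legendre n L"
  shows "legendre_op L = smult (- (real n * (real n + 1))) L"
proof -
  define E where "E = legendre_op L + smult (real n * (real n + 1)) L"
  have E: "deg_lt n E"
    unfolding deg_lt_def
  proof safe
    fix i assume "n \<le> i"
    then show "coeff E i = 0" using L
      by (cases "i = n") (auto simp: E_def is_legendre_def deg_lt_def coeff_legendre_op)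
  qed
  have op: "deg_lt n (legendre_op s)" if "deg_lt n s" for s
    using that by (auto simp: deg_lt_def coeff_legendre_op)
  have "unit_int (E * E) = unit_int (L * legendre_op E) + real n * (real n + 1) * unit_int (L * E)"
    unfolding legendre_op_symmetric[symmetric]
    by (subst (2) E_def) (simp add: unit_int_add unit_int_smult algebra_simps)
  also have "\<dots> = 0" using L E op[OF E] by (simp add: is_legendre_def)
  finally have "E = 0" by (rule unit_int_square_eq_0)
  then show ?thesis by (simp add: E_def add_eq_0_iff)
qed

text \<open>The left side is the integral of the derivative of (2x - 1) L^2, as 2x - 1 is 1 and -1
  at the ends. Under the integral, (2x - 1) L' equals 2n L up to a remainder \<open>r\<close> of
  lower degree, to which \<open>L\<close> is orthogonal.\<close>

lemma legendre_boundary_values: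
  assumes L: "is_legendre n L"
  shows "(poly L 1)\<^sup>2 + (poly L 0)\<^sup>2 = (4 * real n + 2) * unit_int (L * L)"
proof -
  define r where "r = [:-1, 2:] * pderiv L - smult (2 * real n) L"
  have "deg_lt n r" unfolding deg_lt_def
  proof safe
    fix i assume "n \<le> i"
    then show "coeff r i = 0" using L
      by (cases i; cases "i = n") (auto simp: r_def is_legendre_def deg_lt_def coeff_pderiv coeff_pCons)
  qed
  then have r: "unit_int (L * r) = 0" using L by (simp add: is_legendre_def)
  have "pderiv ([:-1, 2:] * (L * L)) = smult (2 + 4 * real n) (L * L) + smult 2 (L * r)"
  proof -
    have e: "[:-1, 2:] * pderiv L = r + smult (2 * real n) L" by (simp add: r_def)
    have "pderiv ([:-1, 2:] * (L * L)) = smult 2 (L * L) + smult 2 (L * ([:-1, 2:] * pderiv L))"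
      unfolding pderiv_mult by (rule real_poly_ext) (simp add: pderiv_pCons algebra_simps)
    then show ?thesis unfolding e by - (rule real_poly_ext, simp add: algebra_simps)
  qed
  then have "poly ([:-1, 2:] * (L * L)) 1 - poly ([:-1, 2:] * (L * L)) 0
      = (2 + 4 * real n) * unit_int (L * L)"
    unfolding unit_int_pderiv[symmetric] by (simp only: unit_int_add unit_int_smult r)
  then show ?thesis by (simp add: power2_eq_square algebra_simps)
qed

text \<open>Integration by parts leaves only boundary terms, since L'' has lower degree. At 0 and 1
  the second-order term of the Legendre equation drops out, which expresses L' there by L.\<close>

lemma legendre_deriv_square:
  assumes L: "is_legendre n L"
  shows "unit_int (pderiv L * pderiv L) = real n * (real n + 1) * (4 * real n + 2) * unit_int (L * L)"
proof -
  have ode: "poly (legendre_op L) x = - (real n * (real n + 1)) * poly L x" for x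
    using legendre_ode[OF L] by simp
  have "poly (legendre_op L) 0 = poly (pderiv L) 0" "poly (legendre_op L) 1 = - poly (pderiv L) 1"
    by (simp_all only: legendre_op_def pderiv_mult) (simp_all add: pderiv_pCons)
  then have d: "poly (pderiv L) 0 = - (real n * (real n + 1)) * poly L 0"
    "poly (pderiv L) 1 = real n * (real n + 1) * poly L 1"
    using ode[of 0] ode[of 1] by simp_all
  have "deg_lt n (pderiv (pderiv L))"
    using L by (auto simp: is_legendre_def deg_lt_def coeff_pderiv)
  then have z: "unit_int (L * pderiv (pderiv L)) = 0" using L by (simp add: is_legendre_def)
  have "unit_int (pderiv L * pderiv L) = poly (L * pderiv L) 1 - poly (L * pderiv L) 0"
    unfolding unit_int_pderiv[symmetric] by (simp add: pderiv_mult unit_int_add z mult.commute)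
  also have "\<dots> = real n * (real n + 1) * ((poly L 1)\<^sup>2 + (poly L 0)\<^sup>2)"
    by (simp add: d power2_eq_square algebra_simps)
  finally show ?thesis by (simp add: legendre_boundary_values[OF L])
qed

text \<open>Cauchy-Schwarz when one orthogonal direction is added: \<open>N\<close> is the energy of
  the new basis vector, \<open>c\<close> the coordinate and \<open>a\<close> the functional on it;
  \<open>R\<close> is the energy of the rest, \<open>b\<close> the functional there and
  \<open>B\<close> its squared norm.\<close>

lemma cauchy_schwarz_step:
  fixes a b c N R B :: real
  assumes "0 < N" "0 \<le> R" "0 \<le> B" "b\<^sup>2 \<le> B * R"
  shows "(c * a + b)\<^sup>2 \<le> (B + a\<^sup>2 / N) * (c\<^sup>2 * N + R)"
proof -
  have "2 * (c * a) * b \<le> a\<^sup>2 / N * R + c\<^sup>2 * N * B"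
  proof -
    have "(2 * (c * a) * b)\<^sup>2 \<le> 4 * (c * a)\<^sup>2 * (B * R)"
      using assms(4) by (simp add: power_mult_distrib mult_left_mono)
    also have "\<dots> = 4 * ((a\<^sup>2 / N * R) * (c\<^sup>2 * N * B))"
      using assms(1) by (simp add: field_simps power2_eq_square)
    also have "\<dots> \<le> (a\<^sup>2 / N * R + c\<^sup>2 * N * B)\<^sup>2"
    proof -
      have "4 * (x * y) \<le> (x + y)\<^sup>2" for x y :: real
        using sum_squares_bound[of x y] by (simp add: power2_sum)
      then show ?thesis .
    qed
    finally show ?thesis
      by (rule power2_le_imp_le) (use assms in simp)
  qed
  moreover have "(B + a\<^sup>2 / N) * (c\<^sup>2 * N + R) = B * R + (a\<^sup>2 / N * R + c\<^sup>2 * N * B) + (c * a)\<^sup>2"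
    using assms(1) by (simp add: field_simps power2_eq_square)
  ultimately show ?thesis using assms(4) by (simp add: power2_sum)
qed

text \<open>The sum is the squared norm of \<phi> on polynomials of degree below n, computed in an
  orthogonal basis. Each induction step splits off the component along the Legendre polynomial of
  highest degree.\<close>

lemma legendre_functional_bound:
  fixes \<phi> :: "real poly \<Rightarrow> real"
  assumes L: "\<And>k. is_legendre k (L k)"
    and add: "\<And>q r. \<phi> (q + r) = \<phi> q + \<phi> r" and smult: "\<And>c q. \<phi> (smult c q) = c * \<phi> q"
  shows "deg_lt n q \<Longrightarrow> (\<phi> q)\<^sup>2 \<le> (\<Sum>k<n. (\<phi> (L k))\<^sup>2 / unit_int (L k * L k)) * unit_int (q * q)"
proof (induction n arbitrary: q)
  case 0
  then have "q = 0" by (auto simp: deg_lt_def poly_eq_iff)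
  then show ?case using smult[of 0 0] by simp
next
  case (Suc n)
  define c r where "c = coeff q n" and "r = q - smult (coeff q n) (L n)"
  have r: "deg_lt n r" unfolding r_def
    by (rule deg_lt_step) (use Suc.prems L[of n] in \<open>auto simp: is_legendre_def\<close>)
  have q: "q = smult c (L n) + r" by (simp add: c_def r_def)
  have o: "unit_int (L n * r) = 0" using L[of n] r by (simp add: is_legendre_def)
  have "q * q = smult (c\<^sup>2) (L n * L n) + r * r + smult (2 * c) (L n * r)"
    by (subst (1 2) q, rule real_poly_ext) (simp add: algebra_simps power2_eq_square)
  then have n: "unit_int (q * q) = c\<^sup>2 * unit_int (L n * L n) + unit_int (r * r)"
    by (simp add: unit_int_add unit_int_smult o)
  have f: "\<phi> q = c * \<phi> (L n) + \<phi> r" by (simp add: q add smult)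
  show ?case unfolding n f sum.lessThan_Suc
    by (rule cauchy_schwarz_step)
       (use Suc.IH[OF r] legendre_square_pos[OF L] unit_int_square_nonneg in
         \<open>auto intro!: sum_nonneg divide_nonneg_nonneg\<close>)
qed

text \<open>The functional is evaluation at 0. Dropping the value at 1 from the boundary identity
  bounds its normalised squares by 4k + 2, whose sum is quadratic in p.\<close>

lemma unit_trace_inequality:
  assumes "degree q \<le> p"
  shows "(poly q 0)\<^sup>2 \<le> 2 * (real p + 1)\<^sup>2 * unit_int (q * q)"
proof -
  obtain L where L: "\<And>k. is_legendre k (L k)" using legendre_exists by metis
  have "(poly q 0)\<^sup>2 \<le> (\<Sum>k<Suc p. (poly (L k) 0)\<^sup>2 / unit_int (L k * L k)) * unit_int (q * q)"
    by (rule legendre_functional_bound[where \<phi> = "\<lambda>q. poly q 0"])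
       (simp_all add: L assms deg_lt_Suc_degree)
  also have "\<dots> \<le> (\<Sum>k<Suc p. 4 * real k + 2) * unit_int (q * q)"
  proof (intro mult_right_mono sum_mono unit_int_square_nonneg)
    fix k
    have "(poly (L k) 0)\<^sup>2 \<le> (4 * real k + 2) * unit_int (L k * L k)"
      unfolding legendre_boundary_values[OF L, symmetric] by simp
    then show "(poly (L k) 0)\<^sup>2 / unit_int (L k * L k) \<le> 4 * real k + 2"
      using legendre_square_pos[OF L, of k] by (simp add: divide_le_eq)
  qed
  also have "(\<Sum>k<Suc p. 4 * real k + 2) = 2 * (real p + 1)\<^sup>2"
    by (induction p) (auto simp: power2_eq_square algebra_simps)
  finally show ?thesis .
qed

text \<open>The bound for the functionals q -> q'(x) is integrated over x. The constant becomes the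
  sum of the normalised energies of the derivatives, a squared Hilbert-Schmidt norm of
  differentiation, and this is still of order p^4.\<close>

lemma unit_markov_inequality:
  assumes "degree q \<le> p"
  shows "unit_int (pderiv q * pderiv q) \<le> (real p + 1) ^ 4 * unit_int (q * q)"
proof -
  obtain L where L: "\<And>k. is_legendre k (L k)" using legendre_exists by metis
  define R where "R = (\<Sum>k<Suc p. smult (1 / unit_int (L k * L k)) (pderiv (L k) * pderiv (L k)))"
  have "(poly (pderiv q) x)\<^sup>2 \<le>
      (\<Sum>k<Suc p. (poly (pderiv (L k)) x)\<^sup>2 / unit_int (L k * L k)) * unit_int (q * q)" for x
    by (rule legendre_functional_bound[where \<phi> = "\<lambda>q. poly (pderiv q) x"])
       (simp_all add: L assms deg_lt_Suc_degree pderiv_add pderiv_smult)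
  then have "poly (pderiv q * pderiv q) x \<le> poly (smult (unit_int (q * q)) R) x" for x
    by (simp add: R_def poly_sum power2_eq_square algebra_simps)
  then have "unit_int (pderiv q * pderiv q) \<le> unit_int (smult (unit_int (q * q)) R)"
    unfolding unit_int_def by (intro integral_le poly_integrable)
  also have "\<dots> = unit_int (q * q) * unit_int R" by (rule unit_int_smult)
  also have "unit_int R = (\<Sum>k<Suc p. unit_int (pderiv (L k) * pderiv (L k)) / unit_int (L k * L k))"
    unfolding R_def by (induction p) (simp_all add: unit_int_add unit_int_smult)
  also have "\<dots> = (\<Sum>k<Suc p. real k * (real k + 1) * (4 * real k + 2))"
    using legendre_square_pos[OF L] by (intro sum.cong refl) (simp add: legendre_deriv_square[OF L] less_imp_neq[symmetric])
  also have "\<dots> = real p * (real p + 1)\<^sup>2 * (real p + 2)"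
    by (induction p) (auto simp: power2_eq_square algebra_simps)
  also have "\<dots> = (real p + 1)\<^sup>2 * ((real p + 1)\<^sup>2 - 1)" by (simp add: power2_eq_square algebra_simps)
  finally have "unit_int (pderiv q * pderiv q) \<le> unit_int (q * q) * ((real p + 1)\<^sup>2 * ((real p + 1)\<^sup>2 - 1))" .
  also have "\<dots> \<le> unit_int (q * q) * (real p + 1) ^ 4"
    by (intro mult_left_mono unit_int_square_nonneg) (simp add: algebra_simps power2_eq_square power4_eq_xxxx)
  finally show ?thesis
    using unit_int_square_nonneg[of q] by (simp add: mult.commute)
qed

section \<open>Rescaling to intervals of any position and length\<close>

lemma unit_int_pcompose:
  assumes "0 < \<delta>"
  shows "unit_int (pcompose q [:u, \<delta>:]) = integral {u..u + \<delta>} (poly q) / \<delta>"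
proof -
  have "(poly q has_integral integral {u..u + \<delta>} (poly q)) (cbox u (u + \<delta>))"
    using poly_integrable[of q u "u + \<delta>"] by (simp add: integrable_integral)
  from has_integral_affinity[OF this, of \<delta> u]
  have "((\<lambda>x. poly q (\<delta> * x + u)) has_integral integral {u..u + \<delta>} (poly q) / \<delta>)
      ((\<lambda>x. (1 / \<delta>) *\<^sub>R x + - ((1 / \<delta>) *\<^sub>R u)) ` cbox u (u + \<delta>))"
    using assms by (simp add: field_simps)
  also have "(\<lambda>x. (1 / \<delta>) *\<^sub>R x + - ((1 / \<delta>) *\<^sub>R u)) ` cbox u (u + \<delta>) = {0..1}"
  proof -
    have "(\<lambda>x. (1 / \<delta>) *\<^sub>R x + - ((1 / \<delta>) *\<^sub>R u)) = (\<lambda>x. (1 / \<delta>) * x + - (u / \<delta>))" by auto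
    then show ?thesis using assms by (simp only: box_real image_affinity_atLeastAtMost) (simp add: field_simps)
  qed
  finally have "((\<lambda>x. poly q (\<delta> * x + u)) has_integral integral {u..u + \<delta>} (poly q) / \<delta>) {0..1}" .
  moreover have "poly (pcompose q [:u, \<delta>:]) = (\<lambda>x. poly q (\<delta> * x + u))"
    by (auto simp: poly_pcompose algebra_simps)
  ultimately show ?thesis unfolding unit_int_def by (simp add: integral_unique)
qed

lemma interval_trace_inequality:
  assumes "degree q \<le> p" "0 < \<delta>"
  shows "(poly q 0)\<^sup>2 \<le> 2 * (real p + 1)\<^sup>2 / \<delta> * integral {0..\<delta>} (\<lambda>t. (poly q t)\<^sup>2)"
proof -
  have "(poly q 0)\<^sup>2 = (poly (pcompose q [:0, \<delta>:]) 0)\<^sup>2" by (simp add: poly_pcompose)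
  also have "\<dots> \<le> 2 * (real p + 1)\<^sup>2 * unit_int (pcompose (q * q) [:0, \<delta>:])"
    unfolding pcompose_mult using assms by (intro unit_trace_inequality) (simp add: degree_pcompose)
  finally show ?thesis using unit_int_pcompose[of \<delta> "q * q" 0] assms
    by (simp add: power2_eq_square poly_mult[abs_def])
qed

lemma interval_markov_inequality:
  assumes "degree q \<le> p" "0 < \<delta>"
  shows "integral {u..u + \<delta>} (\<lambda>t. (poly (pderiv q) t)\<^sup>2)
    \<le> (real p + 1) ^ 4 / \<delta>\<^sup>2 * integral {u..u + \<delta>} (\<lambda>t. (poly q t)\<^sup>2)"
proof -
  define r where "r = pcompose q [:u, \<delta>:]"
  have "pderiv r = smult \<delta> (pcompose (pderiv q) [:u, \<delta>:])"
    by (simp add: r_def pderiv_pcompose pderiv_pCons)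
  then have "unit_int (pderiv r * pderiv r) = \<delta>\<^sup>2 * unit_int (pcompose (pderiv q * pderiv q) [:u, \<delta>:])"
    by (simp add: pcompose_mult unit_int_smult power2_eq_square)
  moreover have "unit_int (pderiv r * pderiv r) \<le> (real p + 1) ^ 4 * unit_int (pcompose (q * q) [:u, \<delta>:])"
    unfolding pcompose_mult r_def[symmetric]
    by (intro unit_markov_inequality) (use assms in \<open>simp add: r_def degree_pcompose\<close>)
  ultimately show ?thesis
    using unit_int_pcompose[of \<delta> "q * q" u] unit_int_pcompose[of \<delta> "pderiv q * pderiv q" u] assms
    by (simp add: power2_eq_square poly_mult[abs_def] field_simps)
qed

subsection \<open>Polynomials in several variables\<close>

lemma finite_multiindices: "finite {\<alpha> :: 'n::finite \<Rightarrow> nat. sum \<alpha> UNIV \<le> k}"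
proof (rule finite_subset)
  show "{\<alpha> :: 'n \<Rightarrow> nat. sum \<alpha> UNIV \<le> k} \<subseteq> (UNIV :: 'n set) \<rightarrow>\<^sub>E {..k}"
  proof (safe intro!: PiE_I)
    fix \<alpha> :: "'n \<Rightarrow> nat" and i assume "sum \<alpha> UNIV \<le> k"
    then show "\<alpha> i \<le> k" using member_le_sum[of i UNIV \<alpha>] by simp
  qed simp
  show "finite ((UNIV :: 'n set) \<rightarrow>\<^sub>E {..k})" by (intro finite_PiE) auto
qed

lemma poly_le_add:
  assumes "poly_le k f" "poly_le k g"
  shows "poly_le k (\<lambda>x. f x + g x)"
proof -
  obtain c d where "\<forall>x. f x = (\<Sum>\<alpha>\<in>{\<alpha>. sum \<alpha> UNIV \<le> k}. c \<alpha> * (\<Prod>i\<in>UNIV. (x $ i) ^ (\<alpha> i)))"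
    "\<forall>x. g x = (\<Sum>\<alpha>\<in>{\<alpha>. sum \<alpha> UNIV \<le> k}. d \<alpha> * (\<Prod>i\<in>UNIV. (x $ i) ^ (\<alpha> i)))"
    using assms unfolding poly_le_def by blast
  then show ?thesis unfolding poly_le_def
    by (intro exI[of _ "\<lambda>\<alpha>. c \<alpha> + d \<alpha>"]) (simp add: distrib_right sum.distrib)
qed

lemma poly_le_scale:
  assumes "poly_le k f"
  shows "poly_le k (\<lambda>x. a * f x)"
proof -
  obtain c where "\<forall>x. f x = (\<Sum>\<alpha>\<in>{\<alpha>. sum \<alpha> UNIV \<le> k}. c \<alpha> * (\<Prod>i\<in>UNIV. (x $ i) ^ (\<alpha> i)))"
    using assms unfolding poly_le_def by blast
  then show ?thesis unfolding poly_le_def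
    by (intro exI[of _ "\<lambda>\<alpha>. a * c \<alpha>"]) (simp add: sum_distrib_left mult.assoc)
qed

lemma poly_le_zero: "poly_le k (\<lambda>x. 0)"
  unfolding poly_le_def by (intro exI[of _ "\<lambda>\<alpha>. 0"]) simp

lemma poly_le_diff: "poly_le k f \<Longrightarrow> poly_le k g \<Longrightarrow> poly_le k (\<lambda>x. f x - g x)"
  using poly_le_add[of k f "\<lambda>x. - 1 * g x"] poly_le_scale[of k g "-1"] by simp

lemma poly_le_sum:
  "(\<And>i. i \<in> I \<Longrightarrow> poly_le k (f i)) \<Longrightarrow> poly_le k (\<lambda>x. \<Sum>i\<in>I. f i x)"
  by (induction I rule: infinite_finite_induct) (auto intro: poly_le_zero poly_le_add)

lemma poly_le_monomial:
  fixes \<beta> :: "'n::finite \<Rightarrow> nat"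
  assumes "sum \<beta> UNIV \<le> k"
  shows "poly_le k (\<lambda>x. \<Prod>i\<in>UNIV. (x $ i) ^ \<beta> i)"
  unfolding poly_le_def
proof (intro exI[of _ "\<lambda>\<alpha>. if \<alpha> = \<beta> then 1 else 0"] allI)
  fix x :: "(real, 'n) vec"
  show "(\<Prod>i\<in>UNIV. (x $ i) ^ \<beta> i) = (\<Sum>\<alpha>\<in>{\<alpha>. sum \<alpha> UNIV \<le> k}.
      (if \<alpha> = \<beta> then 1 else 0) * (\<Prod>i\<in>UNIV. (x $ i) ^ \<alpha> i))"
    using assms by (simp add: if_distrib[of "\<lambda>c. c * _"] sum.delta[OF finite_multiindices] cong: if_cong)
qed

text \<open>The derivative is written with monomials again so that its total degree can be read off.
  Where \<alpha> i = 0 the truncated exponent is harmless, as the factor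
  \<open>real (\<alpha> i)\<close> vanishes.\<close>

lemma monomial_has_derivative:
  fixes \<alpha> :: "'n::finite \<Rightarrow> nat" and x :: "(real, 'n) vec"
  shows "((\<lambda>x. \<Prod>i\<in>UNIV. (x $ i) ^ \<alpha> i) has_derivative
    (\<lambda>h. \<Sum>i\<in>UNIV. (real (\<alpha> i) * h $ i) * (\<Prod>j\<in>UNIV. (x $ j) ^ (\<alpha>(i := \<alpha> i - 1)) j))) (at x)"
proof -
  have "((\<lambda>x. \<Prod>i\<in>UNIV. (x $ i) ^ \<alpha> i) has_derivative
    (\<lambda>h. \<Sum>i\<in>UNIV. (of_nat (\<alpha> i) * h $ i * (x $ i) ^ (\<alpha> i - 1)) * (\<Prod>j\<in>UNIV - {i}. (x $ j) ^ \<alpha> j))) (at x)"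
    by (intro has_derivative_prod has_derivative_power
         bounded_linear.has_derivative[OF bounded_linear_vec_nth has_derivative_ident])
  moreover have "(\<Prod>j\<in>UNIV. (x $ j) ^ (\<alpha>(i := \<alpha> i - 1)) j)
      = (x $ i) ^ (\<alpha> i - 1) * (\<Prod>j\<in>UNIV - {i}. (x $ j) ^ \<alpha> j)" for i
    by (subst prod.remove[of UNIV i]) (auto intro!: prod.cong)
  ultimately show ?thesis by (simp add: mult.assoc)
qed

lemma poly_le_has_derivative:
  assumes "poly_le k f"
  obtains f' where "\<And>x. (f has_derivative f' x) (at x)" "\<And>e. poly_le k (\<lambda>x. f' x e)"
proof -
  obtain c where f: "f = (\<lambda>x. \<Sum>\<alpha>\<in>{\<alpha>. sum \<alpha> UNIV \<le> k}. c \<alpha> * (\<Prod>i\<in>UNIV. (x $ i) ^ (\<alpha> i)))"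
    using assms unfolding poly_le_def by auto
  define f' where "f' = (\<lambda>x h. \<Sum>\<alpha>\<in>{\<alpha>. sum \<alpha> UNIV \<le> k}. c \<alpha> *
    (\<Sum>i\<in>UNIV. (real (\<alpha> i) * h $ i) * (\<Prod>j\<in>UNIV. (x $ j) ^ (\<alpha>(i := \<alpha> i - 1)) j)))"
  show ?thesis
  proof
    show "(f has_derivative f' x) (at x)" for x unfolding f f'_def
      by (intro has_derivative_sum has_derivative_mult_right monomial_has_derivative)
    show "poly_le k (\<lambda>x. f' x e)" for e unfolding f'_def
    proof (intro poly_le_sum poly_le_scale poly_le_monomial)
      fix \<alpha> :: "'a \<Rightarrow> nat" and i assume "\<alpha> \<in> {\<alpha>. sum \<alpha> UNIV \<le> k}"
      moreover have "sum (\<alpha>(i := \<alpha> i - 1)) UNIV \<le> sum \<alpha> UNIV" by (intro sum_mono) auto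
      ultimately show "sum (\<alpha>(i := \<alpha> i - 1)) UNIV \<le> k" by simp
    qed
  qed
qed

lemma poly_le_frechet:
  assumes "poly_le k f"
  shows "(f has_derivative (\<lambda>e. pderiv_dir e f x)) (at x)"
proof -
  obtain f' where "(f has_derivative f' x) (at x)" using assms poly_le_has_derivative by metis
  then show ?thesis unfolding pderiv_dir_def using frechet_derivative_at by metis
qed

lemma poly_le_pderiv_dir:
  assumes "poly_le k f"
  shows "poly_le k (pderiv_dir e f)"
proof -
  obtain f' where f': "\<And>x. (f has_derivative f' x) (at x)" "\<And>e. poly_le k (\<lambda>x. f' x e)"
    using assms poly_le_has_derivative by metis
  have "pderiv_dir e f = (\<lambda>x. f' x e)"
    unfolding pderiv_dir_def using frechet_derivative_at[OF f'(1)] by metis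
  then show ?thesis using f'(2) by simp
qed

lemma poly_le_continuous: "poly_le k f \<Longrightarrow> continuous_on A f"
  using poly_le_frechet has_derivative_continuous continuous_at_imp_continuous_on by metis

text \<open>The bridge to one variable: the total degree bounds the degree along every line, and the
  directional derivative becomes \<open>pderiv\<close>.\<close>

lemma poly_le_on_line:
  fixes x e :: "(real, 'n::finite) vec"
  assumes "poly_le k f"
  obtains q where "degree q \<le> k" "\<And>t. f (x + t *\<^sub>R e) = poly q t"
    "\<And>t. pderiv_dir e f (x + t *\<^sub>R e) = poly (pderiv q) t"
proof -
  obtain c where f: "\<And>x. f x = (\<Sum>\<alpha>\<in>{\<alpha>. sum \<alpha> UNIV \<le> k}. c \<alpha> * (\<Prod>i\<in>UNIV. (x $ i) ^ (\<alpha> i)))"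
    using assms unfolding poly_le_def by blast
  define q where "q = (\<Sum>\<alpha>\<in>{\<alpha>. sum \<alpha> UNIV \<le> k}. smult (c \<alpha>) (\<Prod>i\<in>UNIV. [:x $ i, e $ i:] ^ (\<alpha> i)))"
  have fq: "f (x + t *\<^sub>R e) = poly q t" for t
    by (simp add: f q_def poly_sum poly_prod mult.commute)
  show ?thesis
  proof
    show "degree q \<le> k" unfolding q_def
    proof (intro degree_sum_le[OF finite_multiindices])
      fix \<alpha> :: "'n \<Rightarrow> nat" assume a: "\<alpha> \<in> {\<alpha>. sum \<alpha> UNIV \<le> k}"
      have "degree (smult (c \<alpha>) (\<Prod>i\<in>UNIV. [:x $ i, e $ i:] ^ (\<alpha> i)))
          \<le> degree (\<Prod>i\<in>UNIV. [:x $ i, e $ i:] ^ (\<alpha> i))" by (rule degree_smult_le)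
      also have "\<dots> \<le> (\<Sum>i\<in>UNIV. degree ([:x $ i, e $ i:] ^ (\<alpha> i)))" 
        using degree_prod_sum_le[of UNIV "\<lambda>i. [:x $ i, e $ i:] ^ (\<alpha> i)"] by (simp add: o_def)
      also have "\<dots> \<le> (\<Sum>i\<in>UNIV. \<alpha> i)"
        by (intro sum_mono order.trans[OF degree_power_le]) auto
      finally show "degree (smult (c \<alpha>) (\<Prod>i\<in>UNIV. [:x $ i, e $ i:] ^ (\<alpha> i))) \<le> k" using a by simp
    qed
    show "f (x + t *\<^sub>R e) = poly q t" for t by (rule fq)
    show "pderiv_dir e f (x + t *\<^sub>R e) = poly (pderiv q) t" for t
    proof -
      have "((\<lambda>t. f (x + t *\<^sub>R e)) has_derivative (\<lambda>h. pderiv_dir (h *\<^sub>R e) f (x + t *\<^sub>R e))) (at t)"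
        by (rule has_derivative_compose[OF _ poly_le_frechet[OF assms]])
           (auto intro!: derivative_eq_intros)
      moreover have "((\<lambda>t. f (x + t *\<^sub>R e)) has_derivative (\<lambda>h. poly (pderiv q) t * h)) (at t)"
        using poly_DERIV[of q t] unfolding fq has_field_derivative_def by simp
      ultimately have "(\<lambda>h. pderiv_dir (h *\<^sub>R e) f (x + t *\<^sub>R e)) = (\<lambda>h. poly (pderiv q) t * h)"
        by (rule has_derivative_unique)
      from fun_cong[OF this, of 1] show ?thesis by simp
    qed
  qed
qed

subsection \<open>Integration along lines\<close>

lemma compact_integrable:
  fixes f :: "'a::euclidean_space \<Rightarrow> real"
  assumes "compact D" "continuous_on D f"
  shows "f integrable_on D"
  using borel_integrable_compact[OF assms]
  by (intro set_borel_integral_eq_integral(1)) (simp add: set_integrable_def)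

text \<open>Exchanging integrals is done with nonnegative Lebesgue integrals, where measurability
  suffices; this lemma converts at both ends of such a computation.\<close>

lemma ennreal_integral_compact:
  fixes f :: "'a::euclidean_space \<Rightarrow> real"
  assumes "compact D" "continuous_on D f" "\<And>x. x \<in> D \<Longrightarrow> 0 \<le> f x"
  shows "ennreal (integral D f) = (\<integral>\<^sup>+x. ennreal (f x) * indicator D x \<partial>lborel)"
proof -
  have i: "integrable lborel (\<lambda>x. indicator D x *\<^sub>R f x)"
    by (rule borel_integrable_compact[OF assms(1,2)])
  then have "integral D f = (LINT x|lborel. indicator D x *\<^sub>R f x)"
    using set_borel_integral_eq_integral(2)[of D f] by (simp add: set_integrable_def set_lebesgue_integral_def)
  also have "ennreal \<dots> = (\<integral>\<^sup>+x. ennreal (indicator D x *\<^sub>R f x) \<partial>lborel)"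
    by (rule nn_integral_eq_integral[symmetric, OF i]) (auto simp: indicator_def assms(3))
  also have "\<dots> = (\<integral>\<^sup>+x. ennreal (f x) * indicator D x \<partial>lborel)"
    by (intro nn_integral_cong) (auto simp: indicator_def)
  finally show ?thesis .
qed

lemma nn_integral_translation:
  fixes F :: "'a::euclidean_space \<Rightarrow> ennreal"
  assumes "F \<in> borel_measurable borel"
  shows "(\<integral>\<^sup>+x. F (x + w) \<partial>lborel) = (\<integral>\<^sup>+x. F x \<partial>lborel)"
proof -
  have "(\<integral>\<^sup>+x. F x \<partial>lborel) = (\<integral>\<^sup>+x. F x \<partial>distr lborel borel ((+) w))"
    by (simp add: lborel_distr_plus)
  also have "\<dots> = (\<integral>\<^sup>+x. F (w + x) \<partial>lborel)"
    using assms by (intro nn_integral_distr) auto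
  finally show ?thesis by (simp add: add.commute)
qed

text \<open>A substitute for Fubini along an arbitrary direction that needs no change of coordinates.\<close>

lemma nn_integral_line_average:
  fixes F :: "'a::euclidean_space \<Rightarrow> ennreal"
  assumes [measurable]: "F \<in> borel_measurable borel" and "a \<le> b"
  shows "(\<integral>\<^sup>+x. (\<integral>\<^sup>+v. F (x + v *\<^sub>R e) * indicator {a..b} v \<partial>lborel) \<partial>lborel)
    = ennreal (b - a) * (\<integral>\<^sup>+x. F x \<partial>lborel)"
proof -
  have "(\<integral>\<^sup>+x. (\<integral>\<^sup>+v. F (x + v *\<^sub>R e) * indicator {a..b} v \<partial>lborel) \<partial>lborel)
      = (\<integral>\<^sup>+v. (\<integral>\<^sup>+x. F (x + v *\<^sub>R e) * indicator {a..b} v \<partial>lborel) \<partial>lborel)"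
    by (rule lborel_pair.Fubini'[of "\<lambda>v x. F (x + v *\<^sub>R e) * indicator {a..b} v"]) measurable
  also have "\<dots> = (\<integral>\<^sup>+v. (\<integral>\<^sup>+x. F x \<partial>lborel) * indicator {a..b} v \<partial>lborel)"
    by (intro nn_integral_cong) (simp add: nn_integral_multc nn_integral_translation)
  also have "\<dots> = (\<integral>\<^sup>+x. F x \<partial>lborel) * ennreal (b - a)"
    using assms(2) by (simp add: nn_integral_cmult)
  finally show ?thesis by (simp add: mult.commute)
qed

text \<open>Both sides of an estimate on single lines are integrated over all base points, and
  \<open>nn_integral_line_average\<close> returns volume integrals. The derivative is collected over
  parameters in [0,\<delta>], while the segments used reach up to 2\<delta>; the ratio of these
  lengths is the factor 2.\<close>

lemma directional_markov:
  fixes K Ka :: "(real, 'n::finite) vec set"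
  assumes "poly_le p g" "compact K" "compact Ka" "0 < \<delta>"
    and shift: "\<And>x t. x \<in> Ka \<Longrightarrow> t \<in> {0..\<delta>} \<Longrightarrow> x + t *\<^sub>R e \<in> K"
  shows "integral Ka (\<lambda>x. (pderiv_dir e g x)\<^sup>2) \<le> 2 * (real p + 1) ^ 4 / \<delta>\<^sup>2 * integral K (\<lambda>x. (g x)\<^sup>2)"
proof -
  define C where "C = (real p + 1) ^ 4 / \<delta>\<^sup>2"
  define F Fa :: "(real, 'n) vec \<Rightarrow> ennreal" where "F = (\<lambda>x. ennreal ((g x)\<^sup>2) * indicator K x)"
    and "Fa = (\<lambda>x. ennreal ((pderiv_dir e g x)\<^sup>2) * indicator Ka x)"
  have C: "0 \<le> C" by (simp add: C_def)
  have cg: "continuous_on A g" "continuous_on A (pderiv_dir e g)" for A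
    using assms(1) by (auto intro: poly_le_continuous poly_le_pderiv_dir)
  have [measurable]: "g \<in> borel_measurable borel" "pderiv_dir e g \<in> borel_measurable borel"
    "K \<in> sets borel" "Ka \<in> sets borel"
    using cg assms(2,3) by (auto intro: borel_measurable_continuous_onI borel_compact)
  have Fm [measurable]: "F \<in> borel_measurable borel" "Fa \<in> borel_measurable borel"
    unfolding F_def Fa_def by measurable
  have line: "(\<integral>\<^sup>+v. Fa (x + v *\<^sub>R e) * indicator {0..\<delta>} v \<partial>lborel)
      \<le> ennreal C * (\<integral>\<^sup>+v. F (x + v *\<^sub>R e) * indicator {0..2 * \<delta>} v \<partial>lborel)" for x
  proof (cases "\<exists>v\<in>{0..\<delta>}. x + v *\<^sub>R e \<in> Ka")
    case False
    then have "(\<integral>\<^sup>+v. Fa (x + v *\<^sub>R e) * indicator {0..\<delta>} v \<partial>lborel) = (\<integral>\<^sup>+v. 0 \<partial>(lborel :: real measure))"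
      by (intro nn_integral_cong) (auto simp: Fa_def indicator_def)
    then show ?thesis by simp
  next
    case True
    \<comment> \<open>The parameters at which the line meets \<open>Ka\<close>. If \<open>u\<close>
      is the first one, all of them lie in [u, u + \<delta>], and \<open>shift\<close>, started at
      the first point, keeps this interval in \<open>K\<close>. It is therefore an admissible
      segment of full length \<delta>.\<close>
    define J where "J = {0..\<delta>} \<inter> (\<lambda>v. x + v *\<^sub>R e) -` Ka"
    have "compact J" unfolding J_def
      by (intro compact_Int_closed closed_vimage) (auto intro!: continuous_intros compact_imp_closed assms)
    moreover have "J \<noteq> {}" using True by (auto simp: J_def)
    ultimately obtain u where u: "u \<in> J" "\<And>v. v \<in> J \<Longrightarrow> u \<le> v"
      using compact_attains_inf[of J] by blast
    have inK: "x + v *\<^sub>R e \<in> K" if "v \<in> {u..u + \<delta>}" for v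
      using shift[of "x + u *\<^sub>R e" "v - u"] u(1) that by (auto simp: J_def algebra_simps)
    obtain q where q: "degree q \<le> p" "\<And>t. g (x + t *\<^sub>R e) = poly q t"
      "\<And>t. pderiv_dir e g (x + t *\<^sub>R e) = poly (pderiv q) t"
      using poly_le_on_line[OF assms(1)] by blast
    have "(\<integral>\<^sup>+v. Fa (x + v *\<^sub>R e) * indicator {0..\<delta>} v \<partial>lborel)
        \<le> (\<integral>\<^sup>+v. ennreal ((poly (pderiv q) v)\<^sup>2) * indicator {u..u + \<delta>} v \<partial>lborel)"
      using u by (intro nn_integral_mono) (force simp: Fa_def q(3) J_def indicator_def)
    also have "\<dots> = ennreal (integral {u..u + \<delta>} (\<lambda>v. (poly (pderiv q) v)\<^sup>2))"
      by (rule ennreal_integral_compact[symmetric]) (auto intro!: continuous_intros)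
    also have "\<dots> \<le> ennreal (C * integral {u..u + \<delta>} (\<lambda>v. (poly q v)\<^sup>2))"
      unfolding C_def by (intro ennreal_leI interval_markov_inequality q assms)
    also have "\<dots> = ennreal C * (\<integral>\<^sup>+v. ennreal ((poly q v)\<^sup>2) * indicator {u..u + \<delta>} v \<partial>lborel)"
      using C by (subst ennreal_integral_compact[symmetric])
         (auto intro!: continuous_intros ennreal_mult' integral_nonneg compact_integrable)
    also have "\<dots> \<le> ennreal C * (\<integral>\<^sup>+v. F (x + v *\<^sub>R e) * indicator {0..2 * \<delta>} v \<partial>lborel)"
      using u inK by (intro mult_left_mono nn_integral_mono) (auto simp: F_def q(2) J_def indicator_def)
    finally show ?thesis .
  qed
  have "ennreal \<delta> * (\<integral>\<^sup>+x. Fa x \<partial>lborel)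
      = (\<integral>\<^sup>+x. (\<integral>\<^sup>+v. Fa (x + v *\<^sub>R e) * indicator {0..\<delta>} v \<partial>lborel) \<partial>lborel)"
    using nn_integral_line_average[of Fa 0 \<delta> e] assms(4) by simp
  also have "\<dots> \<le> (\<integral>\<^sup>+x. ennreal C * (\<integral>\<^sup>+v. F (x + v *\<^sub>R e) * indicator {0..2 * \<delta>} v \<partial>lborel) \<partial>lborel)"
    by (intro nn_integral_mono line)
  also have "\<dots> = ennreal C * (ennreal (2 * \<delta>) * (\<integral>\<^sup>+x. F x \<partial>lborel))"
    using nn_integral_line_average[of F 0 "2 * \<delta>" e] assms(4) by (simp add: nn_integral_cmult)
  also have "(\<integral>\<^sup>+x. F x \<partial>lborel) = ennreal (integral K (\<lambda>x. (g x)\<^sup>2))" unfolding F_def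
    by (rule ennreal_integral_compact[symmetric]) (auto intro!: continuous_intros cg assms)
  also have "(\<integral>\<^sup>+x. Fa x \<partial>lborel) = ennreal (integral Ka (\<lambda>x. (pderiv_dir e g x)\<^sup>2))" unfolding Fa_def
    by (rule ennreal_integral_compact[symmetric]) (auto intro!: continuous_intros cg assms)
  finally have "ennreal (\<delta> * integral Ka (\<lambda>x. (pderiv_dir e g x)\<^sup>2))
      \<le> ennreal (C * (2 * \<delta> * integral K (\<lambda>x. (g x)\<^sup>2)))"
    using ennreal_mult'[OF C, of "2 * \<delta> * integral K (\<lambda>x. (g x)\<^sup>2)"]
      ennreal_mult'[of "2 * \<delta>" "integral K (\<lambda>x. (g x)\<^sup>2)"]
      ennreal_mult'[of \<delta> "integral Ka (\<lambda>x. (pderiv_dir e g x)\<^sup>2)"] assms(4)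
    by (simp only: less_imp_le mult_nonneg_nonneg zero_le_numeral)
  then have "\<delta> * integral Ka (\<lambda>x. (pderiv_dir e g x)\<^sup>2) \<le> C * (2 * \<delta> * integral K (\<lambda>x. (g x)\<^sup>2))"
    using assms(4) C
    by (subst (asm) ennreal_le_iff)
       (auto intro!: mult_nonneg_nonneg integral_nonneg compact_integrable assms cg continuous_intros)
  then have "\<delta> * integral Ka (\<lambda>x. (pderiv_dir e g x)\<^sup>2) \<le> \<delta> * (2 * C * integral K (\<lambda>x. (g x)\<^sup>2))"
    by (simp add: algebra_simps)
  then have "integral Ka (\<lambda>x. (pderiv_dir e g x)\<^sup>2) \<le> 2 * C * integral K (\<lambda>x. (g x)\<^sup>2)"
    using assms(4) by (simp only: mult_le_cancel_left_pos)
  then show ?thesis by (simp add: C_def)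
qed

section \<open>Surface integrals over unit cylinders and the trace inequality\<close>

definition cylinder :: "(real, 'n::finite) vec \<Rightarrow> (real, 'n) vec set \<Rightarrow> (real, 'n) vec set" where
  "cylinder \<nu> A = {a + t *\<^sub>R \<nu> | a t. a \<in> A \<and> t \<in> {0..1}}"

lemma surf_int_cylinder:
  "surf_int \<nu> c A g = integral (cylinder \<nu> A) (\<lambda>x. g (x - (x \<bullet> \<nu> - c) *\<^sub>R \<nu>))"
  by (simp add: surf_int_def cylinder_def)

lemma compact_cylinder: "compact A \<Longrightarrow> compact (cylinder \<nu> A)"
proof -
  assume "compact A"
  then have "compact ((\<lambda>(a, t). a + t *\<^sub>R \<nu>) ` (A \<times> {0..1::real}))"
    by (intro compact_continuous_image compact_Times)
       (auto simp: case_prod_unfold intro!: continuous_intros)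
  also have "(\<lambda>(a, t). a + t *\<^sub>R \<nu>) ` (A \<times> {0..1}) = cylinder \<nu> A"
    by (force simp: cylinder_def)
  finally show ?thesis .
qed

text \<open>The surface value is bounded along the segment from y towards the apex \<open>s\<close>;
  sweeping y over A fills a part of \<open>K\<close>. The sweep is carried out on the cylinder over
  A, where |\<kappa>|, the height of \<open>s\<close> above the plane, enters as the speed of the
  segment parameter.\<close>

lemma trace_inequality:
  fixes K A :: "(real, 'n::finite) vec set"
  assumes g: "poly_le p g" and "compact K" "compact A" "norm \<nu> = 1"
    and A: "\<And>y. y \<in> A \<Longrightarrow> y \<bullet> \<nu> = c" and \<kappa>: "\<kappa> = s \<bullet> \<nu> - c" "\<kappa> \<noteq> 0"
    and cone: "\<And>y t. y \<in> A \<Longrightarrow> t \<in> {0..1/2} \<Longrightarrow> y + t *\<^sub>R (s - y) \<in> K"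
  shows "surf_int \<nu> c A (\<lambda>x. (g x)\<^sup>2)
    \<le> 4 * (real p + 1)\<^sup>2 * 2 ^ CARD('n) / \<bar>\<kappa>\<bar> * integral K (\<lambda>x. (g x)\<^sup>2)"
proof -
  define P where "P = (\<lambda>x. x - (x \<bullet> \<nu> - c) *\<^sub>R \<nu>)"
  define Cy where "Cy = cylinder \<nu> A"
  define C where "C = 4 * (real p + 1)\<^sup>2"
  define F :: "(real, 'n) vec \<Rightarrow> ennreal" where "F = (\<lambda>x. ennreal ((g x)\<^sup>2) * indicator K x)"
  have C: "0 \<le> C" by (simp add: C_def)
  have nu: "\<nu> \<bullet> \<nu> = 1" using assms(4) by (simp add: norm_eq_1)
  have cyl: "P x \<in> A \<and> x \<bullet> \<nu> - c \<in> {0..1}" if "x \<in> Cy" for x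
    using that by (auto simp: Cy_def cylinder_def P_def A nu inner_add_left)
  have cg: "continuous_on B g" for B using g by (rule poly_le_continuous)
  have cP: "continuous_on B P" for B unfolding P_def by (intro continuous_intros)
  have cCy: "compact Cy" unfolding Cy_def by (intro compact_cylinder assms)
  have [measurable]: "g \<in> borel_measurable borel" "P \<in> borel_measurable borel"
    "K \<in> sets borel" "Cy \<in> sets borel"
    using cg cP cCy assms(2) by (auto intro: borel_measurable_continuous_onI borel_compact)
  have [measurable]: "F \<in> borel_measurable borel" unfolding F_def by measurable
  \<comment> \<open>The one-dimensional trace inequality for the parameter length 1/2, whence 2 /
    (1/2) = 4 in \<open>C\<close>. Stopping half way to \<open>s\<close> keeps the contraction used
    next away from zero.\<close>
  have ray: "ennreal ((g (P x))\<^sup>2) * indicator Cy x \<le> ennreal C *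
     (\<integral>\<^sup>+t. ennreal ((g (P x + t *\<^sub>R (s - P x)))\<^sup>2) * indicator Cy x * indicator {0..1/2} t \<partial>lborel)" for x
  proof (cases "x \<in> Cy")
    case True
    obtain q where q: "degree q \<le> p" "\<And>t. g (P x + t *\<^sub>R (s - P x)) = poly q t"
      using poly_le_on_line[OF g] by blast
    have "(g (P x))\<^sup>2 = (poly q 0)\<^sup>2" using q(2)[of 0] by simp
    also have "\<dots> \<le> C * integral {0..1/2} (\<lambda>t. (poly q t)\<^sup>2)"
      using interval_trace_inequality[OF q(1), of "1/2"] by (simp add: C_def)
    finally have "ennreal ((g (P x))\<^sup>2) \<le> ennreal C * ennreal (integral {0..1/2} (\<lambda>t. (poly q t)\<^sup>2))"
      using C by (simp add: ennreal_mult'[symmetric] ennreal_leI)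
    also have "ennreal (integral {0..1/2} (\<lambda>t. (poly q t)\<^sup>2))
        = (\<integral>\<^sup>+t. ennreal ((poly q t)\<^sup>2) * indicator {0..1/2} t \<partial>lborel)"
      by (rule ennreal_integral_compact) (auto intro!: continuous_intros)
    finally show ?thesis using True by (simp add: q(2))
  qed simp
  \<comment> \<open>For fixed t, z = (1 - t) x + t s is a homothety with centre \<open>s\<close>;
    its inverse has ratio r <= 2, which gives the Jacobian 2^d. The point of the ray depends on z
    only: it is the projection of z to the plane shifted by t \<kappa>, and the height of z above
    that plane is (1 - t) \<tau>, still in [0,1].\<close>
  have slice: "(\<integral>\<^sup>+x. ennreal ((g (P x + t *\<^sub>R (s - P x)))\<^sup>2) * indicator Cy x \<partial>lborel)
      \<le> ennreal (2 ^ CARD('n)) *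
        (\<integral>\<^sup>+z. F (z - (z \<bullet> \<nu> - c - t * \<kappa>) *\<^sub>R \<nu>) * indicator {0..1} (z \<bullet> \<nu> - c - t * \<kappa>) \<partial>lborel)"
    if t: "t \<in> {0..1/2}" for t
  proof -
    define f where "f = (\<lambda>x. ennreal ((g (P x + t *\<^sub>R (s - P x)))\<^sup>2) * indicator Cy x)"
    define r where "r = 1 / (1 - t)"
    have r: "0 < r" "r \<le> 2" "(1 - t) * r = 1" using t by (auto simp: r_def field_simps)
    have [measurable]: "f \<in> borel_measurable borel" unfolding f_def by measurable
    have "(\<integral>\<^sup>+x. f x \<partial>lborel) = (\<integral>\<^sup>+x. f x \<partial>density (distr lborel borel (\<lambda>x. (s - r *\<^sub>R s) + r *\<^sub>R x)) (\<lambda>_. \<bar>r\<bar> ^ CARD('n)))"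
      using lborel_affine[of r "s - r *\<^sub>R s"] r(1) by simp
    also have "\<dots> = ennreal (r ^ CARD('n)) * (\<integral>\<^sup>+z. f (s - r *\<^sub>R s + r *\<^sub>R z) \<partial>lborel)"
      using r(1) by (simp add: nn_integral_density nn_integral_distr nn_integral_cmult)
    also have "\<dots> \<le> ennreal (2 ^ CARD('n)) *
        (\<integral>\<^sup>+z. F (z - (z \<bullet> \<nu> - c - t * \<kappa>) *\<^sub>R \<nu>) * indicator {0..1} (z \<bullet> \<nu> - c - t * \<kappa>) \<partial>lborel)"
    proof (intro mult_mono nn_integral_mono ennreal_leI power_mono)
      fix z
      define x \<tau> where "x = s - r *\<^sub>R s + r *\<^sub>R z" and "\<tau> = x \<bullet> \<nu> - c"
      have e1: "(1 - t) *\<^sub>R x + t *\<^sub>R s = z"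
      proof -
        have "(1 - t) *\<^sub>R x = (1 - t) *\<^sub>R s + ((1 - t) * r) *\<^sub>R (z - s)"
          by (simp add: x_def scaleR_diff_right scaleR_add_right)
        then show ?thesis unfolding r(3) by (simp add: scaleR_diff_left)
      qed
      have "(1 - t) * (x \<bullet> \<nu>) + t * (s \<bullet> \<nu>) = z \<bullet> \<nu>"
        unfolding e1[symmetric] by (simp add: inner_add_left)
      then have e2: "(1 - t) * \<tau> = z \<bullet> \<nu> - c - t * \<kappa>"
        by (simp add: \<tau>_def \<kappa> algebra_simps)
      have "P x + t *\<^sub>R (s - P x) = ((1 - t) *\<^sub>R x + t *\<^sub>R s) - ((1 - t) * \<tau>) *\<^sub>R \<nu>"
        unfolding P_def \<tau>_def[symmetric] by (simp add: algebra_simps)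
      then have e3: "P x + t *\<^sub>R (s - P x) = z - (z \<bullet> \<nu> - c - t * \<kappa>) *\<^sub>R \<nu>"
        by (simp only: e1 e2)
      show "f (s - r *\<^sub>R s + r *\<^sub>R z)
        \<le> F (z - (z \<bullet> \<nu> - c - t * \<kappa>) *\<^sub>R \<nu>) * indicator {0..1} (z \<bullet> \<nu> - c - t * \<kappa>)"
      proof (cases "x \<in> Cy")
        case True
        have "\<tau> \<in> {0..1}" using cyl[OF True] by (simp add: \<tau>_def)
        then have "(1 - t) * \<tau> \<in> {0..1}" using t mult_le_one[of "1 - t" \<tau>] by auto
        moreover have "P x + t *\<^sub>R (s - P x) \<in> K" using cone cyl[OF True] t by blast
        ultimately show ?thesis 
          using True unfolding f_def x_def[symmetric] e3 e2 F_def by simp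
      qed (simp add: f_def x_def)
    qed (use r in auto)
    finally show ?thesis unfolding f_def .
  qed
  \<comment> \<open>Now z is fixed and t varies. The height is affine in t with slope -\<kappa>, so
    it can serve as the variable at the price of 1 / |\<kappa>|; what remains is a line average in
    direction -\<nu>.\<close>
  have subst: "(\<integral>\<^sup>+t. F (z - (z \<bullet> \<nu> - c - t * \<kappa>) *\<^sub>R \<nu>) * indicator {0..1} (z \<bullet> \<nu> - c - t * \<kappa>) \<partial>lborel)
      = ennreal (1 / \<bar>\<kappa>\<bar>) * (\<integral>\<^sup>+v. F (z + v *\<^sub>R (- \<nu>)) * indicator {0..1} v \<partial>lborel)" for z
  proof -
    have "(\<integral>\<^sup>+v. F (z + v *\<^sub>R (- \<nu>)) * indicator {0..1} v \<partial>lborel) = ennreal \<bar>- \<kappa>\<bar> *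
      (\<integral>\<^sup>+t. F (z + ((z \<bullet> \<nu> - c) + - \<kappa> * t) *\<^sub>R (- \<nu>)) * indicator {0..1} ((z \<bullet> \<nu> - c) + - \<kappa> * t) \<partial>lborel)"
      using \<kappa>(2) by (intro nn_integral_real_affine) auto
    then have "(\<integral>\<^sup>+v. F (z + v *\<^sub>R (- \<nu>)) * indicator {0..1} v \<partial>lborel) = ennreal \<bar>\<kappa>\<bar> *
      (\<integral>\<^sup>+t. F (z - (z \<bullet> \<nu> - c - t * \<kappa>) *\<^sub>R \<nu>) * indicator {0..1} (z \<bullet> \<nu> - c - t * \<kappa>) \<partial>lborel)"
      by (simp add: mult.commute)
    moreover have "ennreal (1 / \<bar>\<kappa>\<bar>) * (ennreal \<bar>\<kappa>\<bar> * X) = X" for X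
      using \<kappa>(2) by (simp add: mult.assoc[symmetric] ennreal_mult'[symmetric])
    ultimately show ?thesis by simp
  qed
  have "ennreal (surf_int \<nu> c A (\<lambda>x. (g x)\<^sup>2)) = (\<integral>\<^sup>+x. ennreal ((g (P x))\<^sup>2) * indicator Cy x \<partial>lborel)"
    unfolding surf_int_cylinder Cy_def[symmetric] P_def
    by (rule ennreal_integral_compact)
       (auto intro!: cCy continuous_intros continuous_on_compose2[OF cg[of UNIV]])
  also have "\<dots> \<le> (\<integral>\<^sup>+x. ennreal C *
     (\<integral>\<^sup>+t. ennreal ((g (P x + t *\<^sub>R (s - P x)))\<^sup>2) * indicator Cy x * indicator {0..1/2} t \<partial>lborel) \<partial>lborel)"
    by (intro nn_integral_mono ray)
  also have "\<dots> = ennreal C * (\<integral>\<^sup>+x.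
     (\<integral>\<^sup>+t. ennreal ((g (P x + t *\<^sub>R (s - P x)))\<^sup>2) * indicator Cy x * indicator {0..1/2} t \<partial>lborel) \<partial>lborel)"
    by (rule nn_integral_cmult) measurable
  finally have outer: "ennreal (surf_int \<nu> c A (\<lambda>x. (g x)\<^sup>2)) \<le> ennreal C * (\<integral>\<^sup>+x.
     (\<integral>\<^sup>+t. ennreal ((g (P x + t *\<^sub>R (s - P x)))\<^sup>2) * indicator Cy x * indicator {0..1/2} t \<partial>lborel) \<partial>lborel)" .
  have "(\<integral>\<^sup>+x.
     (\<integral>\<^sup>+t. ennreal ((g (P x + t *\<^sub>R (s - P x)))\<^sup>2) * indicator Cy x * indicator {0..1/2} t \<partial>lborel) \<partial>lborel)
    = (\<integral>\<^sup>+t. (\<integral>\<^sup>+x. ennreal ((g (P x + t *\<^sub>R (s - P x)))\<^sup>2) * indicator Cy x * indicator {0..1/2} t \<partial>lborel) \<partial>lborel)"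
    by (rule lborel_pair.Fubini'[of "\<lambda>t x. ennreal ((g (P x + t *\<^sub>R (s - P x)))\<^sup>2) * indicator Cy x * indicator {0..1/2} t"]) measurable
  also have "\<dots> \<le> (\<integral>\<^sup>+t. ennreal (2 ^ CARD('n)) *
        (\<integral>\<^sup>+z. F (z - (z \<bullet> \<nu> - c - t * \<kappa>) *\<^sub>R \<nu>) * indicator {0..1} (z \<bullet> \<nu> - c - t * \<kappa>) \<partial>lborel) \<partial>lborel)"
  proof (intro nn_integral_mono)
    fix t :: real
    show "(\<integral>\<^sup>+x. ennreal ((g (P x + t *\<^sub>R (s - P x)))\<^sup>2) * indicator Cy x * indicator {0..1/2} t \<partial>lborel)
      \<le> ennreal (2 ^ CARD('n)) *
        (\<integral>\<^sup>+z. F (z - (z \<bullet> \<nu> - c - t * \<kappa>) *\<^sub>R \<nu>) * indicator {0..1} (z \<bullet> \<nu> - c - t * \<kappa>) \<partial>lborel)"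
      using slice[of t] by (cases "t \<in> {0..1/2}") auto
  qed
  also have "\<dots> = ennreal (2 ^ CARD('n)) * (\<integral>\<^sup>+t.
        (\<integral>\<^sup>+z. F (z - (z \<bullet> \<nu> - c - t * \<kappa>) *\<^sub>R \<nu>) * indicator {0..1} (z \<bullet> \<nu> - c - t * \<kappa>) \<partial>lborel) \<partial>lborel)"
    by (rule nn_integral_cmult) measurable
  also have "(\<integral>\<^sup>+t. (\<integral>\<^sup>+z. F (z - (z \<bullet> \<nu> - c - t * \<kappa>) *\<^sub>R \<nu>) * indicator {0..1} (z \<bullet> \<nu> - c - t * \<kappa>) \<partial>lborel) \<partial>lborel)
    = (\<integral>\<^sup>+z. (\<integral>\<^sup>+t. F (z - (z \<bullet> \<nu> - c - t * \<kappa>) *\<^sub>R \<nu>) * indicator {0..1} (z \<bullet> \<nu> - c - t * \<kappa>) \<partial>lborel) \<partial>lborel)"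
    by (rule lborel_pair.Fubini'[symmetric, of "\<lambda>t z. F (z - (z \<bullet> \<nu> - c - t * \<kappa>) *\<^sub>R \<nu>) * indicator {0..1} (z \<bullet> \<nu> - c - t * \<kappa>)"]) measurable
  also have "\<dots> = ennreal (1 / \<bar>\<kappa>\<bar>) * (\<integral>\<^sup>+z. (\<integral>\<^sup>+v. F (z + v *\<^sub>R (- \<nu>)) * indicator {0..1} v \<partial>lborel) \<partial>lborel)"
    unfolding subst by (rule nn_integral_cmult) measurable
  also have "(\<integral>\<^sup>+z. (\<integral>\<^sup>+v. F (z + v *\<^sub>R (- \<nu>)) * indicator {0..1} v \<partial>lborel) \<partial>lborel) = (\<integral>\<^sup>+x. F x \<partial>lborel)"
    by (subst nn_integral_line_average) auto
  also have "(\<integral>\<^sup>+x. F x \<partial>lborel) = ennreal (integral K (\<lambda>x. (g x)\<^sup>2))" unfolding F_def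
    by (rule ennreal_integral_compact[symmetric]) (auto intro!: continuous_intros cg assms)
  finally have "ennreal (surf_int \<nu> c A (\<lambda>x. (g x)\<^sup>2)) \<le>
      ennreal C * (ennreal (2 ^ CARD('n)) * (ennreal (1 / \<bar>\<kappa>\<bar>) * ennreal (integral K (\<lambda>x. (g x)\<^sup>2))))"
    using outer by (meson mult_left_mono order_trans zero_le)
  also have "ennreal C * (ennreal (2 ^ CARD('n)) * (ennreal (1 / \<bar>\<kappa>\<bar>) * ennreal (integral K (\<lambda>x. (g x)\<^sup>2))))
    = ennreal (C * 2 ^ CARD('n) / \<bar>\<kappa>\<bar> * integral K (\<lambda>x. (g x)\<^sup>2))"
    using C by (simp add: ennreal_mult'[symmetric] mult.assoc)
  finally show ?thesis using C
    by (subst (asm) ennreal_le_iff)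
       (auto simp: C_def intro!: mult_nonneg_nonneg divide_nonneg_nonneg integral_nonneg compact_integrable assms cg continuous_intros)
qed

subsection \<open>Inverse inequalities on a simplex\<close>

text \<open>Subadditivity suffices because the integrand is nonnegative; it is meant for the vertex
  parts, which overlap.\<close>

lemma integral_le_sum_cover:
  fixes f :: "'a::euclidean_space \<Rightarrow> real"
  assumes "finite I" "compact K" "\<And>i. i \<in> I \<Longrightarrow> compact (L i)" "K \<subseteq> (\<Union>i\<in>I. L i)"
    and f: "continuous_on UNIV f" "\<And>x. 0 \<le> f x"
  shows "integral K f \<le> (\<Sum>i\<in>I. integral (L i) f)"
proof -
  have c: "continuous_on A f" for A using f(1) continuous_on_subset by blast
  have [measurable]: "f \<in> borel_measurable borel" using f(1) by (rule borel_measurable_continuous_onI)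
  have "ennreal (integral K f) = (\<integral>\<^sup>+x. ennreal (f x) * indicator K x \<partial>lborel)"
    by (rule ennreal_integral_compact) (use assms c in auto)
  also have "\<dots> \<le> (\<integral>\<^sup>+x. (\<Sum>i\<in>I. ennreal (f x) * indicator (L i) x) \<partial>lborel)"
  proof (intro nn_integral_mono)
    fix x
    show "ennreal (f x) * indicator K x \<le> (\<Sum>i\<in>I. ennreal (f x) * indicator (L i) x)"
    proof (cases "x \<in> K")
      case True
      then obtain i where i: "i \<in> I" "x \<in> L i" using assms(4) by blast
      then have "ennreal (f x) * indicator K x = ennreal (f x) * indicator (L i) x" using True by simp
      also have "\<dots> \<le> (\<Sum>i\<in>I. ennreal (f x) * indicator (L i) x)"
        using i assms(1) by (intro member_le_sum[of i I "\<lambda>i. ennreal (f x) * indicator (L i) x"]) auto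
      finally show ?thesis .
    qed simp
  qed
  also have "\<dots> = (\<Sum>i\<in>I. \<integral>\<^sup>+x. ennreal (f x) * indicator (L i) x \<partial>lborel)"
    using assms(3) by (intro nn_integral_sum) (auto intro!: borel_measurable_times_ennreal borel_measurable_indicator borel_compact)
  also have "\<dots> = (\<Sum>i\<in>I. ennreal (integral (L i) f))"
    using assms c by (intro sum.cong refl ennreal_integral_compact[symmetric]) auto
  also have "\<dots> = ennreal (\<Sum>i\<in>I. integral (L i) f)"
    using assms c by (intro sum_ennreal integral_nonneg compact_integrable) auto
  finally show ?thesis
    using assms c by (subst (asm) ennreal_le_iff) (auto intro!: sum_nonneg integral_nonneg compact_integrable)
qed

section \<open>Vertex parts and the Markov inequality on a simplex\<close>

lemma compact_simplex: "simplex_verts S \<Longrightarrow> compact (convex hull S)"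
  by (simp add: simplex_verts_def finite_imp_compact_convex_hull)

text \<open>A homothetic copy of the simplex about \<open>a\<close>. For a vertex \<open>a\<close>
  these are the points whose barycentric coordinate at \<open>a\<close> is at least 1/(d+1); the
  form as an image makes compactness immediate.\<close>

definition vertex_part :: "(real, 'n::finite) vec set \<Rightarrow> (real, 'n) vec \<Rightarrow> (real, 'n) vec set" where
  "vertex_part S a = (\<lambda>y. (1 / (real CARD('n) + 1)) *\<^sub>R a + (1 - 1 / (real CARD('n) + 1)) *\<^sub>R y) ` (convex hull S)"

lemma compact_vertex_part: "simplex_verts S \<Longrightarrow> compact (vertex_part S a)"
  unfolding vertex_part_def
  by (intro compact_continuous_image compact_simplex continuous_intros)

lemma simplex_subset_vertex_parts:
  fixes S :: "(real, 'n::finite) vec set"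
  assumes S: "simplex_verts S"
  shows "convex hull S \<subseteq> (\<Union>a\<in>S. vertex_part S a)"
proof
  fix x assume "x \<in> convex hull S"
  define \<theta> where "\<theta> = 1 / (real CARD('n) + 1)"
  have fin: "finite S" "card S = CARD('n) + 1" using S by (auto simp: simplex_verts_def)
  have \<theta>: "0 < \<theta>" "\<theta> < 1" by (auto simp: \<theta>_def)
  obtain u where u: "\<forall>b\<in>S. 0 \<le> u b" "sum u S = 1" "(\<Sum>b\<in>S. u b *\<^sub>R b) = x"
    using \<open>x \<in> convex hull S\<close> convex_hull_finite[OF fin(1)] by auto
  \<comment> \<open>Pigeonhole: d + 1 coordinates with sum 1 cannot all be below 1/(d+1).\<close>
  have "\<exists>a\<in>S. \<theta> \<le> u a"
  proof (rule ccontr)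
    assume "\<not> (\<exists>a\<in>S. \<theta> \<le> u a)"
    then have "sum u S < (\<Sum>b\<in>S. \<theta>)" using fin by (intro sum_strict_mono) (auto simp: not_le)
    then show False using u(2) fin(2) by (simp add: \<theta>_def)
  qed
  then obtain a where a: "a \<in> S" "\<theta> \<le> u a" by blast
  \<comment> \<open>The coordinates of the preimage under the homothety: the weight \<theta> is
    taken from \<open>a\<close> and the rest is normalised by 1 - \<theta>.\<close>
  define v where "v = (\<lambda>b. (u b - (if b = a then \<theta> else 0)) / (1 - \<theta>))"
  have v: "\<forall>b\<in>S. 0 \<le> v b" using u(1) a \<theta> by (auto simp: v_def)
  have sv: "sum v S = 1"
    using u(2) a fin \<theta> by (simp add: v_def sum_subtractf sum_divide_distrib[symmetric])
  have xv: "(\<Sum>b\<in>S. v b *\<^sub>R b) = (1 / (1 - \<theta>)) *\<^sub>R (x - \<theta> *\<^sub>R a)"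
  proof -
    have "(\<Sum>b\<in>S. v b *\<^sub>R b) = (\<Sum>b\<in>S. (1 / (1 - \<theta>)) *\<^sub>R (u b *\<^sub>R b - (if b = a then \<theta> *\<^sub>R a else 0)))"
      by (intro sum.cong refl) (auto simp: v_def scaleR_diff_left scaleR_diff_right diff_divide_distrib)
    also have "\<dots> = (1 / (1 - \<theta>)) *\<^sub>R (\<Sum>b\<in>S. u b *\<^sub>R b - (if b = a then \<theta> *\<^sub>R a else 0))"
      by (rule scaleR_sum_right[symmetric])
    also have "(\<Sum>b\<in>S. u b *\<^sub>R b - (if b = a then \<theta> *\<^sub>R a else 0)) = x - \<theta> *\<^sub>R a"
      using u(3) a fin by (simp add: sum_subtractf)
    finally show ?thesis .
  qed
  define y where "y = (\<Sum>b\<in>S. v b *\<^sub>R b)"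
  have "y \<in> convex hull S" unfolding y_def convex_hull_finite[OF fin(1)] using v sv by blast
  moreover have "\<theta> *\<^sub>R a + (1 - \<theta>) *\<^sub>R y = x" unfolding y_def xv using \<theta> by simp
  ultimately have "x \<in> vertex_part S a" unfolding vertex_part_def \<theta>_def[symmetric] by blast
  then show "x \<in> (\<Union>a\<in>S. vertex_part S a)" using a(1) by blast
qed

lemma vertex_part_shift:
  fixes S :: "(real, 'n::finite) vec set"
  assumes "a \<in> S" "b \<in> S" "x \<in> vertex_part S a" "t \<in> {0..1 / (real CARD('n) + 1)}"
  shows "x + t *\<^sub>R (b - a) \<in> convex hull S"
proof -
  define \<theta> where "\<theta> = 1 / (real CARD('n) + 1)"
  obtain y where y: "y \<in> convex hull S" "x = \<theta> *\<^sub>R a + (1 - \<theta>) *\<^sub>R y"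
    using assms(3) unfolding vertex_part_def \<theta>_def[symmetric] by blast
  have \<theta>: "0 < \<theta>" "\<theta> < 1" by (auto simp: \<theta>_def)
  \<comment> \<open>In the combination that defines x, the vertex \<open>a\<close> with weight
    \<theta> is replaced by a point of the edge from \<open>a\<close> to \<open>b\<close>; this
    displaces x by up to \<theta> (b - a).\<close>
  have "(1 - t / \<theta>) *\<^sub>R a + (t / \<theta>) *\<^sub>R b \<in> convex hull S"
    using assms \<theta> unfolding \<theta>_def[symmetric]
    by (intro convexD[OF convex_convex_hull] hull_inc) (auto simp: field_simps)
  from convexD[OF convex_convex_hull this y(1), of \<theta> "1 - \<theta>"] \<theta>
  have "\<theta> *\<^sub>R ((1 - t / \<theta>) *\<^sub>R a + (t / \<theta>) *\<^sub>R b) + (1 - \<theta>) *\<^sub>R y \<in> convex hull S"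
    by simp
  also have "\<theta> *\<^sub>R ((1 - t / \<theta>) *\<^sub>R a + (t / \<theta>) *\<^sub>R b) + (1 - \<theta>) *\<^sub>R y = x + t *\<^sub>R (b - a)"
    using \<theta> unfolding y(2) by (simp add: scaleR_add_right algebra_simps)
  finally show ?thesis .
qed

text \<open>The coefficients are differences of barycentric coordinates of the two antipodal points
  x0 + (r/2) w and x0 - (r/2) w. Both coordinate families sum to 1, so the base vertex
  \<open>a\<close> can be subtracted freely. Half the radius is used because the ball is
  open.\<close>

lemma direction_decomposition:
  assumes "finite S" "a \<in> S" "0 < r" "ball x0 r \<subseteq> convex hull S" "norm w \<le> 1"
  obtains \<mu> where "\<And>b. b \<in> S \<Longrightarrow> \<bar>\<mu> b\<bar> \<le> 1" "r *\<^sub>R w = (\<Sum>b\<in>S. \<mu> b *\<^sub>R (b - a))"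
proof -
  have "norm ((r / 2) *\<^sub>R w) < r"
  proof -
    have "norm ((r / 2) *\<^sub>R w) \<le> r / 2 * 1" using assms(3,5) by (simp add: mult_left_le)
    then show ?thesis using assms(3) by simp
  qed
  then have "x0 + (r / 2) *\<^sub>R w \<in> ball x0 r" "x0 - (r / 2) *\<^sub>R w \<in> ball x0 r"
    by (auto simp: dist_norm)
  then have "x0 + (r / 2) *\<^sub>R w \<in> convex hull S" "x0 - (r / 2) *\<^sub>R w \<in> convex hull S"
    using assms(4) by blast+
  then obtain u v where u: "\<forall>b\<in>S. 0 \<le> u b" "sum u S = 1" "(\<Sum>b\<in>S. u b *\<^sub>R b) = x0 + (r / 2) *\<^sub>R w"
    and v: "\<forall>b\<in>S. 0 \<le> v b" "sum v S = 1" "(\<Sum>b\<in>S. v b *\<^sub>R b) = x0 - (r / 2) *\<^sub>R w"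
    unfolding convex_hull_finite[OF assms(1)] by blast
  have le1: "u b \<le> 1" "v b \<le> 1" if "b \<in> S" for b
    using member_le_sum[of b S u] member_le_sum[of b S v] u v that assms(1) by auto
  show ?thesis
  proof
    show "\<bar>u b - v b\<bar> \<le> 1" if "b \<in> S" for b using u(1) v(1) le1 that by fastforce
    have "(u b - v b) *\<^sub>R (b - a) = u b *\<^sub>R b - v b *\<^sub>R b - (u b *\<^sub>R a - v b *\<^sub>R a)" for b
      by (simp add: algebra_simps)
    then have "(\<Sum>b\<in>S. (u b - v b) *\<^sub>R (b - a)) =
        (\<Sum>b\<in>S. u b *\<^sub>R b) - (\<Sum>b\<in>S. v b *\<^sub>R b) - (sum u S - sum v S) *\<^sub>R a"
      by (simp add: scaleR_diff_left sum_subtractf scaleR_sum_left)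
    also have "\<dots> = r *\<^sub>R w" unfolding u v by (simp add: scaleR_add_left[symmetric])
    finally show "r *\<^sub>R w = (\<Sum>b\<in>S. (u b - v b) *\<^sub>R (b - a))" by simp
  qed
qed

text \<open>Sizes enter only through 1 / r^2, when \<open>w\<close> is expanded in the edge vectors
  at a vertex; the step along an edge vector is the pure number 1 / D with D = d + 1. The power D^5
  collects D from Cauchy-Schwarz, D from the sum over edges, D^2 from the step and D from the sum
  over vertices.\<close>

lemma simplex_markov:
  fixes S :: "(real, 'n::finite) vec set"
  assumes S: "simplex_verts S" and r: "0 < r" "ball x0 r \<subseteq> convex hull S"
    and g: "poly_le p g" and w: "norm w \<le> 1"
  shows "integral (convex hull S) (\<lambda>x. (pderiv_dir w g x)\<^sup>2)
    \<le> 2 * (real CARD('n) + 1) ^ 5 * (real p + 1) ^ 4 / r\<^sup>2 * integral (convex hull S) (\<lambda>x. (g x)\<^sup>2)"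
proof -
  define D where "D = real CARD('n) + 1"
  define I where "I = integral (convex hull S) (\<lambda>x. (g x)\<^sup>2)"
  have fin: "finite S" and cardS: "real (card S) = D" using S by (auto simp: simplex_verts_def D_def)
  have D: "0 < D" by (simp add: D_def)
  have cd: "continuous_on A (pderiv_dir e g)" for A e
    using g by (auto intro: poly_le_continuous poly_le_pderiv_dir)
  have part: "integral (vertex_part S a) (\<lambda>x. (pderiv_dir w g x)\<^sup>2) \<le> 2 * D ^ 4 * (real p + 1) ^ 4 / r\<^sup>2 * I"
    if a: "a \<in> S" for a
  proof -
    obtain \<mu> where \<mu>: "\<And>b. b \<in> S \<Longrightarrow> \<bar>\<mu> b\<bar> \<le> 1" "r *\<^sub>R w = (\<Sum>b\<in>S. \<mu> b *\<^sub>R (b - a))"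
      using direction_decomposition[OF fin a r w] by blast
    have pt: "(pderiv_dir w g x)\<^sup>2 \<le> D / r\<^sup>2 * (\<Sum>b\<in>S. (pderiv_dir (b - a) g x)\<^sup>2)" for x
    proof -
      have lin: "linear (\<lambda>e. pderiv_dir e g x)"
        using poly_le_frechet[OF g, of x] by (rule has_derivative_linear)
      have "r * pderiv_dir w g x = pderiv_dir (r *\<^sub>R w) g x" using linear_cmul[OF lin] by simp
      also have "\<dots> = (\<Sum>b\<in>S. \<mu> b * pderiv_dir (b - a) g x)"
        unfolding \<mu>(2) by (simp add: linear_sum[OF lin] linear_cmul[OF lin])
      finally have "(r * pderiv_dir w g x)\<^sup>2 = (\<Sum>b\<in>S. \<mu> b * pderiv_dir (b - a) g x)\<^sup>2" by simp
      also have "\<dots> \<le> (\<Sum>b\<in>S. (\<mu> b)\<^sup>2) * (\<Sum>b\<in>S. (pderiv_dir (b - a) g x)\<^sup>2)"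
        by (rule Cauchy_Schwarz_ineq_sum)
      also have "\<dots> \<le> D * (\<Sum>b\<in>S. (pderiv_dir (b - a) g x)\<^sup>2)"
      proof (intro mult_right_mono sum_nonneg)
        have "(\<Sum>b\<in>S. (\<mu> b)\<^sup>2) \<le> (\<Sum>b\<in>S. 1)"
          using \<mu>(1) by (intro sum_mono) (simp add: abs_square_le_1)
        then show "(\<Sum>b\<in>S. (\<mu> b)\<^sup>2) \<le> D" using cardS by simp
      qed simp
      finally show ?thesis using r(1) by (simp add: power_mult_distrib field_simps)
    qed
    have "integral (vertex_part S a) (\<lambda>x. (pderiv_dir w g x)\<^sup>2)
        \<le> integral (vertex_part S a) (\<lambda>x. D / r\<^sup>2 * (\<Sum>b\<in>S. (pderiv_dir (b - a) g x)\<^sup>2))"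
      by (intro integral_le compact_integrable compact_vertex_part S continuous_intros cd pt)
    also have "\<dots> = D / r\<^sup>2 * (\<Sum>b\<in>S. integral (vertex_part S a) (\<lambda>x. (pderiv_dir (b - a) g x)\<^sup>2))"
      by (subst integral_mult_right, subst integral_sum)
         (auto intro!: fin compact_integrable compact_vertex_part S continuous_intros cd)
    also have "\<dots> \<le> D / r\<^sup>2 * (\<Sum>b\<in>S. 2 * (real p + 1) ^ 4 / (1 / D)\<^sup>2 * I)"
      unfolding I_def using D vertex_part_shift[OF a] D_def
      by (intro mult_left_mono sum_mono directional_markov[OF g] compact_simplex compact_vertex_part S) auto
    also have "\<dots> = 2 * D ^ 4 * (real p + 1) ^ 4 / r\<^sup>2 * I"
      using cardS D by (simp add: field_simps power2_eq_square power4_eq_xxxx)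
    finally show ?thesis .
  qed
  have "integral (convex hull S) (\<lambda>x. (pderiv_dir w g x)\<^sup>2)
      \<le> (\<Sum>a\<in>S. integral (vertex_part S a) (\<lambda>x. (pderiv_dir w g x)\<^sup>2))"
    by (intro integral_le_sum_cover fin compact_simplex compact_vertex_part S
          simplex_subset_vertex_parts continuous_intros cd) auto
  also have "\<dots> \<le> (\<Sum>a\<in>S. 2 * D ^ 4 * (real p + 1) ^ 4 / r\<^sup>2 * I)" by (intro sum_mono part)
  also have "\<dots> = 2 * D ^ 5 * (real p + 1) ^ 4 / r\<^sup>2 * I"
    using cardS by (simp add: power_Suc[of D 4, symmetric] mult_ac eval_nat_numeral)
  finally show ?thesis unfolding D_def I_def .
qed

section \<open>Outward normals, heights and traces on a simplex\<close>

lemma simplex_orthogonal_zero: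
  fixes S :: "(real, 'n::finite) vec set"
  assumes S: "simplex_verts S" and w: "\<And>x. x \<in> S \<Longrightarrow> w \<bullet> x = b"
  shows "w = 0"
proof -
  \<comment> \<open>d + 1 affinely independent points span the whole space affinely, so a linear
    functional constant on them is constant everywhere.\<close>
  have "aff_dim S = int (card S) - 1"
    using S aff_dim_affine_independent[of S] by (auto simp: simplex_verts_def)
  then have "affine hull S = UNIV"
    using S aff_dim_eq_full[of S] by (simp add: simplex_verts_def)
  moreover have "affine hull S \<subseteq> {x. w \<bullet> x = b}"
    using w by (intro hull_minimal affine_hyperplane) auto
  ultimately have h: "w \<bullet> x = b" for x by blast
  show ?thesis using h[of 0] h[of w] by simp
qed

text \<open>\<open>outnormal\<close> is a definite description and says nothing before this is
  known. A normal of the hyperplane through the d facet vertices exists by dimension; its length and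
  the side of \<open>s\<close> leave no freedom.\<close>

lemma outnormal_unique_exists:
  fixes S :: "(real, 'n::finite) vec set"
  assumes S: "simplex_verts S" and s: "s \<in> S"
  shows "\<exists>!\<nu>. norm \<nu> = 1 \<and> (\<forall>a\<in>S - {s}. \<forall>b\<in>S - {s}. \<nu> \<bullet> (a - b) = 0)
                         \<and> (\<forall>a\<in>S - {s}. \<nu> \<bullet> (s - a) < 0)" (is "\<exists>!\<nu>. ?Q \<nu>")
proof -
  have ind: "\<not> affine_dependent (S - {s})"
    using S affine_independent_subset[of S "S - {s}"] by (auto simp: simplex_verts_def)
  have "card (S - {s}) = CARD('n)" using S s by (auto simp: simplex_verts_def)
  then have "S - {s} \<noteq> {}" by (metis card.empty zero_less_card_finite less_irrefl)
  then obtain a0 where a0: "a0 \<in> S" "a0 \<noteq> s" by blast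
  have "aff_dim (S - {s}) = int (CARD('n)) - 1"
    using aff_dim_affine_independent[OF ind] \<open>card (S - {s}) = CARD('n)\<close> by simp
  then obtain w \<beta> where w: "w \<noteq> 0" "affine hull (S - {s}) = {x. w \<bullet> x = \<beta>}"
    using aff_dim_eq_hyperplane[of "S - {s}"] by auto
  have w\<beta>: "w \<bullet> a = \<beta>" if "a \<in> S - {s}" for a using w(2) that hull_inc[of a "S - {s}"] by blast
  have ws: "w \<bullet> s \<noteq> \<beta>"
  proof
    assume "w \<bullet> s = \<beta>"
    then have "w = 0" using w\<beta> by (intro simplex_orthogonal_zero[OF S]) auto
    then show False using w(1) by simp
  qed
  \<comment> \<open>The sign puts \<open>s\<close> on the negative side, so that the vector points
    out of the simplex.\<close>
  define \<nu> where "\<nu> = (- sgn (w \<bullet> s - \<beta>) / norm w) *\<^sub>R w"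
  have "norm \<nu> = 1" using w(1) ws by (simp add: \<nu>_def abs_sgn_eq)
  moreover have "\<nu> \<bullet> (s - a) < 0" if "a \<in> S - {s}" for a
  proof -
    have "\<nu> \<bullet> (s - a) = - (sgn (w \<bullet> s - \<beta>) * (w \<bullet> s - \<beta>)) / norm w"
      using w\<beta>[OF that] 
      by (simp add: \<nu>_def inner_diff_right right_diff_distrib diff_divide_distrib)
    also have "\<dots> = - \<bar>w \<bullet> s - \<beta>\<bar> / norm w" by (simp add: abs_sgn[of "w \<bullet> s - \<beta>"] mult.commute)
    also have "\<dots> < 0" using ws w(1) by simp
    finally show ?thesis .
  qed
  ultimately have ex: "?Q \<nu>" using w\<beta> by (auto simp: \<nu>_def inner_diff_right)
  have "\<nu>1 = \<nu>2" if q: "?Q \<nu>1" "?Q \<nu>2" for \<nu>1 \<nu>2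
  proof -
    \<comment> \<open>Chosen so that \<nu>1 - \<alpha> \<nu>2 also annihilates s - a0; it is then
      constant on all vertices and must be zero. Positivity of \<alpha> excludes opposite
      vectors.\<close>
    define \<alpha> where "\<alpha> = \<nu>1 \<bullet> (s - a0) / (\<nu>2 \<bullet> (s - a0))"
    have neg: "\<nu>1 \<bullet> (s - a0) < 0" "\<nu>2 \<bullet> (s - a0) < 0" using q a0 by auto
    have \<alpha>: "0 < \<alpha>" unfolding \<alpha>_def using neg by (simp add: divide_neg_neg)
    have "\<nu>1 - \<alpha> *\<^sub>R \<nu>2 = 0"
    proof (rule simplex_orthogonal_zero[OF S])
      fix x assume x: "x \<in> S"
      have "(\<nu>1 - \<alpha> *\<^sub>R \<nu>2) \<bullet> (x - a0) = 0"
      proof (cases "x = s")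
        case True
        then show ?thesis using neg by (simp add: inner_diff_left \<alpha>_def)
      next
        case False
        then show ?thesis using q x a0 by (simp add: inner_diff_left)
      qed
      then show "(\<nu>1 - \<alpha> *\<^sub>R \<nu>2) \<bullet> x = (\<nu>1 - \<alpha> *\<^sub>R \<nu>2) \<bullet> a0" by (simp add: inner_diff_right)
    qed
    then have e: "\<nu>1 = \<alpha> *\<^sub>R \<nu>2" by simp
    then have "norm \<nu>1 = \<alpha> * norm \<nu>2" using \<alpha> by simp
    then show ?thesis using q e by simp
  qed
  then show ?thesis using ex by blast
qed

lemma outnormal_props:
  fixes S :: "(real, 'n::finite) vec set"
  assumes S: "simplex_verts S" and s: "s \<in> S"
  shows "norm (outnormal S s) = 1"
    and "y \<in> facet S s \<Longrightarrow> y \<bullet> outnormal S s = hyp_off S s"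
    and "s \<bullet> outnormal S s < hyp_off S s"
proof -
  define \<nu> where "\<nu> = outnormal S s"
  have Q: "norm \<nu> = 1 \<and> (\<forall>a\<in>S - {s}. \<forall>b\<in>S - {s}. \<nu> \<bullet> (a - b) = 0) \<and> (\<forall>a\<in>S - {s}. \<nu> \<bullet> (s - a) < 0)"
    unfolding \<nu>_def outnormal_def by (rule theI'[OF outnormal_unique_exists[OF assms]])
  have "card (S - {s}) = CARD('n)" using S s by (auto simp: simplex_verts_def)
  then have ne: "S - {s} \<noteq> {}" by (metis card.empty zero_less_card_finite less_irrefl)
  \<comment> \<open>The same choice as in \<open>hyp_off\<close>; by orthogonality every vertex of
    the facet gives this offset.\<close>
  define a0 where "a0 = (SOME a. a \<in> S - {s})"
  have a0: "a0 \<in> S - {s}" unfolding a0_def using ne by (simp only: some_in_eq not_False_eq_True)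
  have off: "hyp_off S s = \<nu> \<bullet> a0" by (simp add: hyp_off_def \<nu>_def a0_def)
  show "norm (outnormal S s) = 1" using Q by (simp add: \<nu>_def)
  have "\<nu> \<bullet> (s - a0) < 0" using Q a0 by blast
  then show "s \<bullet> outnormal S s < hyp_off S s"
    unfolding off \<nu>_def[symmetric] by (simp add: inner_diff_right inner_commute[of s \<nu>])
  have "convex hull (S - {s}) \<subseteq> {x. \<nu> \<bullet> x = \<nu> \<bullet> a0}"
  proof (intro hull_minimal convex_hyperplane subsetI CollectI)
    fix x assume "x \<in> S - {s}"
    then have "\<nu> \<bullet> (x - a0) = 0" using Q a0 by blast
    then show "\<nu> \<bullet> x = \<nu> \<bullet> a0" by (simp add: inner_diff_right)
  qed
  then show "y \<in> facet S s \<Longrightarrow> y \<bullet> outnormal S s = hyp_off S s"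
    unfolding off facet_def \<nu>_def[symmetric] by (auto simp: inner_commute)
qed

text \<open>The simplex lies in the slab between the facet plane and the parallel plane through
  \<open>s\<close>, and the slab contains two points of the ball at distance r along the
  normal.\<close>

lemma simplex_height:
  fixes S :: "(real, 'n::finite) vec set"
  assumes S: "simplex_verts S" and s: "s \<in> S" and r: "0 < r" "ball x0 r \<subseteq> convex hull S"
  shows "r \<le> hyp_off S s - s \<bullet> outnormal S s"
proof -
  define \<nu> where "\<nu> = outnormal S s"
  define c where "c = hyp_off S s"
  have nu: "norm \<nu> = 1" "\<And>y. y \<in> facet S s \<Longrightarrow> y \<bullet> \<nu> = c" "s \<bullet> \<nu> < c"
    using outnormal_props[OF S s] by (auto simp: \<nu>_def c_def)
  have vert: "s \<bullet> \<nu> \<le> x \<bullet> \<nu> \<and> x \<bullet> \<nu> \<le> c" if "x \<in> S" for x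
  proof (cases "x = s")
    case False
    then have "x \<in> facet S s" unfolding facet_def using that by (intro hull_inc) auto
    then show ?thesis using nu by simp
  qed (use nu in simp)
  have "convex hull S \<subseteq> {x. \<nu> \<bullet> x \<ge> s \<bullet> \<nu>} \<inter> {x. \<nu> \<bullet> x \<le> c}"
    using vert by (intro hull_minimal convex_Int convex_halfspace_ge convex_halfspace_le)
      (auto simp: inner_commute)
  moreover have "x0 + (r / 2) *\<^sub>R \<nu> \<in> convex hull S" "x0 - (r / 2) *\<^sub>R \<nu> \<in> convex hull S"
    using r nu(1) by (auto intro!: subsetD[OF r(2)] simp: dist_norm)
  ultimately have "\<nu> \<bullet> (x0 + (r / 2) *\<^sub>R \<nu>) \<le> c" "s \<bullet> \<nu> \<le> \<nu> \<bullet> (x0 - (r / 2) *\<^sub>R \<nu>)" by blast+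
  moreover have "\<nu> \<bullet> \<nu> = 1" using nu(1) by (simp add: norm_eq_1)
  ultimately show ?thesis by (simp add: \<nu>_def[symmetric] c_def[symmetric] inner_add_right inner_diff_right)
qed

lemma simplex_trace:
  fixes S :: "(real, 'n::finite) vec set"
  assumes S: "simplex_verts S" and s: "s \<in> S" and r: "0 < r" "ball x0 r \<subseteq> convex hull S"
    and g: "poly_le p g" and A: "compact A" "A \<subseteq> facet S s"
    and \<nu>: "(\<nu> = outnormal S s \<and> c = hyp_off S s) \<or> (\<nu> = - outnormal S s \<and> c = - hyp_off S s)"
  shows "surf_int \<nu> c A (\<lambda>x. (g x)\<^sup>2)
    \<le> 4 * (real p + 1)\<^sup>2 * 2 ^ CARD('n) / r * integral (convex hull S) (\<lambda>x. (g x)\<^sup>2)"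
proof -
  define \<kappa> where "\<kappa> = s \<bullet> \<nu> - c"
  have \<kappa>: "r \<le> \<bar>\<kappa>\<bar>" using simplex_height[OF S s r] \<nu> by (auto simp: \<kappa>_def)
  have "surf_int \<nu> c A (\<lambda>x. (g x)\<^sup>2)
      \<le> 4 * (real p + 1)\<^sup>2 * 2 ^ CARD('n) / \<bar>\<kappa>\<bar> * integral (convex hull S) (\<lambda>x. (g x)\<^sup>2)"
  proof (rule trace_inequality[OF g compact_simplex[OF S] A(1) _ _ \<kappa>_def])
    show "norm \<nu> = 1" using \<nu> outnormal_props(1)[OF S s] by auto
    show "y \<bullet> \<nu> = c" if "y \<in> A" for y using \<nu> outnormal_props(2)[OF S s] that A(2) by auto
    show "\<kappa> \<noteq> 0" using \<kappa> r(1) by auto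
    fix y t assume y: "y \<in> A" and t: "t \<in> {0..1/2::real}"
    have "y \<in> convex hull S" using y A(2) hull_mono[of "S - {s}" S] by (auto simp: facet_def)
    then have "(1 - t) *\<^sub>R y + t *\<^sub>R s \<in> convex hull S"
      using t s by (intro convexD[OF convex_convex_hull] hull_inc[of s]) auto
    then show "y + t *\<^sub>R (s - y) \<in> convex hull S" by (simp add: algebra_simps)
  qed
  also have "\<dots> \<le> 4 * (real p + 1)\<^sup>2 * 2 ^ CARD('n) / r * integral (convex hull S) (\<lambda>x. (g x)\<^sup>2)"
    using \<kappa> r by (intro mult_right_mono divide_left_mono mult_pos_pos integral_nonneg compact_integrable
      compact_simplex S continuous_intros poly_le_continuous[OF g]) auto
  finally show ?thesis .
qed

lemma diameter_simplex_pos: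
  fixes S :: "(real, 'n::finite) vec set"
  assumes S: "simplex_verts S"
  shows "0 < diameter (convex hull S)"
proof -
  have "card S \<ge> 2" "finite S" using S by (auto simp: simplex_verts_def Suc_le_eq)
  then obtain a b where ab: "a \<in> S" "b \<in> S" "a \<noteq> b" 
    using card_le_Suc0_iff_eq[of S] by fastforce
  then have "0 < dist a b" by simp
  also have "\<dots> \<le> diameter (convex hull S)"
    using ab by (intro diameter_bounded_bound compact_imp_bounded compact_simplex S hull_inc) auto
  finally show ?thesis .
qed

text \<open>The inradius is a supremum, and only radii strictly below it are sure to come with a
  ball; the factor 2 buys this strictness.\<close>

lemma shape_regular_ball:
  fixes S :: "(real, 'n::finite) vec set"
  assumes S: "simplex_verts S" and \<sigma>: "0 < \<sigma>" "diameter (convex hull S) \<le> \<sigma> * inradius (convex hull S)"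
  obtains x0 r where "0 < r" "ball x0 r \<subseteq> convex hull S" "diameter (convex hull S) \<le> 2 * \<sigma> * r"
proof -
  define h where "h = diameter (convex hull S)"
  define X where "X = {r. \<exists>x. ball x r \<subseteq> convex hull S}"
  have h: "0 < h" unfolding h_def by (rule diameter_simplex_pos[OF S])
  have "h / (2 * \<sigma>) < h / \<sigma>" using h \<sigma>(1) by (simp add: field_simps)
  also have "\<dots> \<le> Sup X" using \<sigma> by (simp add: h_def X_def inradius_def field_simps)
  finally have lt: "h / (2 * \<sigma>) < Sup X" .
  \<comment> \<open>Balls of nonpositive radius are empty, so 0 and all negative numbers count as
    radii too; the bound below treats them separately.\<close>
  have "X \<noteq> {}" by (auto simp: X_def intro!: exI[of _ 0])
  moreover have "bdd_above X"
  proof (rule bdd_aboveI)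
    fix r assume "r \<in> X"
    then obtain x where x: "ball x r \<subseteq> convex hull S" by (auto simp: X_def)
    show "r \<le> 2 * h"
    proof (cases "0 < r")
      case True
      obtain e :: "(real, 'n) vec" where e: "norm e = 1" using vector_choose_size[of 1] by auto
      have "x \<in> ball x r" "x + (r / 2) *\<^sub>R e \<in> ball x r" using True e by (auto simp: dist_norm)
      then have "dist x (x + (r / 2) *\<^sub>R e) \<le> h" unfolding h_def using x
        by (intro diameter_bounded_bound compact_imp_bounded compact_simplex S) auto
      then show ?thesis using True e by (simp add: dist_norm)
    qed (use h in simp)
  qed
  ultimately obtain r where r: "r \<in> X" "h / (2 * \<sigma>) < r" using lt less_cSup_iff by metis
  moreover have "0 < h / (2 * \<sigma>)" using h \<sigma>(1) by simp
  ultimately have "0 < r" by linarith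
  moreover obtain x0 where "ball x0 r \<subseteq> convex hull S" using r(1) by (auto simp: X_def)
  moreover have "diameter (convex hull S) \<le> 2 * \<sigma> * r" using r(2) \<sigma>(1) by (simp add: h_def field_simps)
  ultimately show ?thesis using that by blast
qed

subsection \<open>Interfaces of neighbouring simplices\<close>

lemma compact_facet: "simplex_verts S \<Longrightarrow> compact (facet S s)"
  by (simp add: facet_def simplex_verts_def finite_imp_compact_convex_hull)

lemma facet_subset: "facet S s \<subseteq> convex hull S"
  unfolding facet_def by (intro hull_mono) auto

lemma surf_int_negligible: "negligible (cylinder \<nu> A) \<Longrightarrow> surf_int \<nu> c A g = 0"
  unfolding surf_int_cylinder by (rule integral_unique, rule has_integral_negligible) auto

lemma negligible_cylinder_iff:
  assumes "compact A"
  shows "negligible (cylinder \<nu> A) \<longleftrightarrow> \<not> surf_int \<nu> c A (\<lambda>_. 1) > 0"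
proof -
  have "cylinder \<nu> A \<in> lmeasurable" using compact_cylinder[OF assms] by (rule lmeasurable_compact)
  then show ?thesis
    by (simp add: surf_int_cylinder negligible_iff_measure0 lmeasure_integral[symmetric] not_less
        antisym_conv[OF measure_nonneg])
qed

text \<open>Replacing t by 1 - t: reversing the normal only translates the cylinder, so
  negligibility does not depend on the orientation.\<close>

lemma cylinder_uminus: "cylinder (- \<nu>) A = (+) (- \<nu>) ` cylinder \<nu> A"
proof (intro equalityI subsetI)
  fix x assume "x \<in> cylinder (- \<nu>) A"
  then obtain a t where "a \<in> A" "t \<in> {0..1}" "x = a + t *\<^sub>R (- \<nu>)" by (auto simp: cylinder_def)
  then have "x = - \<nu> + (a + (1 - t) *\<^sub>R \<nu>)" "a + (1 - t) *\<^sub>R \<nu> \<in> cylinder \<nu> A"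
    by (auto simp: cylinder_def algebra_simps intro!: exI[of _ a] exI[of _ "1 - t"])
  then show "x \<in> (+) (- \<nu>) ` cylinder \<nu> A" by blast
next
  fix x assume "x \<in> (+) (- \<nu>) ` cylinder \<nu> A"
  then obtain a t where "a \<in> A" "t \<in> {0..1}" "x = - \<nu> + (a + t *\<^sub>R \<nu>)" by (auto simp: cylinder_def)
  then show "x \<in> cylinder (- \<nu>) A"
    unfolding cylinder_def by (auto simp: algebra_simps intro!: exI[of _ a] exI[of _ "1 - t"])
qed

text \<open>If the normals were not parallel, the part \<open>w\<close> of the second orthogonal to
  the first would be nonzero and constant on the cylinder over the intersection, which would then
  lie in a hyperplane and be negligible. A common point of the facets fixes the offsets.\<close>

lemma facet_intersection_cases:
  fixes S1 S2 :: "(real, 'n::finite) vec set"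
  assumes S: "simplex_verts S1" "simplex_verts S2" "s1 \<in> S1" "s2 \<in> S2"
    and pos: "\<not> negligible (cylinder (outnormal S1 s1) (facet S1 s1 \<inter> facet S2 s2))"
  shows "(outnormal S1 s1 = outnormal S2 s2 \<and> hyp_off S1 s1 = hyp_off S2 s2) \<or>
    (outnormal S1 s1 = - outnormal S2 s2 \<and> hyp_off S1 s1 = - hyp_off S2 s2)"
proof -
  define \<nu> \<mu> where "\<nu> = outnormal S1 s1" and "\<mu> = outnormal S2 s2"
  define A where "A = facet S1 s1 \<inter> facet S2 s2"
  have n: "norm \<nu> = 1" "norm \<mu> = 1" using outnormal_props(1) S by (auto simp: \<nu>_def \<mu>_def)
  have A: "a \<bullet> \<nu> = hyp_off S1 s1" "a \<bullet> \<mu> = hyp_off S2 s2" if "a \<in> A" for a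
    using outnormal_props(2) S that by (auto simp: \<nu>_def \<mu>_def A_def)
  define w where "w = \<mu> - (\<mu> \<bullet> \<nu>) *\<^sub>R \<nu>"
  have "w \<bullet> \<nu> = 0" using n by (simp add: w_def inner_diff_left norm_eq_1)
  then have "cylinder \<nu> A \<subseteq> {x. w \<bullet> x = hyp_off S2 s2 - (\<mu> \<bullet> \<nu>) * hyp_off S1 s1}"
  proof (intro subsetI CollectI)
    fix x assume "x \<in> cylinder \<nu> A"
    then obtain a t where a: "a \<in> A" "x = a + t *\<^sub>R \<nu>" by (auto simp: cylinder_def)
    then have "w \<bullet> x = a \<bullet> w" using \<open>w \<bullet> \<nu> = 0\<close> by (simp add: inner_add_right inner_commute)
    also have "\<dots> = hyp_off S2 s2 - (\<mu> \<bullet> \<nu>) * hyp_off S1 s1"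
      using A[OF a(1)] by (simp add: w_def inner_diff_right)
    finally show "w \<bullet> x = hyp_off S2 s2 - (\<mu> \<bullet> \<nu>) * hyp_off S1 s1" .
  qed
  then have "w = 0"
    using pos negligible_hyperplane negligible_subset unfolding \<nu>_def A_def by metis
  then have m: "\<mu> = (\<mu> \<bullet> \<nu>) *\<^sub>R \<nu>" by (simp add: w_def)
  then have "norm \<mu> = \<bar>\<mu> \<bullet> \<nu>\<bar> * norm \<nu>" by (metis norm_scaleR)
  then have "\<mu> \<bullet> \<nu> = 1 \<or> \<mu> \<bullet> \<nu> = -1" using n by auto
  then have "\<nu> = \<mu> \<or> \<nu> = - \<mu>" using m by auto
  moreover have "A \<noteq> {}" using pos unfolding A_def[symmetric] cylinder_def by (intro notI) simp
  then obtain a where "a \<in> A" by blast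
  ultimately show ?thesis using A[of a] unfolding \<nu>_def[symmetric] \<mu>_def[symmetric] by auto
qed

lemma face_neighbors_iff:
  assumes "simplex_verts S1" "simplex_verts S2"
  shows "face_neighbors S1 S2 \<longleftrightarrow> S1 \<noteq> S2 \<and> (\<exists>s1\<in>S1. \<exists>s2\<in>S2.
    \<not> negligible (cylinder (outnormal S1 s1) (facet S1 s1 \<inter> facet S2 s2)))"
proof -
  have "compact (facet S1 s1 \<inter> facet S2 s2)" for s1 s2 using assms by (intro compact_Int compact_facet)
  then show ?thesis unfolding face_neighbors_def using negligible_cylinder_iff by blast
qed

lemma face_neighbors_sym:
  assumes S: "simplex_verts S1" "simplex_verts S2" and nb: "face_neighbors S1 S2"
  shows "face_neighbors S2 S1"
proof -
  obtain s1 s2 where s: "s1 \<in> S1" "s2 \<in> S2" "S1 \<noteq> S2"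
    and pos: "\<not> negligible (cylinder (outnormal S1 s1) (facet S1 s1 \<inter> facet S2 s2))"
    using nb by (auto simp: face_neighbors_iff S)
  have "outnormal S2 s2 = outnormal S1 s1 \<or> outnormal S2 s2 = - outnormal S1 s1"
    using facet_intersection_cases[OF S s(1,2) pos] by auto
  then have "\<not> negligible (cylinder (outnormal S2 s2) (facet S2 s2 \<inter> facet S1 s1))"
    using pos negligible_translation_rev cylinder_uminus by (metis Int_commute)
  then show ?thesis using s by (auto simp: face_neighbors_iff S)
qed

lemma card_face_neighbors:
  fixes T :: "(real, 'n::finite) vec set set"
  assumes T: "mesh_of \<Omega> T" and reg: "shape_regular \<sigma> T p" and \<sigma>: "0 < \<sigma>" and S1: "S1 \<in> T"
  shows "real (card {S2 \<in> T. face_neighbors S1 S2}) \<le> ((2 + \<sigma>) * (2 * \<sigma>\<^sup>2)) ^ CARD('n)"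
proof -
  define N where "N = {S2 \<in> T. face_neighbors S1 S2}"
  define h where "h = diameter (convex hull S1)"
  \<comment> \<open>A neighbour of diameter h' contains a ball of radius r with h' <= 2 \<sigma> r,
    and h <= \<sigma> h'; hence r >= \<rho>.\<close>
  define \<rho> where "\<rho> = h / (2 * \<sigma>\<^sup>2)"
  \<comment> \<open>Through a common point, a neighbour stays within h + \<sigma> h of
    \<open>x1\<close>; one more h makes the inequality strict for the open ball.\<close>
  define R where "R = (2 + \<sigma>) * h"
  have finT: "finite T" and sv: "\<And>S. S \<in> T \<Longrightarrow> simplex_verts S"
    and disj: "\<And>S S'. S \<in> T \<Longrightarrow> S' \<in> T \<Longrightarrow> S \<noteq> S' \<Longrightarrow>
      interior (convex hull S) \<inter> interior (convex hull S') = {}"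
    using T unfolding mesh_of_def by auto
  have h: "0 < h" unfolding h_def using diameter_simplex_pos[OF sv[OF S1]] .
  have \<rho>: "0 < \<rho>" using h \<sigma> by (simp add: \<rho>_def)
  have R: "0 < R" using h \<sigma> by (simp add: R_def)
  obtain x1 where x1: "x1 \<in> S1" using sv[OF S1] by (fastforce simp: simplex_verts_def)
  have nb: "diameter (convex hull S1) \<le> \<sigma> * diameter (convex hull S2)"
    "diameter (convex hull S2) \<le> \<sigma> * diameter (convex hull S1)" if "S2 \<in> N" for S2
    using that reg S1 face_neighbors_sym[of S1 S2] sv unfolding N_def shape_regular_def by auto
  have "\<exists>x. ball x \<rho> \<subseteq> convex hull S2" if S2: "S2 \<in> N" for S2
  proof -
    have S2T: "S2 \<in> T" using S2 by (simp add: N_def)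
    then have "diameter (convex hull S2) \<le> \<sigma> * inradius (convex hull S2)"
      using reg by (simp add: shape_regular_def)
    from shape_regular_ball[OF sv[OF S2T] \<sigma> this]
    obtain x r where x: "0 < r" "ball x r \<subseteq> convex hull S2" "diameter (convex hull S2) \<le> 2 * \<sigma> * r" .
    have "h \<le> \<sigma> * diameter (convex hull S2)" using nb(1)[OF S2] by (simp add: h_def)
    also have "\<dots> \<le> \<sigma> * (2 * \<sigma> * r)" using x(3) \<sigma> by (intro mult_left_mono) auto
    finally have "\<rho> \<le> r" using \<sigma> by (simp add: \<rho>_def field_simps power2_eq_square)
    then show ?thesis using x(2) subset_ball[of \<rho> r x] by blast
  qed
  then obtain z where z: "\<And>S2. S2 \<in> N \<Longrightarrow> ball (z S2) \<rho> \<subseteq> convex hull S2" by metis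
  have sub: "convex hull S2 \<subseteq> ball x1 R" if S2: "S2 \<in> N" for S2
  proof
    fix y assume y: "y \<in> convex hull S2"
    have S2T: "S2 \<in> T" "face_neighbors S1 S2" using S2 by (auto simp: N_def)
    then obtain s1 s2 where "\<not> negligible (cylinder (outnormal S1 s1) (facet S1 s1 \<inter> facet S2 s2))"
      using face_neighbors_iff[of S1 S2] sv S1 by blast
    then have "facet S1 s1 \<inter> facet S2 s2 \<noteq> {}" unfolding cylinder_def by (intro notI) simp
    then obtain a where a: "a \<in> convex hull S1" "a \<in> convex hull S2" using facet_subset by blast
    have "dist x1 a \<le> h" unfolding h_def using x1 a sv[OF S1]
      by (intro diameter_bounded_bound compact_imp_bounded compact_simplex hull_inc[of x1]) auto
    moreover have "dist a y \<le> diameter (convex hull S2)" using a y sv[OF S2T(1)]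
      by (intro diameter_bounded_bound compact_imp_bounded compact_simplex) auto
    moreover have "dist x1 y \<le> dist x1 a + dist a y" by (rule dist_triangle)
    moreover have "diameter (convex hull S2) \<le> \<sigma> * h" using nb(2)[OF S2] by (simp add: h_def)
    ultimately have "dist x1 y < R" using h unfolding R_def distrib_right by linarith
    then show "y \<in> ball x1 R" by simp
  qed
  have dj: "disjoint_family_on (\<lambda>S2. ball (z S2) \<rho>) N"
    unfolding disjoint_family_on_def
  proof (intro ballI impI)
    fix S S' assume *: "S \<in> N" "S' \<in> N" "S \<noteq> S'"
    have "ball (z S) \<rho> \<subseteq> interior (convex hull S)" "ball (z S') \<rho> \<subseteq> interior (convex hull S')"
      using z[OF *(1)] z[OF *(2)] by (simp_all add: interior_maximal)
    then show "ball (z S) \<rho> \<inter> ball (z S') \<rho> = {}" using disj[of S S'] * unfolding N_def by blast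
  qed
  have finN: "finite N" using finT by (simp add: N_def)
  define V where "V = unit_ball_vol (real CARD('n))"
  have V: "0 < V" by (simp add: V_def)
  have "real (card N) * (V * \<rho> ^ CARD('n)) = (\<Sum>S2\<in>N. measure lborel (ball (z S2) \<rho>))"
    using \<rho> by (simp add: content_ball V_def)
  also have "\<dots> = measure lborel (\<Union>S2\<in>N. ball (z S2) \<rho>)"
    by (rule measure_finite_Union[symmetric]) (use finN dj emeasure_lborel_ball_finite in \<open>auto simp: less_top\<close>)
  also have "\<dots> \<le> measure lborel (ball x1 R)"
  proof (rule measure_mono_fmeasurable)
    show "(\<Union>S2\<in>N. ball (z S2) \<rho>) \<subseteq> ball x1 R" using z sub by blast
    show "(\<Union>S2\<in>N. ball (z S2) \<rho>) \<in> sets lborel" using finN by auto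
    show "ball x1 R \<in> fmeasurable lborel"
      using emeasure_lborel_ball_finite[of x1 R] by (simp add: fmeasurable_def)
  qed
  also have "\<dots> = V * R ^ CARD('n)" using R by (simp add: content_ball V_def)
  finally have "real (card N) * \<rho> ^ CARD('n) \<le> R ^ CARD('n)" using V by (simp add: mult.left_commute)
  then have "real (card N) \<le> (R / \<rho>) ^ CARD('n)" using \<rho> by (simp add: power_divide field_simps)
  also have "R / \<rho> = (2 + \<sigma>) * (2 * \<sigma>\<^sup>2)" using h \<sigma> by (simp add: R_def \<rho>_def)
  finally show ?thesis unfolding N_def .
qed

subsection \<open>Inverse inequalities for iterated curls\<close>

definition poly_field :: "nat \<Rightarrow> ((real, 'n::finite) vec \<Rightarrow> real^3) \<Rightarrow> bool" where
  "poly_field k U \<longleftrightarrow> (\<forall>j. poly_le k (\<lambda>x. U x $ j))"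

lemma poly_field_continuous:
  assumes "poly_field k U"
  shows "continuous_on A U"
proof -
  have "continuous_on A (\<lambda>x. \<chi> j. U x $ j)"
    using assms unfolding poly_field_def by (intro continuous_on_vec_lambda poly_le_continuous) blast
  then show ?thesis by simp
qed

lemma norm_square_3: "(norm (v :: real^3))\<^sup>2 = (v $ 1)\<^sup>2 + (v $ 2)\<^sup>2 + (v $ 3)\<^sup>2"
  unfolding power2_norm_eq_inner by (simp add: inner_vec_def sum_3 power2_eq_square)

lemma poly_field_emb:
  fixes F :: "(real, 'n::{finite,linorder}) vec \<Rightarrow> (real, 'n) vec"
  assumes "\<And>i. poly_le k (\<lambda>x. F x $ i)"
  shows "poly_field k (\<lambda>x. emb (F x))"
proof -
  have "poly_le k (\<lambda>x. F x \<bullet> e)" for e :: "(real, 'n) vec"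
    unfolding inner_vec_def using assms
    by (intro poly_le_sum) (simp add: mult.commute poly_le_scale)
  then show ?thesis unfolding poly_field_def emb_def by (simp add: forall_3)
qed

lemma poly_field_curl: "poly_field k U \<Longrightarrow> poly_field k (curl U)"
  unfolding poly_field_def curl_def[abs_def] pd_def[abs_def]
  by (simp add: forall_3 poly_le_diff poly_le_pderiv_dir)

lemma poly_field_cu:
  assumes "V \<in> Vh T p" "S \<in> T"
  shows "poly_field (p S) (cu k V S)"
proof (induction k)
  case 0
  then show ?case using assms by (auto simp: cu_def Vh_def intro!: poly_field_emb)
next
  case (Suc k)
  then show ?case by (simp add: cu_def poly_field_curl)
qed

text \<open>An inequality, since the fictitious third direction in two dimensions is 0; it lets one
  Markov estimate cover both dimensions.\<close>

lemma norm_coord_dir: "norm (coord_dir i :: (real, 'n::{finite,linorder}) vec) \<le> 1"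
  by (simp add: coord_dir_def)

text \<open>12 = 2 * 2 * 3: the first 2 is from \<open>simplex_markov\<close>, the second from
  squaring a difference, and 3 counts the directions in which each component is
  differentiated.\<close>

lemma curl_markov:
  fixes S :: "(real, 'n::{finite,linorder}) vec set"
  assumes S: "simplex_verts S" and r: "0 < r" "ball x0 r \<subseteq> convex hull S" and U: "poly_field p U"
  shows "integral (convex hull S) (\<lambda>x. (norm (curl U x))\<^sup>2)
    \<le> 12 * (real CARD('n) + 1) ^ 5 * (real p + 1) ^ 4 / r\<^sup>2 * integral (convex hull S) (\<lambda>x. (norm (U x))\<^sup>2)"
proof -
  define C where "C = 2 * (real CARD('n) + 1) ^ 5 * (real p + 1) ^ 4 / r\<^sup>2"
  define K where "K = convex hull S"
  have Uj: "poly_le p (\<lambda>x. U x $ j)" for j using U by (simp add: poly_field_def)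
  have K: "compact K" unfolding K_def by (rule compact_simplex[OF S])
  have cpd: "continuous_on A (pd U i j)" for A i j
    unfolding pd_def[abs_def] by (intro poly_le_continuous[where k = p] poly_le_pderiv_dir Uj)
  have cU: "continuous_on A (\<lambda>x. U x $ j)" for A j by (rule poly_le_continuous[OF Uj])
  have ip: "(\<lambda>x. (pd U i j x)\<^sup>2) integrable_on K" and iU: "(\<lambda>x. (U x $ j)\<^sup>2) integrable_on K" for i j
    by (intro compact_integrable K continuous_intros cpd cU)+
  have "integral K (\<lambda>x. (pd U i j x)\<^sup>2) \<le> C * integral K (\<lambda>x. (U x $ j)\<^sup>2)" for i j
    unfolding C_def K_def pd_def by (rule simplex_markov[OF S r Uj norm_coord_dir])
  then have "(\<Sum>i\<in>{1,2,3}. \<Sum>j\<in>UNIV. integral K (\<lambda>x. (pd U i j x)\<^sup>2))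
      \<le> (\<Sum>i\<in>{1,2,3::nat}. \<Sum>j\<in>UNIV. C * integral K (\<lambda>x. (U x $ j)\<^sup>2))"
    by (intro sum_mono)
  also have "\<dots> = 3 * C * (\<Sum>j\<in>UNIV. integral K (\<lambda>x. (U x $ j)\<^sup>2))"
    by (simp add: sum_distrib_left[symmetric])
  also have "(\<Sum>j\<in>UNIV. integral K (\<lambda>x. (U x $ j)\<^sup>2)) = integral K (\<lambda>x. (norm (U x))\<^sup>2)"
    unfolding norm_square_3 by (simp add: sum_3 integral_add iU integrable_add)
  finally have s: "(\<Sum>i\<in>{1,2,3}. \<Sum>j\<in>UNIV. integral K (\<lambda>x. (pd U i j x)\<^sup>2))
      \<le> 3 * C * integral K (\<lambda>x. (norm (U x))\<^sup>2)" .
  have sq: "(a - b)\<^sup>2 \<le> 2 * (a\<^sup>2 + b\<^sup>2)" for a b :: real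
    using zero_le_power2[of "a + b"] by (simp add: power2_sum power2_diff)
  have "(norm (curl U x))\<^sup>2 \<le> 2 * (\<Sum>i\<in>{1,2,3}. \<Sum>j\<in>UNIV. (pd U i j x)\<^sup>2)" for x
  proof -
    have "(norm (curl U x))\<^sup>2 \<le> 2 * ((pd U 2 3 x)\<^sup>2 + (pd U 3 2 x)\<^sup>2) + 2 * ((pd U 3 1 x)\<^sup>2 + (pd U 1 3 x)\<^sup>2)
        + 2 * ((pd U 1 2 x)\<^sup>2 + (pd U 2 1 x)\<^sup>2)"
      unfolding norm_square_3 curl_def vector_3 by (intro add_mono sq)
    also have "\<dots> \<le> 2 * (\<Sum>i\<in>{1,2,3}. \<Sum>j\<in>UNIV. (pd U i j x)\<^sup>2)"
      by (simp add: sum_3)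
    finally show ?thesis .
  qed
  then have "integral K (\<lambda>x. (norm (curl U x))\<^sup>2)
      \<le> integral K (\<lambda>x. 2 * (\<Sum>i\<in>{1,2,3}. \<Sum>j\<in>UNIV. (pd U i j x)\<^sup>2))"
    by (intro integral_le compact_integrable K continuous_intros cpd
        poly_field_continuous[OF poly_field_curl[OF U]])
  also have "\<dots> = 2 * (\<Sum>i\<in>{1,2,3}. \<Sum>j\<in>UNIV. integral K (\<lambda>x. (pd U i j x)\<^sup>2))"
    by (simp add: integral_sum ip integrable_sum integral_add integrable_add)
  also have "\<dots> \<le> 2 * (3 * C * integral K (\<lambda>x. (norm (U x))\<^sup>2))" using s by simp
  finally show ?thesis by (simp add: C_def K_def)
qed

subsection \<open>Surface integrals of continuous functions\<close>

lemma continuous_projected: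
  assumes "continuous_on UNIV f"
  shows "continuous_on A (\<lambda>x. f (x - (x \<bullet> \<nu> - c) *\<^sub>R \<nu>))"
  by (rule continuous_on_compose2[OF assms]) (auto intro!: continuous_intros)

lemma surf_integrable:
  assumes "compact A" "continuous_on UNIV f"
  shows "(\<lambda>x. f (x - (x \<bullet> \<nu> - c) *\<^sub>R \<nu>) :: real) integrable_on cylinder \<nu> A"
  by (intro compact_integrable compact_cylinder assms continuous_projected)

lemma surf_int_mono:
  assumes "compact A" "continuous_on UNIV f" "continuous_on UNIV g" "\<And>x. f x \<le> g x"
  shows "surf_int \<nu> c A f \<le> surf_int \<nu> c A g"
  unfolding surf_int_cylinder by (intro integral_le surf_integrable assms)

lemma surf_int_add:
  assumes "compact A" "continuous_on UNIV f" "continuous_on UNIV g"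
  shows "surf_int \<nu> c A (\<lambda>x. f x + g x) = surf_int \<nu> c A f + surf_int \<nu> c A g"
  unfolding surf_int_cylinder by (intro integral_add surf_integrable assms)

lemma surf_int_cmult: "surf_int \<nu> c A (\<lambda>x. k * f x) = k * surf_int \<nu> c A f"
  unfolding surf_int_cylinder by simp

lemma field_trace:
  fixes S :: "(real, 'n::finite) vec set"
  assumes S: "simplex_verts S" and s: "s \<in> S" and r: "0 < r" "ball x0 r \<subseteq> convex hull S"
    and U: "poly_field p U" and A: "compact A" "A \<subseteq> facet S s"
    and \<nu>: "(\<nu> = outnormal S s \<and> c = hyp_off S s) \<or> (\<nu> = - outnormal S s \<and> c = - hyp_off S s)"
  shows "surf_int \<nu> c A (\<lambda>x. (norm (U x))\<^sup>2)
    \<le> 4 * (real p + 1)\<^sup>2 * 2 ^ CARD('n) / r * integral (convex hull S) (\<lambda>x. (norm (U x))\<^sup>2)"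
proof -
  define C where "C = 4 * (real p + 1)\<^sup>2 * 2 ^ CARD('n) / r"
  have Uj: "poly_le p (\<lambda>x. U x $ j)" for j using U by (simp add: poly_field_def)
  have cU: "continuous_on B (\<lambda>x. U x $ j)" for B j by (rule poly_le_continuous[OF Uj])
  have iU: "(\<lambda>x. (U x $ j)\<^sup>2) integrable_on (convex hull S)" for j
    by (intro compact_integrable compact_simplex S continuous_intros cU)
  have t: "surf_int \<nu> c A (\<lambda>x. (U x $ j)\<^sup>2) \<le> C * integral (convex hull S) (\<lambda>x. (U x $ j)\<^sup>2)" for j
    unfolding C_def by (rule simplex_trace[OF S s r Uj A \<nu>])
  have "surf_int \<nu> c A (\<lambda>x. (norm (U x))\<^sup>2) = surf_int \<nu> c A (\<lambda>x. (U x $ 1)\<^sup>2)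
      + surf_int \<nu> c A (\<lambda>x. (U x $ 2)\<^sup>2) + surf_int \<nu> c A (\<lambda>x. (U x $ 3)\<^sup>2)"
    unfolding norm_square_3 by (simp add: surf_int_add A(1) cU continuous_intros)
  also have "\<dots> \<le> C * integral (convex hull S) (\<lambda>x. (U x $ 1)\<^sup>2)
      + C * integral (convex hull S) (\<lambda>x. (U x $ 2)\<^sup>2) + C * integral (convex hull S) (\<lambda>x. (U x $ 3)\<^sup>2)"
    by (intro add_mono t)
  also have "\<dots> = C * integral (convex hull S) (\<lambda>x. (norm (U x))\<^sup>2)"
    unfolding norm_square_3 by (simp add: integral_add iU integrable_add distrib_left)
  finally show ?thesis unfolding C_def .
qed

section \<open>Young's inequality on a face\<close>

definition avg_normsq :: "real \<Rightarrow> real \<Rightarrow> ((real, 'n) vec \<Rightarrow> real^3) \<Rightarrow> ((real, 'n) vec \<Rightarrow> real^3) \<Rightarrow> (real, 'n) vec \<Rightarrow> real" where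
  "avg_normsq hf pf a2 a3 x = hf ^ 3 / pf ^ 6 * (norm (a3 x))\<^sup>2 + hf / pf ^ 2 * (norm (a2 x))\<^sup>2"

lemma continuous_avg_normsq:
  "continuous_on A a2 \<Longrightarrow> continuous_on A a3 \<Longrightarrow> continuous_on A (avg_normsq hf pf a2 a3)"
  unfolding avg_normsq_def[abs_def] by (intro continuous_intros)

lemma young_inner:
  fixes u v :: "'a::real_inner"
  assumes "0 < X"
  shows "- (X * (norm u)\<^sup>2 + (norm v)\<^sup>2 / X) \<le> 2 * (u \<bullet> v)"
proof -
  have "0 \<le> (norm (X *\<^sub>R u + v))\<^sup>2" by simp
  also have "\<dots> = X * (X * (norm u)\<^sup>2 + 2 * (u \<bullet> v) + (norm v)\<^sup>2 / X)"
    using assms unfolding power2_norm_eq_inner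
    by (simp add: inner_add_left inner_add_right inner_commute field_simps)
  finally show ?thesis using assms by (simp add: zero_le_mult_iff)
qed

text \<open>With equal arguments each consistency term occurs twice, and Young's inequality is
  applied with c times the inverse penalty weight. Of the threshold 1/c + c, the part 1/c pays for
  the jump produced by Young and c is left for the norm. The averages are charged twice, by Young
  and by the norm, hence 2c.\<close>

lemma face_form_lower_bound:
  assumes "0 < hf" "0 < pf" "0 < c" "1 / c + c \<le> \<eta>1" "1 / c + c \<le> \<eta>2"
  shows "c * face_normsq hf pf j jc a2 a3 x - 2 * c * avg_normsq hf pf a2 a3 x
    \<le> face_form \<eta>1 \<eta>2 hf pf j jc a2 a3 j jc a2 a3 x"
proof -
  define X Y where "X = hf ^ 3 / pf ^ 6" and "Y = hf / pf ^ 2"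
  have X: "0 < X" "pf ^ 6 / hf ^ 3 = 1 / X" and Y: "0 < Y" "pf ^ 2 / hf = 1 / Y"
    using assms by (simp_all add: X_def Y_def)
  have y1: "- (c * X * (norm (a3 x))\<^sup>2 + (norm (j x))\<^sup>2 / (c * X)) \<le> 2 * (a3 x \<bullet> j x)"
    by (rule young_inner) (use X assms in simp)
  have y2: "- (c * Y * (norm (a2 x))\<^sup>2 + (norm (jc x))\<^sup>2 / (c * Y)) \<le> 2 * (a2 x \<bullet> jc x)"
    by (rule young_inner) (use Y assms in simp)
  have p1: "(1 / c + c) * ((norm (jc x))\<^sup>2 / Y) \<le> \<eta>1 * ((norm (jc x))\<^sup>2 / Y)"
    by (rule mult_right_mono) (use assms Y in auto)
  have p2: "(1 / c + c) * ((norm (j x))\<^sup>2 / X) \<le> \<eta>2 * ((norm (j x))\<^sup>2 / X)"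
    by (rule mult_right_mono) (use assms X in auto)
  have form: "face_form \<eta>1 \<eta>2 hf pf j jc a2 a3 j jc a2 a3 x = 2 * (a3 x \<bullet> j x) + 2 * (a2 x \<bullet> jc x)
      + \<eta>1 * ((norm (jc x))\<^sup>2 / Y) + \<eta>2 * ((norm (j x))\<^sup>2 / X)"
    unfolding face_form_def power2_norm_eq_inner
    using X(2) Y(2) by (simp flip: times_divide_eq_right) (simp add: times_divide_eq_right)
  have ns: "face_normsq hf pf j jc a2 a3 x = (norm (j x))\<^sup>2 / X + X * (norm (a3 x))\<^sup>2
      + Y * (norm (a2 x))\<^sup>2 + (norm (jc x))\<^sup>2 / Y"
    unfolding face_normsq_def X Y X_def[symmetric] Y_def[symmetric] by simp
  have av: "avg_normsq hf pf a2 a3 x = X * (norm (a3 x))\<^sup>2 + Y * (norm (a2 x))\<^sup>2"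
    by (simp add: avg_normsq_def X_def Y_def)
  have d: "(1 / c + c) * (t / Z) = t / (c * Z) + c * (t / Z)" for t Z :: real
    by (simp add: distrib_right add_divide_distrib)
  show ?thesis unfolding form ns av using y1 y2 p1[unfolded d] p2[unfolded d]
    by (simp only: distrib_left mult.assoc)
qed

lemma surf_face_form_lower_bound:
  assumes "0 < hf" "0 < pf" "0 < c" "1 / c + c \<le> \<eta>1" "1 / c + c \<le> \<eta>2" and A: "compact A"
    and cont: "continuous_on UNIV j" "continuous_on UNIV jc" "continuous_on UNIV a2" "continuous_on UNIV a3"
  shows "c * surf_int \<nu> b A (face_normsq hf pf j jc a2 a3) - 2 * c * surf_int \<nu> b A (avg_normsq hf pf a2 a3)
    \<le> surf_int \<nu> b A (face_form \<eta>1 \<eta>2 hf pf j jc a2 a3 j jc a2 a3)"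
proof -
  have cn: "continuous_on UNIV (face_normsq hf pf j jc a2 a3)"
    unfolding face_normsq_def[abs_def] by (intro continuous_intros cont)
  have cf: "continuous_on UNIV (face_form \<eta>1 \<eta>2 hf pf j jc a2 a3 j jc a2 a3)"
    unfolding face_form_def[abs_def] by (intro continuous_intros cont)
  have ca: "continuous_on UNIV (avg_normsq hf pf a2 a3)" by (intro continuous_avg_normsq cont)
  have "c * surf_int \<nu> b A (face_normsq hf pf j jc a2 a3) + (- 2 * c) * surf_int \<nu> b A (avg_normsq hf pf a2 a3)
      = surf_int \<nu> b A (\<lambda>x. c * face_normsq hf pf j jc a2 a3 x + (- 2 * c) * avg_normsq hf pf a2 a3 x)"
    by (subst surf_int_add) (simp_all only: surf_int_cmult A continuous_on_mult continuous_on_const cn ca)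
  also have "\<dots> \<le> surf_int \<nu> b A (face_form \<eta>1 \<eta>2 hf pf j jc a2 a3 j jc a2 a3)"
    using face_form_lower_bound[OF assms(1-5)]
    by (intro surf_int_mono A continuous_intros cn ca cf) simp
  finally show ?thesis by simp
qed

subsection \<open>Average terms are controlled by the element energies\<close>

text \<open>The radius and p + 1 are replaced by the diameter and p through 1/r <= 2 \<sigma>/h and
  p + 1 <= 2p. Thus 32 = 4 * 2^2 * 2 and 768 = 12 * 2^4 * 2^2.\<close>

lemma scaled_inverse_bounds:
  fixes S :: "(real, 'n::{finite,linorder}) vec set"
  assumes S: "simplex_verts S" and s: "s \<in> S"
    and \<sigma>: "0 < \<sigma>" "diameter (convex hull S) \<le> \<sigma> * inradius (convex hull S)"
    and U: "poly_field p U" and p: "1 \<le> p" and A: "compact A" "A \<subseteq> facet S s"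
    and \<nu>: "(\<nu> = outnormal S s \<and> c = hyp_off S s) \<or> (\<nu> = - outnormal S s \<and> c = - hyp_off S s)"
  shows "surf_int \<nu> c A (\<lambda>x. (norm (U x))\<^sup>2) \<le> 32 * \<sigma> * 2 ^ CARD('n) *
      ((real p)\<^sup>2 / diameter (convex hull S)) * integral (convex hull S) (\<lambda>x. (norm (U x))\<^sup>2)" (is ?trace)
    and "integral (convex hull S) (\<lambda>x. (norm (curl U x))\<^sup>2) \<le> 768 * \<sigma>\<^sup>2 * (real CARD('n) + 1) ^ 5 *
      ((real p) ^ 4 / (diameter (convex hull S))\<^sup>2) * integral (convex hull S) (\<lambda>x. (norm (U x))\<^sup>2)" (is ?markov)
proof -
  define h where "h = diameter (convex hull S)"
  define I where "I = integral (convex hull S) (\<lambda>x. (norm (U x))\<^sup>2)"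
  have h: "0 < h" unfolding h_def by (rule diameter_simplex_pos[OF S])
  have I: "0 \<le> I" unfolding I_def
    by (intro integral_nonneg compact_integrable compact_simplex S continuous_intros poly_field_continuous[OF U]) auto
  from shape_regular_ball[OF S \<sigma>] obtain x0 r
    where r: "0 < r" "ball x0 r \<subseteq> convex hull S" and hr: "h \<le> 2 * \<sigma> * r" unfolding h_def .
  have inv: "1 / r \<le> 2 * \<sigma> / h" using hr r h by (simp add: field_simps)
  have p2: "real p + 1 \<le> 2 * real p" using p by simp
  have "surf_int \<nu> c A (\<lambda>x. (norm (U x))\<^sup>2) \<le> 4 * (real p + 1)\<^sup>2 * 2 ^ CARD('n) * (1 / r) * I"
    using field_trace[OF S s r U A \<nu>] by (simp add: I_def)
  also have "\<dots> \<le> 4 * (2 * real p)\<^sup>2 * 2 ^ CARD('n) * (2 * \<sigma> / h) * I"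
    using I p2 inv r by (intro mult_right_mono mult_mono mult_nonneg_nonneg power_mono) auto
  also have "\<dots> = 32 * \<sigma> * 2 ^ CARD('n) * ((real p)\<^sup>2 / h) * I" by (simp add: power_mult_distrib)
  finally show ?trace by (simp only: h_def I_def)
  have "integral (convex hull S) (\<lambda>x. (norm (curl U x))\<^sup>2)
      \<le> 12 * (real CARD('n) + 1) ^ 5 * (real p + 1) ^ 4 * (1 / r)\<^sup>2 * I"
    using curl_markov[OF S r U] by (simp add: I_def power_divide)
  also have "\<dots> \<le> 12 * (real CARD('n) + 1) ^ 5 * (2 * real p) ^ 4 * (2 * \<sigma> / h)\<^sup>2 * I"
    using I p2 inv r by (intro mult_right_mono mult_mono mult_nonneg_nonneg power_mono) auto
  also have "\<dots> = 768 * \<sigma>\<^sup>2 * (real CARD('n) + 1) ^ 5 * ((real p) ^ 4 / h\<^sup>2) * I"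
    by (simp add: power_mult_distrib power_divide)
  finally show ?markov by (simp only: h_def I_def)
qed

text \<open>The first summand belongs to the third curl, with trace and Markov constants multiplied,
  the second to the second curl, with the trace constant alone. The exponents 9 = 3 + 6 and 3 = 1 +
  2 add those of h and p in the two weights.\<close>

definition avg_const :: "real \<Rightarrow> nat \<Rightarrow> real" where
  "avg_const \<sigma> d = (max 1 \<sigma>) ^ 9 * (32 * \<sigma> * 2 ^ d) * (768 * \<sigma>\<^sup>2 * (real d + 1) ^ 5)
     + (max 1 \<sigma>) ^ 3 * (32 * \<sigma> * 2 ^ d)"

lemma avg_const_nonneg: "0 < \<sigma> \<Longrightarrow> 0 \<le> avg_const \<sigma> d"
  by (simp add: avg_const_def)

text \<open>The weights cancel the powers from the inverse inequalities up to the ratios hf / h and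
  p / pf. A face may take its size or degree from the neighbour, so the ratios are bounded by max 1
  \<sigma> and not by 1.\<close>

lemma element_avg_bound:
  fixes S :: "(real, 'n::{finite,linorder}) vec set"
  assumes S: "simplex_verts S" and s: "s \<in> S"
    and \<sigma>: "0 < \<sigma>" "diameter (convex hull S) \<le> \<sigma> * inradius (convex hull S)"
    and U: "poly_field p U" and p: "1 \<le> p" and A: "compact A" "A \<subseteq> facet S s"
    and \<nu>: "(\<nu> = outnormal S s \<and> c = hyp_off S s) \<or> (\<nu> = - outnormal S s \<and> c = - hyp_off S s)"
    and hf: "0 < hf" "hf \<le> max 1 \<sigma> * diameter (convex hull S)"
    and pf: "0 < pf" "real p \<le> max 1 \<sigma> * pf"
  shows "surf_int \<nu> c A (avg_normsq hf pf U (curl U))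
    \<le> avg_const \<sigma> CARD('n) * integral (convex hull S) (\<lambda>x. (norm (U x))\<^sup>2)"
proof -
  define h I M where "h = diameter (convex hull S)" and "I = integral (convex hull S) (\<lambda>x. (norm (U x))\<^sup>2)"
    and "M = max 1 \<sigma>"
  define Ct Cm where "Ct = 32 * \<sigma> * 2 ^ CARD('n)" and "Cm = 768 * \<sigma>\<^sup>2 * (real CARD('n) + 1) ^ 5"
  have pos: "0 \<le> Ct" "0 \<le> Cm" using \<sigma>(1) by (auto simp: Ct_def Cm_def)
  have h: "0 < h" unfolding h_def by (rule diameter_simplex_pos[OF S])
  have I: "0 \<le> I" unfolding I_def
    by (intro integral_nonneg compact_integrable compact_simplex S continuous_intros poly_field_continuous[OF U]) auto
  have cU: "poly_field p (curl U)" by (rule poly_field_curl[OF U])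
  define P where "P = real p"
  have P: "0 < P" using p by (simp add: P_def)
  have q: "0 \<le> hf / h" "hf / h \<le> M" "0 \<le> P / pf" "P / pf \<le> M"
    using hf pf h P by (auto simp: h_def[symmetric] M_def[symmetric] P_def[symmetric] field_simps)
  have t2: "surf_int \<nu> c A (\<lambda>x. (norm (U x))\<^sup>2) \<le> Ct * (P\<^sup>2 / h) * I"
    unfolding Ct_def h_def I_def P_def by (rule scaled_inverse_bounds(1)[OF S s \<sigma> U p A \<nu>])
  have "surf_int \<nu> c A (\<lambda>x. (norm (curl U x))\<^sup>2)
      \<le> Ct * (P\<^sup>2 / h) * integral (convex hull S) (\<lambda>x. (norm (curl U x))\<^sup>2)"
    unfolding Ct_def h_def P_def by (rule scaled_inverse_bounds(1)[OF S s \<sigma> cU p A \<nu>])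
  also have "\<dots> \<le> Ct * (P\<^sup>2 / h) * (Cm * (P ^ 4 / h\<^sup>2) * I)"
    using scaled_inverse_bounds(2)[OF S s \<sigma> U p A \<nu>] pos h
    by (intro mult_left_mono) (auto simp: Cm_def h_def I_def P_def)
  finally have t3: "surf_int \<nu> c A (\<lambda>x. (norm (curl U x))\<^sup>2) \<le> Ct * (P\<^sup>2 / h) * (Cm * (P ^ 4 / h\<^sup>2) * I)" .
  have "surf_int \<nu> c A (avg_normsq hf pf U (curl U)) =
      hf ^ 3 / pf ^ 6 * surf_int \<nu> c A (\<lambda>x. (norm (curl U x))\<^sup>2) + hf / pf ^ 2 * surf_int \<nu> c A (\<lambda>x. (norm (U x))\<^sup>2)"
    unfolding avg_normsq_def[abs_def]
    by (subst surf_int_add) (auto simp only: surf_int_cmult intro!: A continuous_intros poly_field_continuous[OF U] poly_field_continuous[OF cU])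
  also have "\<dots> \<le> hf ^ 3 / pf ^ 6 * (Ct * (P\<^sup>2 / h) * (Cm * (P ^ 4 / h\<^sup>2) * I)) + hf / pf ^ 2 * (Ct * (P\<^sup>2 / h) * I)"
    using hf pf by (intro add_mono mult_left_mono t2 t3) auto
  also have "\<dots> = (hf / h) ^ 3 * (P / pf) ^ 6 * (Ct * Cm * I) + (hf / h) * (P / pf)\<^sup>2 * (Ct * I)"
  proof -
    have "P ^ 6 = P\<^sup>2 * P ^ 4" "h ^ 3 = h * h\<^sup>2" by (simp_all add: eval_nat_numeral)
    then show ?thesis by (simp add: power_divide mult_ac)
  qed
  also have "\<dots> \<le> M ^ 3 * M ^ 6 * (Ct * Cm * I) + M * M\<^sup>2 * (Ct * I)"
    using q pos I by (intro add_mono mult_mono power_mono mult_nonneg_nonneg zero_le_power) auto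
  also have "\<dots> = avg_const \<sigma> CARD('n) * I"
  proof -
    have "M ^ 9 = M ^ 3 * M ^ 6" "M ^ 3 = M * M\<^sup>2" by (simp_all add: eval_nat_numeral)
    then show ?thesis unfolding avg_const_def Ct_def[symmetric] Cm_def[symmetric] M_def[symmetric]
      by (simp add: algebra_simps)
  qed
  finally show ?thesis unfolding I_def .
qed

lemma norm_square_mean:
  fixes u v :: "'a::real_inner"
  shows "(norm ((1/2) *\<^sub>R (u + v)))\<^sup>2 \<le> 1/2 * ((norm u)\<^sup>2 + (norm v)\<^sup>2)"
proof -
  have "0 \<le> (norm (u - v))\<^sup>2" by simp
  then show ?thesis unfolding power2_norm_eq_inner
    by (simp add: inner_add_left inner_add_right inner_diff_left inner_diff_right inner_commute)
qed

definition curl2_energy :: "('n::{finite,linorder}) dgfun \<Rightarrow> (real, 'n) vec set \<Rightarrow> real" where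
  "curl2_energy V S = integral (convex hull S) (\<lambda>x. (norm (cu 2 V S x))\<^sup>2)"

lemma cu_3: "cu 3 V S = curl (cu 2 V S)"
  by (simp add: cu_def numeral_3_eq_3 numeral_2_eq_2)

text \<open>Convexity of the squared norm splits the average into one-sided terms, each estimated on
  its own element.\<close>

lemma interior_avg_bound:
  fixes V :: "('n::{finite,linorder}) dgfun"
  assumes T: "mesh_of \<Omega> T" and reg: "shape_regular \<sigma> T p" and p: "\<forall>S\<in>T. 2 \<le> p S"
    and V: "V \<in> Vh T p" and \<sigma>: "0 < \<sigma>"
    and S: "S1 \<in> T" "S2 \<in> T" "S1 \<noteq> S2" "s1 \<in> S1" "s2 \<in> S2"
  shows "surf_int (outnormal S1 s1) (hyp_off S1 s1) (facet S1 s1 \<inter> facet S2 s2)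
      (avg_normsq (hface S1 S2) (pface p S1 S2) (iavg 2 V S1 S2) (iavg 3 V S1 S2))
    \<le> (if face_neighbors S1 S2 then avg_const \<sigma> CARD('n) * (curl2_energy V S1 + curl2_energy V S2) / 2 else 0)"
proof (cases "negligible (cylinder (outnormal S1 s1) (facet S1 s1 \<inter> facet S2 s2))")
  case True
  \<comment> \<open>Here the integral is 0, but the elements may still be neighbours through another
    pair of facets, so the right side must be seen to be nonnegative.\<close>
  have "0 \<le> curl2_energy V S" if "S \<in> T" for S
    unfolding curl2_energy_def using T that
    by (intro integral_nonneg compact_integrable compact_simplex continuous_intros
        poly_field_continuous[OF poly_field_cu[OF V that]]) (auto simp: mesh_of_def)
  then show ?thesis using S avg_const_nonneg[OF \<sigma>, of "CARD('n)"] by (simp add: surf_int_negligible[OF True])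
next
  case False
  define A where "A = facet S1 s1 \<inter> facet S2 s2"
  define \<nu> c where "\<nu> = outnormal S1 s1" and "c = hyp_off S1 s1"
  define hf pf where "hf = hface S1 S2" and "pf = pface p S1 S2"
  define J where "J = (\<lambda>S. surf_int \<nu> c A (avg_normsq hf pf (cu 2 V S) (cu 3 V S)))"
  have sv: "simplex_verts S1" "simplex_verts S2" using T S by (auto simp: mesh_of_def)
  have nb: "face_neighbors S1 S2" using False S by (auto simp: face_neighbors_iff sv)
  have nb': "face_neighbors S2 S1" by (rule face_neighbors_sym[OF sv nb])
  have A: "compact A" unfolding A_def by (intro compact_Int compact_facet sv)
  have d: "0 < diameter (convex hull S1)" "0 < diameter (convex hull S2)"
    using diameter_simplex_pos sv by auto
  have pp: "2 \<le> p S1" "2 \<le> p S2" using p S by auto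
  have hf: "0 < hf" using d by (simp add: hf_def hface_def)
  have pf: "0 < pf" using pp by (simp add: pf_def pface_def)
  have cmp: "diameter (convex hull S1) \<le> \<sigma> * diameter (convex hull S2)" "real (p S1) \<le> \<sigma> * real (p S2)"
    "diameter (convex hull S2) \<le> \<sigma> * diameter (convex hull S1)" "real (p S2) \<le> \<sigma> * real (p S1)"
    using reg nb nb' S(1,2) unfolding shape_regular_def by blast+
  have inr: "diameter (convex hull S1) \<le> \<sigma> * inradius (convex hull S1)"
    "diameter (convex hull S2) \<le> \<sigma> * inradius (convex hull S2)"
    using reg S(1,2) unfolding shape_regular_def by blast+
  define M where "M = max 1 \<sigma>"
  have M: "1 \<le> M" by (simp add: M_def)
  have up: "t \<le> M * t" if "0 \<le> t" for t
    using that mult_right_mono[of 1 M t] by (simp add: M_def)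
  have up\<sigma>: "t' \<le> M * t" if "t' \<le> \<sigma> * t" "0 \<le> t" for t t'
    using that mult_right_mono[of \<sigma> M t] by (simp add: M_def)
  have hfM: "hf \<le> M * diameter (convex hull S1)" "hf \<le> M * diameter (convex hull S2)"
    unfolding hf_def hface_def using cmp d M by (auto intro!: max.boundedI intro: up\<sigma> less_imp_le)
  have pfM: "real (p S1) \<le> M * pf" "real (p S2) \<le> M * pf"
    unfolding pf_def pface_def min_def using cmp by (auto intro: up up\<sigma>)
  note hfM = hfM[unfolded M_def] and pfM = pfM[unfolded M_def]
  have cu: "poly_field (p S1) (cu 2 V S1)" "poly_field (p S2) (cu 2 V S2)"
    using poly_field_cu[OF V] S by auto
  have J1: "J S1 \<le> avg_const \<sigma> CARD('n) * curl2_energy V S1"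
    unfolding J_def curl2_energy_def cu_3
    by (rule element_avg_bound[OF sv(1) S(4) \<sigma> inr(1) cu(1) _ A _ _ hf hfM(1) pf pfM(1)])
       (use pp in \<open>auto simp: A_def \<nu>_def c_def\<close>)
  \<comment> \<open>The normal and offset are those of \<open>S1\<close>; seen from
    \<open>S2\<close> they agree up to a common sign, which is the alternative in
    \<open>element_avg_bound\<close>.\<close>
  have J2: "J S2 \<le> avg_const \<sigma> CARD('n) * curl2_energy V S2"
    unfolding J_def curl2_energy_def cu_3
    by (rule element_avg_bound[OF sv(2) S(5) \<sigma> inr(2) cu(2) _ A _ _ hf hfM(2) pf pfM(2)])
       (use pp facet_intersection_cases[OF sv S(4,5) False] in \<open>auto simp: A_def \<nu>_def c_def\<close>)
  have cc: "continuous_on B (cu k V S1)" "continuous_on B (cu k V S2)" for B k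
    using poly_field_continuous poly_field_cu[OF V] S by blast+
  have "surf_int \<nu> c A (avg_normsq hf pf (iavg 2 V S1 S2) (iavg 3 V S1 S2))
      \<le> surf_int \<nu> c A (\<lambda>x. 1/2 * avg_normsq hf pf (cu 2 V S1) (cu 3 V S1) x
          + 1/2 * avg_normsq hf pf (cu 2 V S2) (cu 3 V S2) x)"
  proof (rule surf_int_mono[OF A])
    show "continuous_on UNIV (avg_normsq hf pf (iavg 2 V S1 S2) (iavg 3 V S1 S2))"
      unfolding iavg_def[abs_def] by (intro continuous_avg_normsq continuous_intros cc)
    show "continuous_on UNIV (\<lambda>x. 1/2 * avg_normsq hf pf (cu 2 V S1) (cu 3 V S1) x
          + 1/2 * avg_normsq hf pf (cu 2 V S2) (cu 3 V S2) x)"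
      by (intro continuous_intros continuous_avg_normsq cc)
    fix x
    have "avg_normsq hf pf (iavg 2 V S1 S2) (iavg 3 V S1 S2) x
        \<le> hf ^ 3 / pf ^ 6 * (1/2 * ((norm (cu 3 V S1 x))\<^sup>2 + (norm (cu 3 V S2 x))\<^sup>2))
          + hf / pf ^ 2 * (1/2 * ((norm (cu 2 V S1 x))\<^sup>2 + (norm (cu 2 V S2 x))\<^sup>2))"
      unfolding avg_normsq_def iavg_def using hf pf
      by (intro add_mono mult_left_mono norm_square_mean) auto
    also have "\<dots> = 1/2 * avg_normsq hf pf (cu 2 V S1) (cu 3 V S1) x
          + 1/2 * avg_normsq hf pf (cu 2 V S2) (cu 3 V S2) x"
      unfolding avg_normsq_def by (simp add: algebra_simps add_divide_distrib)
    finally show "avg_normsq hf pf (iavg 2 V S1 S2) (iavg 3 V S1 S2) x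
        \<le> 1/2 * avg_normsq hf pf (cu 2 V S1) (cu 3 V S1) x
          + 1/2 * avg_normsq hf pf (cu 2 V S2) (cu 3 V S2) x" .
  qed
  also have "\<dots> = 1/2 * J S1 + 1/2 * J S2"
    unfolding J_def
    by (subst surf_int_add[OF A]) (simp_all only: surf_int_cmult continuous_on_mult continuous_on_const continuous_avg_normsq cc)
  also have "\<dots> \<le> avg_const \<sigma> CARD('n) * (curl2_energy V S1 + curl2_energy V S2) / 2"
    using J1 J2 by (simp add: algebra_simps)
  finally show ?thesis using nb by (simp add: A_def \<nu>_def c_def hf_def pf_def)
qed

lemma boundary_avg_bound:
  fixes V :: "('n::{finite,linorder}) dgfun"
  assumes T: "mesh_of \<Omega> T" and reg: "shape_regular \<sigma> T p" and p: "\<forall>S\<in>T. 2 \<le> p S"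
    and V: "V \<in> Vh T p" and \<sigma>: "0 < \<sigma>" and S: "S \<in> T" "s \<in> S"
  shows "surf_int (outnormal S s) (hyp_off S s) (facet S s \<inter> frontier \<Omega>)
      (avg_normsq (diameter (convex hull S)) (real (p S)) (cu 2 V S) (cu 3 V S))
    \<le> avg_const \<sigma> CARD('n) * curl2_energy V S"
proof -
  have sv: "simplex_verts S" using T S by (auto simp: mesh_of_def)
  have inr: "diameter (convex hull S) \<le> \<sigma> * inradius (convex hull S)"
    using reg S(1) unfolding shape_regular_def by blast
  have A: "compact (facet S s \<inter> frontier \<Omega>)" by (intro compact_Int_closed compact_facet sv frontier_closed)
  have d: "0 < diameter (convex hull S)" using diameter_simplex_pos sv by auto
  have pp: "2 \<le> p S" using p S by auto
  have up: "t \<le> max 1 \<sigma> * t" if "0 \<le> t" for t :: real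
    using that mult_right_mono[of 1 "max 1 \<sigma>" t] by auto
  show ?thesis unfolding curl2_energy_def cu_3
    by (rule element_avg_bound[OF sv S(2) \<sigma> inr poly_field_cu[OF V S(1)] _ A _ _ d])
       (use pp up d in auto)
qed

section \<open>Summation over the mesh\<close>

lemma neighbour_sum_bound:
  fixes E :: "'a \<Rightarrow> real"
  assumes "finite T" "\<And>S. S \<in> T \<Longrightarrow> 0 \<le> E S"
    and sym: "\<And>S S'. S \<in> T \<Longrightarrow> S' \<in> T \<Longrightarrow> R S S' \<Longrightarrow> R S' S"
    and card: "\<And>S. S \<in> T \<Longrightarrow> real (card {S' \<in> T. R S S'}) \<le> N"
  shows "(\<Sum>S\<in>T. \<Sum>S'\<in>T. if R S S' then E S + E S' else 0) \<le> 2 * N * (\<Sum>S\<in>T. E S)"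
proof -
  have one: "(\<Sum>S\<in>T. \<Sum>S'\<in>T. if R S S' then E S else 0) \<le> N * (\<Sum>S\<in>T. E S)"
  proof -
    have "(\<Sum>S'\<in>T. if R S S' then E S else 0) \<le> N * E S" if "S \<in> T" for S
    proof -
      have "(\<Sum>S'\<in>T. if R S S' then E S else 0) = real (card {S' \<in> T. R S S'}) * E S"
        using assms(1) by (simp add: sum.inter_filter[symmetric])
      then show ?thesis using card[OF that] assms(2)[OF that] by (simp add: mult_right_mono)
    qed
    then show ?thesis unfolding sum_distrib_left by (rule sum_mono)
  qed
  \<comment> \<open>Exchanging the sums and using the symmetry of \<open>R\<close> turns this half
    into the one already bounded.\<close>
  have "(\<Sum>S\<in>T. \<Sum>S'\<in>T. if R S S' then E S' else 0) = (\<Sum>S'\<in>T. \<Sum>S\<in>T. if R S S' then E S' else 0)"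
    by (rule sum.swap)
  also have "\<dots> = (\<Sum>S'\<in>T. \<Sum>S\<in>T. if R S' S then E S' else 0)"
    using sym by (intro sum.cong refl) auto
  finally have two: "(\<Sum>S\<in>T. \<Sum>S'\<in>T. if R S S' then E S' else 0) \<le> N * (\<Sum>S\<in>T. E S)"
    using one by simp
  have "(\<Sum>S\<in>T. \<Sum>S'\<in>T. if R S S' then E S + E S' else 0) =
      (\<Sum>S\<in>T. \<Sum>S'\<in>T. (if R S S' then E S else 0) + (if R S S' then E S' else 0))"
    by (intro sum.cong refl) auto
  then show ?thesis using one two by (simp add: sum.distrib)
qed

text \<open>Interior faces: (d+1)^2 pairs of facets for each pair of elements, times the bound on
  the number of neighbours. Boundary faces: d + 1 facets for each element.\<close>

definition avg_total_const :: "real \<Rightarrow> nat \<Rightarrow> real" where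
  "avg_total_const \<sigma> d = (real d + 1)\<^sup>2 * avg_const \<sigma> d * ((2 + \<sigma>) * (2 * \<sigma>\<^sup>2)) ^ d + (real d + 1) * avg_const \<sigma> d"

lemma avg_total_const_nonneg: "0 < \<sigma> \<Longrightarrow> 0 \<le> avg_total_const \<sigma> d"
  unfolding avg_total_const_def
  by (intro add_nonneg_nonneg mult_nonneg_nonneg avg_const_nonneg zero_le_power) auto

lemma total_avg_bound:
  fixes V :: "('n::{finite,linorder}) dgfun"
  assumes T: "mesh_of \<Omega> T" and reg: "shape_regular \<sigma> T p" and p: "\<forall>S\<in>T. 2 \<le> p S"
    and V: "V \<in> Vh T p" and \<sigma>: "0 < \<sigma>"
  shows "(\<Sum>S1\<in>T. \<Sum>s1\<in>S1. \<Sum>S2\<in>T - {S1}. \<Sum>s2\<in>S2. (1/2) *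
        surf_int (outnormal S1 s1) (hyp_off S1 s1) (facet S1 s1 \<inter> facet S2 s2)
          (avg_normsq (hface S1 S2) (pface p S1 S2) (iavg 2 V S1 S2) (iavg 3 V S1 S2)))
   + (\<Sum>S\<in>T. \<Sum>s\<in>S. surf_int (outnormal S s) (hyp_off S s) (facet S s \<inter> frontier \<Omega>)
          (avg_normsq (diameter (convex hull S)) (real (p S)) (cu 2 V S) (cu 3 V S)))
   \<le> avg_total_const \<sigma> CARD('n) * (\<Sum>S\<in>T. curl2_energy V S)" (is "?I + ?B \<le> _")
proof -
  define D where "D = real CARD('n) + 1"
  define C where "C = avg_const \<sigma> CARD('n)"
  define N where "N = ((2 + \<sigma>) * (2 * \<sigma>\<^sup>2)) ^ CARD('n)"
  define E where "E = curl2_energy V"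
  define W where "W = (\<lambda>S1 S2. if face_neighbors S1 S2 then E S1 + E S2 else 0)"
  have C: "0 \<le> C" unfolding C_def by (rule avg_const_nonneg[OF \<sigma>])
  have D: "0 < D" by (simp add: D_def)
  have fT: "finite T" and sv: "\<And>S. S \<in> T \<Longrightarrow> simplex_verts S" using T by (auto simp: mesh_of_def)
  have cS: "real (card S) = D" "finite S" if "S \<in> T" for S
    using sv[OF that] by (auto simp: simplex_verts_def D_def)
  have E: "0 \<le> E S" if "S \<in> T" for S
    unfolding E_def curl2_energy_def
    by (intro integral_nonneg compact_integrable compact_simplex sv that continuous_intros
        poly_field_continuous[OF poly_field_cu[OF V that]]) auto
  have W: "0 \<le> W S1 S2" if "S1 \<in> T" "S2 \<in> T" for S1 S2 using E that by (simp add: W_def)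
  \<comment> \<open>C / 4 combines the 1/2 for counting ordered pairs with the 1/2 from the
    average.\<close>
  have "?I \<le> (\<Sum>S1\<in>T. \<Sum>s1\<in>S1. \<Sum>S2\<in>T - {S1}. \<Sum>s2\<in>S2. C / 4 * W S1 S2)"
  proof (intro sum_mono)
    fix S1 s1 S2 s2 assume *: "S1 \<in> T" "s1 \<in> S1" "S2 \<in> T - {S1}" "s2 \<in> S2"
    show "(1/2) * surf_int (outnormal S1 s1) (hyp_off S1 s1) (facet S1 s1 \<inter> facet S2 s2)
          (avg_normsq (hface S1 S2) (pface p S1 S2) (iavg 2 V S1 S2) (iavg 3 V S1 S2)) \<le> C / 4 * W S1 S2"
    proof -
      have "surf_int (outnormal S1 s1) (hyp_off S1 s1) (facet S1 s1 \<inter> facet S2 s2)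
          (avg_normsq (hface S1 S2) (pface p S1 S2) (iavg 2 V S1 S2) (iavg 3 V S1 S2))
          \<le> (if face_neighbors S1 S2 then avg_const \<sigma> CARD('n) * (curl2_energy V S1 + curl2_energy V S2) / 2 else 0)"
        using * by (intro interior_avg_bound[OF T reg p V \<sigma>]) auto
      also have "\<dots> = C / 2 * W S1 S2" by (simp add: C_def W_def E_def)
      finally show ?thesis by simp
    qed
  qed
  also have "\<dots> = (\<Sum>S1\<in>T. \<Sum>S2\<in>T - {S1}. D\<^sup>2 * (C / 4) * W S1 S2)"
  proof (intro sum.cong refl)
    fix S1 assume "S1 \<in> T"
    then show "(\<Sum>s1\<in>S1. \<Sum>S2\<in>T - {S1}. \<Sum>s2\<in>S2. C / 4 * W S1 S2) = (\<Sum>S2\<in>T - {S1}. D\<^sup>2 * (C / 4) * W S1 S2)"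
      using cS by (simp add: sum_distrib_left power2_eq_square mult_ac)
  qed
  also have "\<dots> \<le> (\<Sum>S1\<in>T. \<Sum>S2\<in>T. D\<^sup>2 * (C / 4) * W S1 S2)"
    using fT C W by (intro sum_mono sum_mono2) auto
  also have "\<dots> = D\<^sup>2 * (C / 4) * (\<Sum>S1\<in>T. \<Sum>S2\<in>T. W S1 S2)" by (simp add: sum_distrib_left)
  also have "\<dots> \<le> D\<^sup>2 * (C / 4) * (2 * N * (\<Sum>S\<in>T. E S))"
    unfolding W_def N_def using C sv
    by (intro mult_left_mono neighbour_sum_bound fT E card_face_neighbors[OF T reg \<sigma>])
       (auto intro: face_neighbors_sym)
  also have "\<dots> \<le> D\<^sup>2 * C * N * (\<Sum>S\<in>T. E S)"
  proof -
    have "0 \<le> D\<^sup>2 * C * N * (\<Sum>S\<in>T. E S)"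
      using C E \<sigma> by (intro mult_nonneg_nonneg sum_nonneg) (auto simp: N_def)
    then show ?thesis by (simp add: mult_ac)
  qed
  finally have I: "?I \<le> D\<^sup>2 * C * N * (\<Sum>S\<in>T. E S)" .
  have "?B \<le> (\<Sum>S\<in>T. \<Sum>s\<in>S. C * E S)"
    unfolding C_def E_def by (intro sum_mono boundary_avg_bound[OF T reg p V \<sigma>])
  also have "\<dots> = D * C * (\<Sum>S\<in>T. E S)"
    using cS by (simp add: sum_distrib_left mult_ac)
  finally show ?thesis using I
    by (simp add: avg_total_const_def C_def D_def N_def E_def distrib_right)
qed

section \<open>Coercivity\<close>

lemma ah_coercive:
  fixes V :: "('n::{finite,linorder}) dgfun"
  assumes T: "mesh_of \<Omega> T" and reg: "shape_regular \<sigma> T p" and p: "\<forall>S\<in>T. 2 \<le> p S"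
    and V: "V \<in> Vh T p" and \<sigma>: "0 < \<sigma>"
    and c: "c = 1 / (2 * avg_total_const \<sigma> CARD('n) + 1)" "1 / c + c \<le> \<eta>1" "1 / c + c \<le> \<eta>2"
  shows "c * dg_normsq \<Omega> T p V \<le> ah \<Omega> T p \<eta>1 \<eta>2 V V"
proof -
  define Q where "Q = avg_total_const \<sigma> CARD('n)"
  have Q: "0 \<le> Q" unfolding Q_def by (rule avg_total_const_nonneg[OF \<sigma>])
  \<comment> \<open>The equation 2cQ = 1 - c is the reason for the value of c: the averages may
    consume exactly what the norm leaves of the volume energy.\<close>
  have c0: "0 < c" "2 * c * Q = 1 - c" using Q unfolding c(1) Q_def[symmetric] by (auto simp: field_simps)
  have sv: "\<And>S. S \<in> T \<Longrightarrow> simplex_verts S" using T by (auto simp: mesh_of_def)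
  have cc: "continuous_on B (cu k V S)" if "S \<in> T" for B k S
    using poly_field_continuous poly_field_cu[OF V that] by blast
  have d: "0 < diameter (convex hull S)" "0 < real (p S)" if "S \<in> T" for S
    using that p diameter_simplex_pos[OF sv] by force+
  define vol where "vol = (\<Sum>S\<in>T. integral (convex hull S) (\<lambda>x. (norm (cu 2 V S x))\<^sup>2 + (norm (V S x))\<^sup>2))"
  define E where "E = (\<Sum>S\<in>T. curl2_energy V S)"
  have VS: "continuous_on B (\<lambda>x. V S x)" if "S \<in> T" for B S
  proof -
    have "continuous_on B (\<lambda>x. \<chi> j. V S x $ j)"
      using V that unfolding Vh_def by (intro continuous_on_vec_lambda poly_le_continuous) blast
    then show ?thesis by simp
  qed
  have "E \<le> vol" unfolding E_def vol_def curl2_energy_def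
    by (intro sum_mono integral_le compact_integrable compact_simplex sv continuous_intros cc VS) auto
  then have vol: "2 * c * Q * E \<le> (1 - c) * vol"
    using c0 Q by (auto intro!: mult_left_mono) (metis c0(2) mult_nonneg_nonneg less_imp_le zero_le_numeral diff_ge_0_iff_ge)
  \<comment> \<open>The face sums as functions of the integrand, so that form, norm and averages are
    compared face by face under one pattern.\<close>
  define FI where "FI = (\<lambda>g :: (real, 'n) vec set \<Rightarrow> (real, 'n) vec \<Rightarrow> (real, 'n) vec set \<Rightarrow> (real, 'n) vec \<Rightarrow> (real, 'n) vec \<Rightarrow> real.
    \<Sum>S1\<in>T. \<Sum>s1\<in>S1. \<Sum>S2\<in>T - {S1}. \<Sum>s2\<in>S2. (1/2) *
        surf_int (outnormal S1 s1) (hyp_off S1 s1) (facet S1 s1 \<inter> facet S2 s2) (g S1 s1 S2 s2))"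
  define FB where "FB = (\<lambda>g :: (real, 'n) vec set \<Rightarrow> (real, 'n) vec \<Rightarrow> (real, 'n) vec \<Rightarrow> real.
    \<Sum>S\<in>T. \<Sum>s\<in>S. surf_int (outnormal S s) (hyp_off S s) (facet S s \<inter> frontier \<Omega>) (g S s))"
  define nI where "nI = (\<lambda>S1 s1 S2 s2. face_normsq (hface S1 S2) (pface p S1 S2)
             (ijump 0 V S1 s1 S2 s2) (ijump 1 V S1 s1 S2 s2) (iavg 2 V S1 S2) (iavg 3 V S1 S2))"
  define fI where "fI = (\<lambda>S1 s1 S2 s2. face_form \<eta>1 \<eta>2 (hface S1 S2) (pface p S1 S2)
             (ijump 0 V S1 s1 S2 s2) (ijump 1 V S1 s1 S2 s2) (iavg 2 V S1 S2) (iavg 3 V S1 S2)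
             (ijump 0 V S1 s1 S2 s2) (ijump 1 V S1 s1 S2 s2) (iavg 2 V S1 S2) (iavg 3 V S1 S2))"
  define aI where "aI = (\<lambda>S1 (s1 :: (real, 'n) vec) S2 (s2 :: (real, 'n) vec).
             avg_normsq (hface S1 S2) (pface p S1 S2) (iavg 2 V S1 S2) (iavg 3 V S1 S2))"
  define nB where "nB = (\<lambda>S s. face_normsq (diameter (convex hull S)) (real (p S))
             (bjump 0 V S s) (bjump 1 V S s) (cu 2 V S) (cu 3 V S))"
  define fB where "fB = (\<lambda>S s. face_form \<eta>1 \<eta>2 (diameter (convex hull S)) (real (p S))
             (bjump 0 V S s) (bjump 1 V S s) (cu 2 V S) (cu 3 V S)
             (bjump 0 V S s) (bjump 1 V S s) (cu 2 V S) (cu 3 V S))"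
  define aB where "aB = (\<lambda>S (s :: (real, 'n) vec). avg_normsq (diameter (convex hull S)) (real (p S)) (cu 2 V S) (cu 3 V S))"
  have ah: "ah \<Omega> T p \<eta>1 \<eta>2 V V = vol + FI fI + FB fB"
    unfolding ah_def vol_def FI_def FB_def fI_def fB_def power2_norm_eq_inner ..
  have dg: "dg_normsq \<Omega> T p V = vol + FI nI + FB nB"
    unfolding dg_normsq_def vol_def FI_def FB_def nI_def nB_def ..
  have avg: "FI aI + FB aB \<le> Q * E"
    unfolding FI_def FB_def aI_def aB_def Q_def E_def by (rule total_avg_bound[OF T reg p V \<sigma>])
  have "c * FI nI - 2 * c * FI aI =
      (\<Sum>S1\<in>T. \<Sum>s1\<in>S1. \<Sum>S2\<in>T - {S1}. \<Sum>s2\<in>S2. (1/2) *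
        (c * surf_int (outnormal S1 s1) (hyp_off S1 s1) (facet S1 s1 \<inter> facet S2 s2) (nI S1 s1 S2 s2)
        - 2 * c * surf_int (outnormal S1 s1) (hyp_off S1 s1) (facet S1 s1 \<inter> facet S2 s2) (aI S1 s1 S2 s2)))"
    unfolding FI_def sum_distrib_left sum_subtractf[symmetric] right_diff_distrib
    by (intro sum.cong refl) (simp add: mult_ac)
  also have "\<dots> \<le> FI fI"
    unfolding FI_def
  proof (intro sum_mono mult_left_mono)
    fix S1 s1 S2 s2 assume *: "S1 \<in> T" "s1 \<in> S1" "S2 \<in> T - {S1}" "s2 \<in> S2"
    then have S2: "S2 \<in> T" by simp
    have A: "compact (facet S1 s1 \<inter> facet S2 s2)" using * S2 sv by (intro compact_Int compact_facet) auto
    show "c * surf_int (outnormal S1 s1) (hyp_off S1 s1) (facet S1 s1 \<inter> facet S2 s2) (nI S1 s1 S2 s2)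
        - 2 * c * surf_int (outnormal S1 s1) (hyp_off S1 s1) (facet S1 s1 \<inter> facet S2 s2) (aI S1 s1 S2 s2)
        \<le> surf_int (outnormal S1 s1) (hyp_off S1 s1) (facet S1 s1 \<inter> facet S2 s2) (fI S1 s1 S2 s2)"
      unfolding nI_def aI_def fI_def
    proof (rule surf_face_form_lower_bound[OF _ _ c0(1) c(2,3) A])
      show "0 < hface S1 S2" using d[OF *(1)] by (simp add: hface_def)
      show "0 < pface p S1 S2" using d[OF *(1)] d[OF S2] by (simp add: pface_def)
      show "continuous_on UNIV (ijump 0 V S1 s1 S2 s2)" "continuous_on UNIV (ijump 1 V S1 s1 S2 s2)"
        unfolding ijump_def[abs_def]
        by (intro continuous_on_add continuous_on_cross continuous_on_const cc *(1) S2)+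
      show "continuous_on UNIV (iavg 2 V S1 S2)" "continuous_on UNIV (iavg 3 V S1 S2)"
        unfolding iavg_def[abs_def] by (intro continuous_intros cc *(1) S2)+
    qed
  qed simp
  finally have I: "c * FI nI - 2 * c * FI aI \<le> FI fI" .
  have "c * FB nB - 2 * c * FB aB =
      (\<Sum>S\<in>T. \<Sum>s\<in>S. c * surf_int (outnormal S s) (hyp_off S s) (facet S s \<inter> frontier \<Omega>) (nB S s)
        - 2 * c * surf_int (outnormal S s) (hyp_off S s) (facet S s \<inter> frontier \<Omega>) (aB S s))"
    unfolding FB_def sum_distrib_left sum_subtractf[symmetric] ..
  also have "\<dots> \<le> FB fB"
    unfolding FB_def
  proof (intro sum_mono)
    fix S s assume *: "S \<in> T" "s \<in> S"
    have A: "compact (facet S s \<inter> frontier \<Omega>)"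
      by (intro compact_Int_closed compact_facet sv * frontier_closed)
    show "c * surf_int (outnormal S s) (hyp_off S s) (facet S s \<inter> frontier \<Omega>) (nB S s)
        - 2 * c * surf_int (outnormal S s) (hyp_off S s) (facet S s \<inter> frontier \<Omega>) (aB S s)
        \<le> surf_int (outnormal S s) (hyp_off S s) (facet S s \<inter> frontier \<Omega>) (fB S s)"
      unfolding nB_def aB_def fB_def
    proof (rule surf_face_form_lower_bound[OF d[OF *(1)] c0(1) c(2,3) A])
      show "continuous_on UNIV (bjump 0 V S s)" "continuous_on UNIV (bjump 1 V S s)"
        unfolding bjump_def[abs_def] by (intro continuous_on_cross continuous_on_const cc *(1))+
    qed (intro cc *(1))+
  qed
  finally have B: "c * FB nB - 2 * c * FB aB \<le> FB fB" .
  have "2 * c * (FI aI + FB aB) \<le> 2 * c * (Q * E)" using avg c0 by (intro mult_left_mono) auto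
  then have "2 * c * FI aI + 2 * c * FB aB \<le> (1 - c) * vol" using vol by (simp add: algebra_simps)
  then show ?thesis unfolding ah dg using I B by (simp add: algebra_simps)
qed

theorem theorem3p1:
  assumes "CARD('n::{finite,linorder}) = 2 \<or> CARD('n) = 3"
  shows "\<forall>\<sigma>>0. \<exists>\<eta>1s>0. \<exists>\<eta>2s>0. \<exists>c>0.
     \<forall>(\<Omega>::((real,'n) vec) set) T p \<eta>1 \<eta>2 V.
       admissible_domain \<Omega> \<and> mesh_of \<Omega> T \<and> shape_regular \<sigma> T p \<and> (\<forall>S\<in>T. 2 \<le> p S)
       \<and> \<eta>1 > \<eta>1s \<and> \<eta>2 > \<eta>2s \<and> V \<in> Vh T p
       \<longrightarrow> ah \<Omega> T p \<eta>1 \<eta>2 V V \<ge> c * dg_normsq \<Omega> T p V"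
proof (intro allI impI)
  fix \<sigma> :: real assume \<sigma>: "0 < \<sigma>"
  \<comment> \<open>Built from \<sigma> and the dimension alone, before domain, mesh and degrees are
    chosen; both thresholds will be 1 / c + c.\<close>
  define c where "c = 1 / (2 * avg_total_const \<sigma> CARD('n) + 1)"
  have c: "0 < c" unfolding c_def using avg_total_const_nonneg[OF \<sigma>, of "CARD('n)"] by simp
  have "\<forall>(\<Omega>::((real,'n) vec) set) T p \<eta>1 \<eta>2 V.
       admissible_domain \<Omega> \<and> mesh_of \<Omega> T \<and> shape_regular \<sigma> T p \<and> (\<forall>S\<in>T. 2 \<le> p S)
       \<and> \<eta>1 > 1 / c + c \<and> \<eta>2 > 1 / c + c \<and> V \<in> Vh T p
       \<longrightarrow> ah \<Omega> T p \<eta>1 \<eta>2 V V \<ge> c * dg_normsq \<Omega> T p V"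
    using ah_coercive[OF _ _ _ _ \<sigma> c_def] less_imp_le by blast
  moreover have "0 < 1 / c + c" using c by (simp add: add_pos_pos)
  ultimately show "\<exists>\<eta>1s>0. \<exists>\<eta>2s>0. \<exists>c>0.
     \<forall>(\<Omega>::((real,'n) vec) set) T p \<eta>1 \<eta>2 V.
       admissible_domain \<Omega> \<and> mesh_of \<Omega> T \<and> shape_regular \<sigma> T p \<and> (\<forall>S\<in>T. 2 \<le> p S)
       \<and> \<eta>1 > \<eta>1s \<and> \<eta>2 > \<eta>2s \<and> V \<in> Vh T p
       \<longrightarrow> ah \<Omega> T p \<eta>1 \<eta>2 V V \<ge> c * dg_normsq \<Omega> T p V"
    using c by blast
qed

end
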